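(* Let $S(t)$ be the contraction semigroup on ${\mathfrak A}$ generated by the operator ${\mathbb A}$ described in the context, and assume moreover that there is $\delta>0$ such that $\mu'(s)+\delta\mu(s)\le0$ for almost every $s\in\Omega$. Then there exist $K>1$ and $\omega>0$ such that $$\|S(t)z\|_{\mathfrak A}\le K\|z\|_{\mathfrak A}\,{\rm e}^{-\omega t}\qquad\text{for every }z\in{\mathfrak A}\text{ and every }t\ge0.$$
   Context: $H$ is a separable real Hilbert space and $A$ is a selfadjoint strictly positive linear operator on $H$ with compact inverse and dense domain ${\mathcal D}(A)$; $V={\mathcal D}(A^{1/2})$ with norm $\|u\|_V=\|A^{1/2}u\|_H$. Let $\ell\in(0,\infty]$, $\Omega=(0,\ell)$. The kernel $\mu:\Omega\to(0,\infty)$ is nonincreasing, summable, absolutely continuous on every closed interval contained in $\Omega$, and, if $\ell<\infty$, continuous at $\ell$ with $\mu(\ell)=0$. Functions on $\Omega$ are understood to be $0$ outside $\Omega$. $\nu=1/\mu$; ${\mathcal V}=L^2_\nu(\Omega;V)$ with norm $\|\xi\|_{\mathcal V}^2=\int_0^\ell\nu\|\xi\|_V^2$. $D$ denotes distributional derivative; $P\xi=D\xi$ on ${\mathcal D}(P)=\{\xi\in{\mathcal V}:D\xi\in{\mathcal V},\ \lim_{\tau\to\ell}\xi(\tau)=0\text{ in }V\}$. ${\mathfrak A}=V\times H\times{\mathcal V}$ with $\|(u,v,\xi)\|_{\mathfrak A}^2=\|u\|_V^2+\|v\|_H^2+\|\xi\|_{\mathcal V}^2$. ${\mathbb A}$ has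 domain $\{(u,v,\xi)\in{\mathfrak A}: v\in V,\ u+\int_0^\ell\xi\,{\rm d}\tau\in{\mathcal D}(A),\ \xi\in{\mathcal D}(P)\}$ and acts as ${\mathbb A}(u,v,\xi)=(v,-A[u+\int_0^\ell\xi(\tau){\rm d}\tau],P\xi+\mu v)$; it generates a contraction semigroup $S(t)$ on ${\mathfrak A}$. *)

theory Defs
  imports "HOL-Analysis.Analysis"
begin

definition abs_cont_on_interval :: "(real \<Rightarrow> real) \<Rightarrow> real \<Rightarrow> real \<Rightarrow> bool" where
  "abs_cont_on_interval f a b \<longleftrightarrow>
     (\<forall>\<epsilon>>0. \<exists>d>0. \<forall>(n::nat) (x::nat \<Rightarrow> real) (y::nat \<Rightarrow> real).
        (\<forall>i<n. a \<le> x i \<and> x i \<le> y i \<and> y i \<le> b) \<and>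
        (\<forall>i<n. \<forall>j<n. i \<noteq> j \<longrightarrow> y i \<le> x j \<or> y j \<le> x i) \<and>
        (\<Sum>i<n. y i - x i) < d
        \<longrightarrow> (\<Sum>i<n. \<bar>f (y i) - f (x i)\<bar>) < \<epsilon>)"

definition linear_op :: "'h::real_vector set \<Rightarrow> ('h \<Rightarrow> 'h) \<Rightarrow> bool" where
  "linear_op D T \<longleftrightarrow> subspace D \<and>
     (\<forall>x\<in>D. \<forall>y\<in>D. \<forall>a b::real. T (a *\<^sub>R x + b *\<^sub>R y) = a *\<^sub>R T x + b *\<^sub>R T y)"

definition adj_dom :: "'h::real_inner set \<Rightarrow> ('h \<Rightarrow> 'h) \<Rightarrow> 'h set" where
  "adj_dom D T = {v. \<exists>w. \<forall>u\<in>D. inner (T u) v = inner u w}"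

definition selfadjoint_op :: "'h::real_inner set \<Rightarrow> ('h \<Rightarrow> 'h) \<Rightarrow> bool" where
  "selfadjoint_op D T \<longleftrightarrow> linear_op D T \<and> closure D = UNIV \<and>
     adj_dom D T = D \<and> (\<forall>u\<in>D. \<forall>v\<in>D. inner (T u) v = inner u (T v))"

definition strictly_positive_op :: "'h::real_inner set \<Rightarrow> ('h \<Rightarrow> 'h) \<Rightarrow> bool" where
  "strictly_positive_op D T \<longleftrightarrow> (\<forall>u\<in>D. u \<noteq> 0 \<longrightarrow> inner (T u) u > 0)"

definition compact_inverse_op :: "'h::real_normed_vector set \<Rightarrow> ('h \<Rightarrow> 'h) \<Rightarrow> bool" where
  "compact_inverse_op D T \<longleftrightarrow> bij_betw T D UNIV \<and>
     (\<forall>X. bounded X \<longrightarrow> compact (closure (inv_into D T ` X)))"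

text \<open>(DB,B) is the (nonnegative selfadjoint) square root A^(1/2) of (DA,A):
  B is selfadjoint, nonnegative and B\<circ>B = A as operators (including domains).
  The square root is unique, so this determines V = D(A^(1/2)) and its norm.\<close>
definition is_sqrt_op :: "'h::real_inner set \<Rightarrow> ('h \<Rightarrow> 'h) \<Rightarrow> 'h set \<Rightarrow> ('h \<Rightarrow> 'h) \<Rightarrow> bool" where
  "is_sqrt_op DA A DB B \<longleftrightarrow> selfadjoint_op DB B \<and> (\<forall>u\<in>DB. inner (B u) u \<ge> 0) \<and>
     DA = {u\<in>DB. B u \<in> DB} \<and> (\<forall>u\<in>DA. B (B u) = A u)"

definition Omega :: "ereal \<Rightarrow> real set" where
  "Omega ell = {\<tau>. 0 < \<tau> \<and> ereal \<tau> < ell}"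

definition to_ell :: "ereal \<Rightarrow> real filter" where
  "to_ell ell = (if ell = \<infinity> then at_top else at_left (real_of_ereal ell))"

definition kernel_ok :: "ereal \<Rightarrow> (real \<Rightarrow> real) \<Rightarrow> bool" where
  "kernel_ok ell \<mu> \<longleftrightarrow>
     (\<forall>s\<in>Omega ell. \<mu> s > 0) \<and>
     (\<forall>s\<in>Omega ell. \<forall>t\<in>Omega ell. s \<le> t \<longrightarrow> \<mu> t \<le> \<mu> s) \<and>
     set_integrable lebesgue (Omega ell) \<mu> \<and>
     (\<forall>a b. {a..b} \<subseteq> Omega ell \<longrightarrow> abs_cont_on_interval \<mu> a b) \<and>
     (ell \<noteq> \<infinity> \<longrightarrow> (\<mu> \<longlongrightarrow> 0) (at_left (real_of_ereal ell)))"

text \<open>Elements are represented by functions \<Omega> \<rightarrow> H (values outside \<Omega> are irrelevant);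
  the V-norm of w is norm (B w).\<close>
definition in_mem :: "ereal \<Rightarrow> (real \<Rightarrow> real) \<Rightarrow> 'h::{real_inner,banach,second_countable_topology} set
     \<Rightarrow> ('h \<Rightarrow> 'h) \<Rightarrow> (real \<Rightarrow> 'h) \<Rightarrow> bool" where
  "in_mem ell \<mu> DB B \<xi> \<longleftrightarrow>
     (AE \<tau> in lebesgue. \<tau> \<in> Omega ell \<longrightarrow> \<xi> \<tau> \<in> DB) \<and>
     set_borel_measurable lebesgue (Omega ell) (\<lambda>\<tau>. B (\<xi> \<tau>)) \<and>
     set_integrable lebesgue (Omega ell) (\<lambda>\<tau>. (1 / \<mu> \<tau>) * (norm (B (\<xi> \<tau>)))\<^sup>2)"

definition mem_norm :: "ereal \<Rightarrow> (real \<Rightarrow> real) \<Rightarrow> ('h::{real_inner,banach,second_countable_topology} \<Rightarrow> 'h)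
     \<Rightarrow> (real \<Rightarrow> 'h) \<Rightarrow> real" where
  "mem_norm ell \<mu> B \<xi> =
     sqrt (LINT \<tau>:Omega ell|lebesgue. (1 / \<mu> \<tau>) * (norm (B (\<xi> \<tau>)))\<^sup>2)"

definition test_fun :: "real set \<Rightarrow> (real \<Rightarrow> real) \<Rightarrow> bool" where
  "test_fun U \<phi> \<longleftrightarrow> (\<forall>n x. ((deriv ^^ n) \<phi>) differentiable (at x)) \<and>
     compact (closure {x. \<phi> x \<noteq> 0}) \<and> closure {x. \<phi> x \<noteq> 0} \<subseteq> U"

definition distr_deriv :: "real set \<Rightarrow> (real \<Rightarrow> 'h::{real_normed_vector,banach,second_countable_topology})
     \<Rightarrow> (real \<Rightarrow> 'h) \<Rightarrow> bool" where
  "distr_deriv U \<xi> \<eta> \<longleftrightarrow> (\<forall>\<phi>. test_fun U \<phi> \<longrightarrow>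
     (LINT \<tau>:U|lebesgue. deriv \<phi> \<tau> *\<^sub>R \<xi> \<tau>) = - (LINT \<tau>:U|lebesgue. \<phi> \<tau> *\<^sub>R \<eta> \<tau>))"

text \<open>\<xi> \<in> D(P) with P\<xi> = \<eta>: \<xi>, \<eta> \<in> \<V>, \<eta> = D\<xi>, and (the continuous representative of)
  \<xi> tends to 0 in V as \<tau> \<rightarrow> \<ell>.\<close>
definition P_rel :: "ereal \<Rightarrow> (real \<Rightarrow> real) \<Rightarrow> 'h::{real_inner,banach,second_countable_topology} set
     \<Rightarrow> ('h \<Rightarrow> 'h) \<Rightarrow> (real \<Rightarrow> 'h) \<Rightarrow> (real \<Rightarrow> 'h) \<Rightarrow> bool" where
  "P_rel ell \<mu> DB B \<xi> \<eta> \<longleftrightarrow>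
     in_mem ell \<mu> DB B \<xi> \<and> in_mem ell \<mu> DB B \<eta> \<and> distr_deriv (Omega ell) \<xi> \<eta> \<and>
     (\<exists>\<xi>'. (AE \<tau> in lebesgue. \<tau> \<in> Omega ell \<longrightarrow> \<xi>' \<tau> = \<xi> \<tau>) \<and>
           (\<forall>\<tau>\<in>Omega ell. \<xi>' \<tau> \<in> DB) \<and>
           continuous_on (Omega ell) (\<lambda>\<tau>. B (\<xi>' \<tau>)) \<and>
           ((\<lambda>\<tau>. B (\<xi>' \<tau>)) \<longlongrightarrow> 0) (to_ell ell))"

type_synonym 'h state = "'h \<times> 'h \<times> (real \<Rightarrow> 'h)"

definition in_phase :: "ereal \<Rightarrow> (real \<Rightarrow> real) \<Rightarrow> 'h::{real_inner,banach,second_countable_topology} set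
     \<Rightarrow> ('h \<Rightarrow> 'h) \<Rightarrow> 'h state \<Rightarrow> bool" where
  "in_phase ell \<mu> DB B z \<longleftrightarrow> (case z of (u, v, \<xi>) \<Rightarrow> u \<in> DB \<and> in_mem ell \<mu> DB B \<xi>)"

definition phase_norm :: "ereal \<Rightarrow> (real \<Rightarrow> real) \<Rightarrow> ('h::{real_inner,banach,second_countable_topology} \<Rightarrow> 'h)
     \<Rightarrow> 'h state \<Rightarrow> real" where
  "phase_norm ell \<mu> B z = (case z of (u, v, \<xi>) \<Rightarrow>
     sqrt ((norm (B u))\<^sup>2 + (norm v)\<^sup>2 + (mem_norm ell \<mu> B \<xi>)\<^sup>2))"

definition st_lin :: "real \<Rightarrow> 'h::real_vector state \<Rightarrow> real \<Rightarrow> 'h state \<Rightarrow> 'h state" where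
  "st_lin a z b w = (case z of (u, v, \<xi>) \<Rightarrow> case w of (u', v', \<xi>') \<Rightarrow>
     (a *\<^sub>R u + b *\<^sub>R u', a *\<^sub>R v + b *\<^sub>R v', \<lambda>\<tau>. a *\<^sub>R \<xi> \<tau> + b *\<^sub>R \<xi>' \<tau>))"

text \<open>gen_rel z w: z \<in> D(\<bbbA>) and w represents \<bbbA> z.\<close>
definition gen_rel :: "ereal \<Rightarrow> (real \<Rightarrow> real) \<Rightarrow> 'h::{real_inner,banach,second_countable_topology} set
     \<Rightarrow> ('h \<Rightarrow> 'h) \<Rightarrow> 'h set \<Rightarrow> ('h \<Rightarrow> 'h) \<Rightarrow> 'h state \<Rightarrow> 'h state \<Rightarrow> bool" where
  "gen_rel ell \<mu> DA A DB B z w \<longleftrightarrow> (case z of (u, v, \<xi>) \<Rightarrow>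
     in_phase ell \<mu> DB B z \<and> v \<in> DB \<and>
     u + (LINT \<tau>:Omega ell|lebesgue. \<xi> \<tau>) \<in> DA \<and>
     (\<exists>\<eta>. P_rel ell \<mu> DB B \<xi> \<eta> \<and>
        w = (v, - A (u + (LINT \<tau>:Omega ell|lebesgue. \<xi> \<tau>)), \<lambda>\<tau>. \<eta> \<tau> + \<mu> \<tau> *\<^sub>R v)))"

text \<open>S is a strongly continuous contraction semigroup on \<AA> whose infinitesimal
  generator is \<bbbA> (everything modulo elements of zero \<AA>-norm, i.e. a.e. equality).\<close>
definition generated_contraction_semigroup ::
  "ereal \<Rightarrow> (real \<Rightarrow> real) \<Rightarrow> 'h::{real_inner,banach,second_countable_topology} set
     \<Rightarrow> ('h \<Rightarrow> 'h) \<Rightarrow> 'h set \<Rightarrow> ('h \<Rightarrow> 'h) \<Rightarrow> (real \<Rightarrow> 'h state \<Rightarrow> 'h state) \<Rightarrow> bool" where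
  "generated_contraction_semigroup ell \<mu> DA A DB B S \<longleftrightarrow>
   (let inA = in_phase ell \<mu> DB B; nA = phase_norm ell \<mu> B;
        dist = (\<lambda>z w. nA (st_lin 1 z (-1) w)) in
     (\<forall>t\<ge>0. \<forall>z. inA z \<longrightarrow> inA (S t z)) \<and>
     (\<forall>t\<ge>0. \<forall>z w a b. inA z \<longrightarrow> inA w \<longrightarrow>
         dist (S t (st_lin a z b w)) (st_lin a (S t z) b (S t w)) = 0) \<and>
     (\<forall>t\<ge>0. \<forall>z. inA z \<longrightarrow> nA (S t z) \<le> nA z) \<and>
     (\<forall>z. inA z \<longrightarrow> dist (S 0 z) z = 0) \<and>
     (\<forall>t\<ge>0. \<forall>s\<ge>0. \<forall>z. inA z \<longrightarrow> dist (S (t + s) z) (S t (S s z)) = 0) \<and>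
     (\<forall>z. inA z \<longrightarrow> (\<forall>t\<ge>0. ((\<lambda>s. dist (S s z) (S t z)) \<longlongrightarrow> 0) (at t within {0..}))) \<and>
     (\<forall>z. inA z \<longrightarrow>
        ((\<exists>w. gen_rel ell \<mu> DA A DB B z w) \<longleftrightarrow>
         (\<exists>w. inA w \<and> ((\<lambda>h. dist (st_lin (1/h) (S h z) (-1/h) z) w) \<longlongrightarrow> 0) (at_right 0)))) \<and>
     (\<forall>z w. gen_rel ell \<mu> DA A DB B z w \<longrightarrow>
         ((\<lambda>h. dist (st_lin (1/h) (S h z) (-1/h) z) w) \<longlongrightarrow> 0) (at_right 0)))"

end

theory Submission
  imports Defs
begin

text \<open>
  Write \<open>\<nu> = 1/\<mu>\<close>. The hypothesis on \<open>\<mu>'\<close> says \<open>\<delta> \<integral>\<^sub>s\<^sup>t \<mu> \<le> \<mu>(s) - \<mu>(t)\<close>, which makes \<open>P\<close> strictly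
  dissipative: \<open>2 \<langle>P\<xi>, \<xi>\<rangle> \<le> -\<delta> \<parallel>\<xi>\<parallel>\<^sup>2\<close> in \<open>L\<^sup>2\<^sub>\<nu>(\<Omega>; V)\<close>. Along \<open>z = (u, v, \<xi>)\<close> the energy identity thus gives
  \<open>(d/dt) \<parallel>z\<parallel>\<^sup>2 \<le> -\<delta> \<parallel>\<xi>\<parallel>\<^sup>2\<close>. The components \<open>v\<close> and \<open>u\<close> are recovered by the multipliers
  \<open>-\<langle>v, \<integral> \<psi> \<xi>\<rangle>\<close> and \<open>\<langle>v, u\<rangle>\<close>, where \<open>\<psi> \<ge> 0\<close> is a test function on \<open>\<Omega>\<close>: the derivative of the first contains
  \<open>-(\<integral> \<psi> \<mu>) \<parallel>v\<parallel>\<^sup>2\<close>, that of the second \<open>-\<parallel>u\<parallel>\<^sub>V\<^sup>2 + \<parallel>v\<parallel>\<^sup>2\<close>, up to terms absorbed by the dissipation. Hence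
  \<open>N \<parallel>z\<parallel>\<^sup>2 - \<langle>v, \<integral> \<psi> \<xi>\<rangle> + \<epsilon> \<langle>v, u\<rangle>\<close> with \<open>N\<close> large is equivalent to \<open>\<parallel>z\<parallel>\<^sup>2\<close> and decays exponentially. Only right
  derivatives along orbits starting in the domain of the generator are needed; the domain is dense.
\<close>

text \<open>The decay hypothesis speaks only of points where \<open>\<mu>\<close> has a derivative
  and is vacuous elsewhere, so differentiability almost everywhere and an integral formula for
  \<open>\<mu>\<close> must first be extracted from absolute continuity. The dissipation estimate is
  an integration by parts against the weight 1/\<mu>. At ell this weight is unbounded, and
  convergence of xi to 0 in V does not by itself remove the boundary term. It is removed by bounding
  the weighted value at b by 1/\<delta> times the tail over (b, ell) of the integral of |P xi|_V^2 /
  \<mu>. At 0 the boundary term has the favourable sign and is dropped. States are functions, not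
  classes, and \<open>B\<close> is uncontrolled off \<open>DB\<close>. The abstract semigroup
  argument therefore uses a semidefinite form on a set of states, and linearity is only visible
  through that form. The distributional derivative is taken in H while the energy lives in V; the
  bounded injective operator A^(-1/2) carries identities from one to the other.\<close>

section \<open>Monotone absolutely continuous functions\<close>

text \<open>Convex subsets of the line with disjoint interiors meet in a null set, so the lengths
  add up to the measure of the union.\<close>

lemma nonoverlapping_intervals_sum_le:
  fixes l r :: "real set \<Rightarrow> real"
  assumes fin: "finite E"
    and K: "\<And>K. K \<in> E \<Longrightarrow> {l K..r K} = K \<and> l K < r K"
    and pw: "pairwise (\<lambda>A B. interior A \<inter> interior B = {}) E"
    and X: "\<Union>E \<subseteq> X" "X \<in> lmeasurable"
  shows "(\<Sum>K\<in>E. r K - l K) \<le> measure lebesgue X"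
proof -
  have "pairwise (\<lambda>A B. negligible (A \<inter> B)) E"
  proof (rule pairwiseI)
    fix A B assume AB: "A \<in> E" "B \<in> E" "A \<noteq> B"
    have "convex A" "convex B" using K[OF AB(1)] K[OF AB(2)] by (metis convex_real_interval(5))+
    then have "negligible (A \<inter> B) \<longleftrightarrow> interior (A \<inter> B) = {}"
      using negligible_convex_interior convex_Int by blast
    then show "negligible (A \<inter> B)"
      using pw AB by (simp add: pairwise_def)
  qed
  moreover have lm: "K \<in> lmeasurable" if "K \<in> E" for K
    using K[OF that] by (metis lmeasurable_interval(1) interval_cbox)
  ultimately have "measure lebesgue (\<Union>E) = (\<Sum>K\<in>E. measure lebesgue K)"
    using fin by (intro measure_negligible_finite_Union) auto
  also have "\<dots> = (\<Sum>K\<in>E. r K - l K)"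
  proof (rule sum.cong[OF refl])
    fix K' assume "K' \<in> E"
    then have K': "{l K'..r K'} = K'" "l K' < r K'" using K by auto
    have "measure lebesgue {l K'..r K'} = r K' - l K'" using K'(2) by simp
    then show "measure lebesgue K' = r K' - l K'" unfolding K'(1) .
  qed
  finally have "(\<Sum>K\<in>E. r K - l K) = measure lebesgue (\<Union>E)" by simp
  also have "\<dots> \<le> measure lebesgue X"
    using X fin lm by (intro measure_mono_fmeasurable) (auto intro: fmeasurableD)
  finally show ?thesis .
qed

text \<open>The covering lemma used below produces sets of intervals rather than indexed endpoints.
  This form of absolute continuity takes such a family, with \<open>l\<close> and \<open>r\<close>
  reading off the endpoints.\<close>

lemma abs_cont_on_interval_finite_family:
  fixes f :: "real \<Rightarrow> real"
  assumes ac: "abs_cont_on_interval f a b" and e: "e > 0"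
  obtains d where "d > 0"
    "\<And>E l r. \<lbrakk>finite E; \<And>K. K \<in> E \<Longrightarrow> {l K..r K} = K \<and> l K < r K \<and> K \<subseteq> {a..b};
       pairwise (\<lambda>A B. interior A \<inter> interior B = {}) E; (\<Sum>K\<in>E. r K - l K) < d\<rbrakk>
     \<Longrightarrow> (\<Sum>K\<in>E. \<bar>f (r K) - f (l K)\<bar>) < e"
proof -
  obtain d where d: "d > 0" and D: "\<And>(n::nat) (x::nat \<Rightarrow> real) (y::nat \<Rightarrow> real).
        (\<forall>i<n. a \<le> x i \<and> x i \<le> y i \<and> y i \<le> b) \<and>
        (\<forall>i<n. \<forall>j<n. i \<noteq> j \<longrightarrow> y i \<le> x j \<or> y j \<le> x i) \<and>
        (\<Sum>i<n. y i - x i) < d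
        \<Longrightarrow> (\<Sum>i<n. \<bar>f (y i) - f (x i)\<bar>) < e"
    using ac e unfolding abs_cont_on_interval_def by (elim allE[of _ e]) blast
  show ?thesis
  proof (rule that[OF d])
    fix E l r
    assume fin: "finite E" and K: "\<And>K. K \<in> E \<Longrightarrow> {l K..r K} = K \<and> l K < r K \<and> K \<subseteq> {a..b}"
      and pw: "pairwise (\<lambda>A B. interior A \<inter> interior B = {}) E" and lt: "(\<Sum>K\<in>E. r K - l K) < d"
    obtain h where h: "bij_betw h {0..<card E} E"
      using ex_bij_betw_nat_finite[OF fin] by auto
    have hE: "h i \<in> E" if "i < card E" for i using h that by (auto simp: bij_betw_def)
    have s: "(\<Sum>i<card E. g (h i)) = (\<Sum>K\<in>E. g K)" for g :: "real set \<Rightarrow> real"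
      using sum.reindex_bij_betw[OF h, of g] by (simp add: atLeast0LessThan)
    have ov: "r (h i) \<le> l (h j) \<or> r (h j) \<le> l (h i)" if "i < card E" "j < card E" "i \<noteq> j" for i j
    proof -
      have ne: "h i \<noteq> h j" using h that by (auto simp: bij_betw_def inj_on_def)
      then have "interior (h i) \<inter> interior (h j) = {}"
        using pw hE that by (auto simp: pairwise_def)
      moreover have "interior (h i) = {l (h i)<..<r (h i)}" "interior (h j) = {l (h j)<..<r (h j)}"
        using K[OF hE[OF that(1)]] K[OF hE[OF that(2)]] by (metis interior_atLeastAtMost_real)+
      ultimately have "{l (h i)<..<r (h i)} \<inter> {l (h j)<..<r (h j)} = {}" by simp
      \<comment> \<open>A point strictly between the larger left end and the smaller right end would
        lie in both open intervals.\<close>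
      then have "\<not> max (l (h i)) (l (h j)) < min (r (h i)) (r (h j))"
        by (auto dest: dense)
      then show ?thesis using K[OF hE[OF that(1)]] K[OF hE[OF that(2)]] by (auto simp: max_def min_def split: if_splits)
    qed
    have "(\<Sum>i<card E. \<bar>f (r (h i)) - f (l (h i))\<bar>) < e"
    proof (rule D, intro conjI allI impI)
      fix i assume "i < card E"
      from K[OF hE[OF this]] have *: "{l (h i)..r (h i)} = h i" "l (h i) < r (h i)" "h i \<subseteq> {a..b}" by auto
      then have "{l (h i)..r (h i)} \<subseteq> {a..b}" by metis
      then show "a \<le> l (h i)" "l (h i) \<le> r (h i)" "r (h i) \<le> b" using *(2) by auto
    qed (use ov lt s[of "\<lambda>K. r K - l K"] in auto)
    then show "(\<Sum>K\<in>E. \<bar>f (r K) - f (l K)\<bar>) < e"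
      using s[of "\<lambda>K. \<bar>f (r K) - f (l K)\<bar>"] by simp
  qed
qed

lemma abs_cont_on_interval_continuous_on:
  assumes "abs_cont_on_interval f a b"
  shows "continuous_on {a..b} f"
proof (rule continuous_on_iff[THEN iffD2], intro ballI allI impI)
  fix x e :: real assume x: "x \<in> {a..b}" and e: "e > 0"
  then obtain d where d: "d > 0" and D: "\<And>(n::nat) (x::nat \<Rightarrow> real) (y::nat \<Rightarrow> real).
        (\<forall>i<n. a \<le> x i \<and> x i \<le> y i \<and> y i \<le> b) \<and>
        (\<forall>i<n. \<forall>j<n. i \<noteq> j \<longrightarrow> y i \<le> x j \<or> y j \<le> x i) \<and>
        (\<Sum>i<n. y i - x i) < d
        \<Longrightarrow> (\<Sum>i<n. \<bar>f (y i) - f (x i)\<bar>) < e"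
    using assms e unfolding abs_cont_on_interval_def by (elim allE[of _ e]) blast
  show "\<exists>d>0. \<forall>x'\<in>{a..b}. dist x' x < d \<longrightarrow> dist (f x') (f x) < e"
  proof (intro exI[of _ d] conjI ballI impI d)
    fix y assume y: "y \<in> {a..b}" "dist y x < d"
    \<comment> \<open>A family of one interval suffices; \<open>min\<close> and \<open>max\<close>
      sort its ends, as \<open>y\<close> may lie on either side of \<open>x\<close>.\<close>
    have "(\<Sum>i<Suc 0. \<bar>f (max x y) - f (min x y)\<bar>) < e"
      using x y by (intro D) (auto simp: dist_real_def)
    then show "dist (f y) (f x) < e"
      by (auto simp: dist_real_def max_def min_def split: if_splits)
  qed
qed

text \<open>Clamping makes \<open>F\<close> constant outside [a, b], so its Stieltjes measure lives
  on [a, b]. A Lebesgue null set there is covered by non-overlapping intervals of total length below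
  the threshold of absolute continuity, and monotonicity turns the sum of the increments of
  \<open>f\<close> into the Stieltjes measure of the cover.\<close>

lemma absolutely_continuous_interval_measure:
  fixes f :: "real \<Rightarrow> real"
  assumes ab: "a < b" and ac: "abs_cont_on_interval f a b"
    and mono: "\<And>x y. a \<le> x \<Longrightarrow> x \<le> y \<Longrightarrow> y \<le> b \<Longrightarrow> f x \<le> f y"
  defines "F \<equiv> \<lambda>x. f (min b (max a x))"
  shows "absolutely_continuous lborel (interval_measure F)"
    and "\<And>x y. x \<le> y \<Longrightarrow> F x \<le> F y" and "continuous_on UNIV F"
proof -
  show mF: "F x \<le> F y" if "x \<le> y" for x y
    unfolding F_def using that ab by (intro mono) auto
  show cF: "continuous_on UNIV F"
    unfolding F_def
    by (rule continuous_on_compose2[OF abs_cont_on_interval_continuous_on[OF ac]])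
       (use ab in \<open>auto intro!: continuous_intros\<close>)
  let ?M = "interval_measure F"
  have Icc: "emeasure ?M {x..y} = F y - F x" if "x \<le> y" for x y
    by (rule emeasure_interval_measure_Icc[OF that mF cF])
  have n1: "(\<Union>n::nat. {a - real n..a}) \<in> null_sets ?M"
  proof (rule null_sets_UN)
    fix n show "{a - real n..a} \<in> null_sets ?M"
      using Icc[of "a - real n" a] ab by (intro null_setsI) (auto simp: F_def)
  qed
  have n2: "(\<Union>n::nat. {b..b + real n}) \<in> null_sets ?M"
  proof (rule null_sets_UN)
    fix n show "{b..b + real n} \<in> null_sets ?M"
      using Icc[of b "b + real n"] ab by (intro null_setsI) (auto simp: F_def)
  qed
  have cover: "x \<in> (\<Union>n::nat. {a - real n..a}) \<union> (\<Union>n::nat. {b..b + real n}) \<union> {a..b}" for x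
  proof -
    obtain n :: nat where "\<bar>x - a\<bar> + \<bar>x - b\<bar> \<le> real n" using real_arch_simple by blast
    then show ?thesis by (cases "x < a"; cases "x > b") (auto intro!: exI[of _ n])
  qed
  show "absolutely_continuous lborel ?M"
    unfolding absolutely_continuous_def
  proof
    fix N :: "real set" assume N: "N \<in> null_sets lborel"
    then have Nb[measurable]: "N \<in> sets borel" by auto
    have "emeasure ?M (N \<inter> {a..b}) \<le> ennreal e" if e: "e > 0" for e
    proof -
      obtain d where d: "d > 0" and D: "\<And>E l r. \<lbrakk>finite E; \<And>K. K \<in> E \<Longrightarrow> {l K..r K} = K \<and> l K < r K \<and> K \<subseteq> {a..b};
       pairwise (\<lambda>A B. interior A \<inter> interior B = {}) E; (\<Sum>K\<in>E. r K - l K) < d\<rbrakk>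
     \<Longrightarrow> (\<Sum>K\<in>E. \<bar>f (r K) - f (l K)\<bar>) < e"
        using abs_cont_on_interval_finite_family[OF ac e] by blast
      have Nl: "N \<inter> {a..b} \<in> null_sets lebesgue"
        using N by (auto intro: null_sets_completionI null_set_Int2)
      then have lm: "N \<inter> {a..b} \<in> lmeasurable" and m0: "measure lebesgue (N \<inter> {a..b}) = 0"
        by (auto simp: fmeasurable_def null_sets_def measure_def)
      have sub: "N \<inter> {a..b} \<subseteq> cbox a b" "0 < d / 2" using d by auto
      \<comment> \<open>A countable cover by non-degenerate intervals; the excess d / 2 keeps its
        measure strictly below \<open>d\<close>.\<close>
      obtain \<D> where cD: "countable \<D>"
        and Dc: "\<And>K. K \<in> \<D> \<Longrightarrow> K \<subseteq> cbox a b \<and> K \<noteq> {} \<and> (\<exists>c d. K = cbox c d)"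
        and Dp: "pairwise (\<lambda>A B. interior A \<inter> interior B = {}) \<D>"
        and Di: "\<And>K. \<lbrakk>K \<in> \<D>; box a b \<noteq> {}\<rbrakk> \<Longrightarrow> interior K \<noteq> {}"
        and DN: "N \<inter> {a..b} \<subseteq> \<Union>\<D>" and Dl: "\<Union>\<D> \<in> lmeasurable"
        and Dm: "measure lebesgue (\<Union>\<D>) \<le> measure lebesgue (N \<inter> {a..b}) + d / 2"
      proof (rule measurable_outer_intervals_bounded[OF lm sub], goal_cases)
        case (1 D)
        from 1(2,3,4,6-9) show thesis by (rule that)
      qed
      have "\<forall>K\<in>\<D>. \<exists>c d. K = {c..d} \<and> c < d"
      proof
        fix K assume K: "K \<in> \<D>"
        then obtain c d where cd: "K = cbox c d" using Dc by blast
        moreover have "interior K \<noteq> {}" using Di[OF K] ab by simp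
        ultimately show "\<exists>c d. K = {c..d} \<and> c < d" by auto
      qed
      then obtain l r where lr: "\<And>K. K \<in> \<D> \<Longrightarrow> {l K..r K} = K \<and> l K < r K" by metis
      \<comment> \<open>Absolute continuity sees finite families only; the countable cover is
        reached afterwards by continuity of the measure from below.\<close>
      have fin: "emeasure ?M (\<Union>E) \<le> ennreal e" if E: "finite E" "E \<subseteq> \<D>" for E
      proof -
        have pE: "pairwise (\<lambda>A B. interior A \<inter> interior B = {}) E"
          using Dp E(2) by (rule pairwise_subset)
        have KE: "{l K..r K} = K \<and> l K < r K" "K \<subseteq> {a..b}" if "K \<in> E" for K
          using lr[of K] Dc[of K] that E(2) by auto
        have "(\<Sum>K\<in>E. r K - l K) \<le> measure lebesgue (\<Union>\<D>)"
          using E by (intro nonoverlapping_intervals_sum_le[OF E(1) KE(1) pE _ Dl]) auto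
        also have "\<dots> < d" using Dm m0 d by simp
        finally have lt: "(\<Sum>K\<in>E. \<bar>f (r K) - f (l K)\<bar>) < e"
          using KE pE E(1) by (intro D) auto
        have "emeasure ?M (\<Union>E) \<le> (\<Sum>K\<in>E. emeasure ?M K)"
        proof -
          have "\<And>K. K \<in> E \<Longrightarrow> K \<in> sets ?M" using KE by (metis atLeastAtMost_borel sets_interval_measure)
          then show ?thesis using emeasure_subadditive_finite[of E "\<lambda>x. x" ?M] E(1) by auto
        qed
        also have "\<dots> = (\<Sum>K\<in>E. ennreal \<bar>f (r K) - f (l K)\<bar>)"
        proof (rule sum.cong[OF refl])
          fix K assume K: "K \<in> E"
          have "emeasure ?M K = emeasure ?M {l K..r K}" using KE(1)[OF K] by metis
          also have "\<dots> = F (r K) - F (l K)" using KE(1)[OF K] by (intro Icc) auto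
          also have "F (r K) - F (l K) = f (r K) - f (l K)"
          proof -
            have "{l K..r K} \<subseteq> {a..b}" "l K < r K" using KE[OF K] by metis+
            then show ?thesis unfolding F_def by auto
          qed
          also have "f (r K) - f (l K) = \<bar>f (r K) - f (l K)\<bar>"
            using KE[OF K] mono[of "l K" "r K"] by (metis abs_of_nonneg atLeastatMost_subset_iff diff_ge_0_iff_ge less_imp_le)
          finally show "emeasure ?M K = ennreal \<bar>f (r K) - f (l K)\<bar>" .
        qed
        also have "\<dots> = ennreal (\<Sum>K\<in>E. \<bar>f (r K) - f (l K)\<bar>)" by (simp add: sum_ennreal)
        also have "\<dots> \<le> ennreal e" using lt by (intro ennreal_leI) simp
        finally show ?thesis .
      qed
      show ?thesis
      proof (cases "\<D> = {}")
        case True then show ?thesis using DN by simp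
      next
        case False
        let ?K = "\<lambda>n. \<Union>i<n. from_nat_into \<D> i"
        have s: "from_nat_into \<D> i \<in> sets ?M" for i
          using lr[OF from_nat_into[OF False]] by (metis atLeastAtMost_borel sets_interval_measure)
        have U: "\<Union>\<D> = (\<Union>n. ?K n)"
        proof -
          have "\<Union>\<D> = (\<Union>i. from_nat_into \<D> i)"
            using range_from_nat_into[OF False cD] by simp
          also have "\<dots> = (\<Union>n. ?K n)" (is "?l = ?r")
          proof
            show "?l \<subseteq> ?r"
            proof
              fix x assume "x \<in> ?l"
              then obtain i where "x \<in> from_nat_into \<D> i" by blast
              then have "x \<in> ?K (Suc i)" by auto
              then show "x \<in> ?r" by blast
            qed
          qed blast
          finally show ?thesis .
        qed
        have "emeasure ?M (N \<inter> {a..b}) \<le> emeasure ?M (\<Union>n. ?K n)"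
          using DN U s by (intro emeasure_mono) auto
        also have "\<dots> = (SUP n. emeasure ?M (?K n))"
        proof (rule SUP_emeasure_incseq[symmetric])
          show "incseq ?K" unfolding incseq_def by (intro allI impI UN_mono) auto
        qed (use s in auto)
        also have "\<dots> \<le> ennreal e"
        proof (rule SUP_least)
          fix n
          have "?K n = \<Union>(from_nat_into \<D> ` {..<n})" by auto
          then show "emeasure ?M (?K n) \<le> ennreal e"
            using from_nat_into[OF False] by (auto intro!: fin)
        qed
        finally show ?thesis .
      qed
    qed
    note small = this
    have "emeasure ?M (N \<inter> {a..b}) \<le> 0"
      by (rule ennreal_le_epsilon) (simp add: small)
    then have "emeasure ?M (N \<inter> {a..b}) = 0" by simp
    then have "N \<inter> {a..b} \<in> null_sets ?M" by (intro null_setsI) auto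
    then have "(\<Union>n::nat. {a - real n..a}) \<union> (\<Union>n::nat. {b..b + real n}) \<union> (N \<inter> {a..b}) \<in> null_sets ?M"
      using n1 n2 by (intro null_sets.Un)
    then show "N \<in> null_sets ?M"
    proof (rule null_sets_subset)
      show "N \<subseteq> (\<Union>n::nat. {a - real n..a}) \<union> (\<Union>n::nat. {b..b + real n}) \<union> (N \<inter> {a..b})"
        using cover by blast
    qed simp
  qed
qed

text \<open>Lebesgue differentiation. The averaging theorem controls averages over intervals to the
  right of a point. Averages to the left are right averages of the reflected function, which is the
  origin of the exceptional set \<open>N2\<close>.\<close>

lemma has_real_derivative_indefinite_integral_AE:
  fixes h F :: "real \<Rightarrow> real"
  assumes h: "integrable lborel h"
    and F: "\<And>x y. s \<le> x \<Longrightarrow> x \<le> y \<Longrightarrow> y \<le> t \<Longrightarrow> F y - F x = integral {x..y} h"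
  shows "AE x in lebesgue. x \<in> {s<..<t} \<longrightarrow> (F has_real_derivative h x) (at x)"
proof -
  have hI: "h integrable_on cbox c d" for c d
    using integrable_on_lborel[OF h] integrable_on_subcbox[of h UNIV c d] by simp
  have h': "integrable lborel (\<lambda>x. h (- x))"
    using lborel_integrable_real_affine_iff[of "-1" h 0] h by simp
  have hI': "(\<lambda>x. h (- x)) integrable_on cbox c d" for c d
    using integrable_on_lborel[OF h'] integrable_on_subcbox[of "\<lambda>x. h (- x)" UNIV c d] by simp
  obtain N1 where N1: "negligible N1" and r: "\<And>x e. \<lbrakk>x \<notin> N1; 0 < e\<rbrakk> \<Longrightarrow>
      \<exists>d>0. \<forall>k. 0 < k \<and> k < d \<longrightarrow> \<bar>integral {x..x + k} h / k - h x\<bar> < e"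
    using integrable_ccontinuous_explicit[of h] hI
    by (auto simp: divide_inverse_commute)
  obtain N2 where N2: "negligible N2" and l: "\<And>x e. \<lbrakk>x \<notin> N2; 0 < e\<rbrakk> \<Longrightarrow>
      \<exists>d>0. \<forall>k. 0 < k \<and> k < d \<longrightarrow> \<bar>integral {x..x + k} (\<lambda>x. h (-x)) / k - h (-x)\<bar> < e"
    using integrable_ccontinuous_explicit[of "\<lambda>x. h (-x)"] hI'
    by (auto simp: divide_inverse_commute)
  have "negligible (uminus ` N2)"
    using N2 by (intro negligible_differentiable_image_negligible)
      (auto intro!: derivative_intros simp: differentiable_on_def)
  then have neg: "N1 \<union> uminus ` N2 \<in> null_sets lebesgue"
    using N1 unfolding negligible_iff_null_sets by (rule null_sets.Un[rotated])
  show ?thesis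
  proof (rule AE_I'[OF neg], rule subsetI, rule ccontr)
    fix x assume "x \<in> {x \<in> space lebesgue. \<not> (x \<in> {s<..<t} \<longrightarrow> (F has_real_derivative h x) (at x))}"
      and nx: "x \<notin> N1 \<union> uminus ` N2"
    then have x: "s < x" "x < t" and nd: "\<not> (F has_real_derivative h x) (at x)" by auto
    have x1: "x \<notin> N1" and x2: "- x \<notin> N2" using nx by force+
    have "((\<lambda>k. (F (x + k) - F x) / k) \<longlongrightarrow> h x) (at 0)"
    proof (rule LIM_I)
      fix e :: real assume e: "0 < e"
      obtain d1 where d1: "d1 > 0" "\<And>k. 0 < k \<Longrightarrow> k < d1 \<Longrightarrow> \<bar>integral {x..x + k} h / k - h x\<bar> < e"
        using r[OF x1 e] by blast
      obtain d2 where d2: "d2 > 0" "\<And>k. 0 < k \<Longrightarrow> k < d2 \<Longrightarrow>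
          \<bar>integral {-x..-x + k} (\<lambda>x. h (-x)) / k - h x\<bar> < e"
        using l[OF x2 e] by auto
      define d where "d = Min {d1, d2, x - s, t - x}"
      have d: "d > 0" "d \<le> d1" "d \<le> d2" "d \<le> x - s" "d \<le> t - x"
        using d1(1) d2(1) x by (auto simp: d_def)
      show "\<exists>d>0. \<forall>k::real. k \<noteq> 0 \<and> norm (k - 0) < d \<longrightarrow> norm ((F (x + k) - F x) / k - h x) < e"
      proof (intro exI[of _ d] conjI allI impI d)
        fix k :: real assume k: "k \<noteq> 0 \<and> norm (k - 0) < d"
        show "norm ((F (x + k) - F x) / k - h x) < e"
        proof (cases "k > 0")
          case True
          then show ?thesis using d1(2)[of k] F[of x "x + k"] d k x by auto
        next
          case False
          then have k': "0 < - k" "- k < d" using k by auto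
          have "integral {-x..-x + (-k)} (\<lambda>x. h (-x)) = integral {x + k..x} h"
            using Henstock_Kurzweil_Integration.integral_reflect_real[of x "x + k" h] by simp
          also have "\<dots> = F x - F (x + k)"
            using F[of "x + k" x] k' d x by auto
          finally have "(F (x + k) - F x) / k = integral {-x..-x + (-k)} (\<lambda>x. h (-x)) / (-k)"
            using k by (metis minus_diff_eq minus_divide_divide)
          then show ?thesis using d2(2)[of "-k"] k' d by auto
        qed
      qed
    qed
    then have "(F has_real_derivative h x) (at x)" by (simp add: DERIV_def)
    with nd show False by simp
  qed
qed

text \<open>The density is the Radon-Nikodym derivative of the Stieltjes measure of the clamped
  function.\<close>

lemma monotone_abs_cont_indefinite_integral:
  fixes f :: "real \<Rightarrow> real"
  assumes ab: "a < b" and ac: "abs_cont_on_interval f a b"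
    and mono: "\<And>x y. a \<le> x \<Longrightarrow> x \<le> y \<Longrightarrow> y \<le> b \<Longrightarrow> f x \<le> f y"
  obtains h :: "real \<Rightarrow> real" where "integrable lborel h"
    "\<And>x y. a \<le> x \<Longrightarrow> x \<le> y \<Longrightarrow> y \<le> b \<Longrightarrow> f y - f x = integral {x..y} h"
proof -
  define F where "F = (\<lambda>x. f (min b (max a x)))"
  have F: "absolutely_continuous lborel (interval_measure F)" "\<And>x y. x \<le> y \<Longrightarrow> F x \<le> F y" "continuous_on UNIV F"
    unfolding F_def by (rule absolutely_continuous_interval_measure[OF ab ac]; use mono in blast)+
  let ?M = "interval_measure F"
  obtain g where g[measurable]: "g \<in> borel_measurable lborel" and gM: "density lborel g = ?M"
    using sigma_finite_measure.Radon_Nikodym[OF sigma_finite_lborel F(1)] by auto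
  have Icc: "(\<integral>\<^sup>+x. g x * indicator {x1..y1} x \<partial>lborel) = ennreal (F y1 - F x1)" if "x1 \<le> y1" for x1 y1
  proof -
    have "(\<integral>\<^sup>+x. g x * indicator {x1..y1} x \<partial>lborel) = emeasure ?M {x1..y1}"
      unfolding gM[symmetric] by (subst emeasure_density) auto
    also have "\<dots> = ennreal (F y1 - F x1)"
      by (rule emeasure_interval_measure_Icc[OF that F(2) F(3)])
    finally show ?thesis .
  qed
  \<comment> \<open>The mass of [a, b] is finite, so the density is finite almost everywhere on it
    and passing from \<open>ennreal\<close> to \<open>real\<close> changes it on a null set
    only.\<close>
  define h where "h = (\<lambda>x. enn2real (g x * indicator {a..b} x))"
  have [measurable]: "h \<in> borel_measurable lborel" unfolding h_def by measurable
  have "AE x in lborel. g x * indicator {a..b} x \<noteq> \<infinity>"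
    using Icc[of a b] ab by (intro nn_integral_PInf_AE) auto
  then have hg: "AE x in lborel. ennreal (h x) = g x * indicator {a..b} x"
    by eventually_elim (simp add: h_def less_top)
  have hint: "integrable lborel h"
  proof (rule integrableI_nonneg)
    have "(\<integral>\<^sup>+x. ennreal (h x) \<partial>lborel) = (\<integral>\<^sup>+x. g x * indicator {a..b} x \<partial>lborel)"
      by (rule nn_integral_cong_AE[OF hg])
    then show "(\<integral>\<^sup>+x. ennreal (h x) \<partial>lborel) < \<infinity>" using Icc[of a b] ab by simp
  qed (auto simp: h_def)
  moreover have "f y1 - f x1 = integral {x1..y1} h" if xy: "a \<le> x1" "x1 \<le> y1" "y1 \<le> b" for x1 y1
  proof -
    have s: "set_integrable lborel {x1..y1} h"
      unfolding set_integrable_def using hint by (intro integrable_mult_indicator) auto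
    have "ennreal (LINT x:{x1..y1}|lborel. h x) = (\<integral>\<^sup>+x. ennreal (indicator {x1..y1} x * h x) \<partial>lborel)"
      using s unfolding set_lebesgue_integral_def set_integrable_def
      by (subst nn_integral_eq_integral) (auto simp: h_def)
    also have "\<dots> = (\<integral>\<^sup>+x. g x * indicator {x1..y1} x \<partial>lborel)"
      using hg xy by (intro nn_integral_cong_AE, elim AE_mp) (auto simp: indicator_def intro!: AE_I2)
    also have "\<dots> = ennreal (F y1 - F x1)" by (rule Icc[OF xy(2)])
    also have "F y1 - F x1 = f y1 - f x1" using xy by (simp add: F_def)
    finally have "(LINT x:{x1..y1}|lborel. h x) = f y1 - f x1"
      using mono[OF xy] by (subst (asm) ennreal_inj)
        (auto simp: set_lebesgue_integral_def h_def intro!: Bochner_Integration.integral_nonneg)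
    moreover have "(LINT x:{x1..y1}|lborel. h x) = integral {x1..y1} h"
      by (rule set_borel_integral_eq_integral(2)[OF s])
    ultimately show ?thesis by simp
  qed
  ultimately show ?thesis by (rule that)
qed

text \<open>Writing the nondecreasing function -\<mu> as an integral of some \<open>h\<close> yields
  a derivative almost everywhere. At those points the hypothesis reads
  \<open>\<delta> * \<mu> x \<le> h x\<close>, and integration gives the claim.\<close>

lemma kernel_integral_decay:
  assumes mu: "kernel_ok ell \<mu>"
    and mu_decay: "AE s in lebesgue. s \<in> Omega ell \<longrightarrow>
                     (\<forall>d. (\<mu> has_real_derivative d) (at s) \<longrightarrow> d + \<delta> * \<mu> s \<le> 0)"
    and s: "s \<in> Omega ell" and t: "t \<in> Omega ell" and st: "s \<le> t"
  shows "\<delta> * integral {s..t} \<mu> \<le> \<mu> s - \<mu> t" and "continuous_on {s..t} \<mu>"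
proof -
  have sub: "{s..t} \<subseteq> Omega ell"
    using s t unfolding Omega_def by (auto intro: le_less_trans[of "ereal _" "ereal t"])
  then have ac: "abs_cont_on_interval \<mu> s t"
    using mu unfolding kernel_ok_def by blast
  then show cont: "continuous_on {s..t} \<mu>" by (rule abs_cont_on_interval_continuous_on)
  show "\<delta> * integral {s..t} \<mu> \<le> \<mu> s - \<mu> t"
  proof (cases "s = t")
    case False
    then have lt: "s < t" using st by simp
    have "abs_cont_on_interval (\<lambda>x. - \<mu> x) s t"
      using ac unfolding abs_cont_on_interval_def by (simp add: abs_minus_commute)
    moreover have "- \<mu> x \<le> - \<mu> y" if "s \<le> x" "x \<le> y" "y \<le> t" for x y
    proof -
      have "x \<in> Omega ell" "y \<in> Omega ell" using sub that by auto
      then show ?thesis using mu that unfolding kernel_ok_def by (simp add: Ball_def)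
    qed
    ultimately obtain h where h: "integrable lborel h"
      and F: "\<And>x y. s \<le> x \<Longrightarrow> x \<le> y \<Longrightarrow> y \<le> t \<Longrightarrow> - \<mu> y - - \<mu> x = integral {x..y} h"
      using monotone_abs_cont_indefinite_integral[OF lt] by blast
    have "AE x in lebesgue. x \<in> {s<..<t} \<longrightarrow> ((\<lambda>x. - \<mu> x) has_real_derivative h x) (at x)"
      by (rule has_real_derivative_indefinite_integral_AE[OF h F])
    with mu_decay have "AE x in lebesgue. x \<in> {s<..<t} \<longrightarrow> \<delta> * \<mu> x \<le> h x"
    proof eventually_elim
      case (elim x)
      show ?case
      proof
        assume x: "x \<in> {s<..<t}"
        with elim have "((\<lambda>x. - \<mu> x) has_real_derivative h x) (at x)" by simp
        from DERIV_minus[OF this] have "(\<mu> has_real_derivative - h x) (at x)" by simp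
        moreover have "x \<in> Omega ell" using sub x by auto
        ultimately show "\<delta> * \<mu> x \<le> h x" using elim(1) by fastforce
      qed
    qed
    moreover have "AE x in lebesgue. x \<noteq> s \<and> x \<noteq> t"
      by (intro AE_conjI; rule AE_I'[of "{_}"]) auto
    ultimately have ae: "AE x in lebesgue. x \<in> {s..t} \<longrightarrow> \<delta> * \<mu> x \<le> h x"
      by eventually_elim auto
    then obtain N where N: "{x. \<not> (x \<in> {s..t} \<longrightarrow> \<delta> * \<mu> x \<le> h x)} \<subseteq> N" "N \<in> null_sets lebesgue"
      by (auto simp: eventually_ae_filter)
    have hi: "h integrable_on {s..t}"
      using integrable_on_lborel[OF h] integrable_on_subcbox[of h UNIV s t] by simp
    have mi: "\<mu> integrable_on {s..t}" using cont by (rule integrable_continuous_interval)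
    have "\<delta> * integral {s..t} \<mu> = integral {s..t} (\<lambda>x. \<delta> * \<mu> x)" by simp
    \<comment> \<open>The integrand is altered on the exceptional null set so that the comparison
      with \<open>h\<close> becomes pointwise.\<close>
    also have "\<dots> = integral {s..t} (\<lambda>x. if x \<in> N then h x else \<delta> * \<mu> x)"
      using N by (intro integral_spike[of N]) (auto simp: negligible_iff_null_sets)
    also have "\<dots> \<le> integral {s..t} h"
    proof (rule integral_le[OF _ hi])
      show "(\<lambda>x. if x \<in> N then h x else \<delta> * \<mu> x) integrable_on {s..t}"
      proof (rule integrable_spike[of "\<lambda>x. \<delta> * \<mu> x" _ N])
        show "(\<lambda>x. \<delta> * \<mu> x) integrable_on {s..t}"
          by (intro integrable_continuous_interval continuous_intros cont)
      qed (use N in \<open>auto simp: negligible_iff_null_sets\<close>)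
    qed (use N in auto)
    also have "\<dots> = \<mu> s - \<mu> t" using F[of s t] st by simp
    finally show ?thesis .
  qed simp
qed

section \<open>The square root of the elastic operator\<close>

locale sqrt_operator =
  fixes DA DB :: "'h::{real_inner,banach,second_countable_topology} set"
    and A B :: "'h \<Rightarrow> 'h"
  assumes A_sa: "selfadjoint_op DA A"
    and A_pos: "strictly_positive_op DA A"
    and A_cpt: "compact_inverse_op DA A"
    and B_sqrt: "is_sqrt_op DA A DB B"
begin

lemma subspace_DB: "subspace DB"
  and B_lin: "x \<in> DB \<Longrightarrow> y \<in> DB \<Longrightarrow> B (a *\<^sub>R x + b *\<^sub>R y) = a *\<^sub>R B x + b *\<^sub>R B y"
  and B_sym: "x \<in> DB \<Longrightarrow> y \<in> DB \<Longrightarrow> inner (B x) y = inner x (B y)"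
  and closure_DB: "closure DB = UNIV"
  and DA_iff: "x \<in> DA \<longleftrightarrow> x \<in> DB \<and> B x \<in> DB"
  and BB: "x \<in> DA \<Longrightarrow> B (B x) = A x"
  using B_sqrt unfolding is_sqrt_op_def selfadjoint_op_def linear_op_def by auto

lemma DB_lin: "x \<in> DB \<Longrightarrow> y \<in> DB \<Longrightarrow> a *\<^sub>R x + b *\<^sub>R y \<in> DB"
  using subspace_DB by (simp add: subspace_add subspace_scale)

lemma zero_DB [simp]: "0 \<in> DB" and B_zero [simp]: "B 0 = 0"
  using subspace_DB subspace_0 B_lin[of 0 0 0 0] by auto

lemma B_diff: "x \<in> DB \<Longrightarrow> y \<in> DB \<Longrightarrow> B (x - y) = B x - B y"
  using B_lin[of x y 1 "-1"] by simp

lemma B_scale: "x \<in> DB \<Longrightarrow> B (a *\<^sub>R x) = a *\<^sub>R B x"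
  using B_lin[of x x a 0] by simp

lemma B_add: "x \<in> DB \<Longrightarrow> y \<in> DB \<Longrightarrow> B (x + y) = B x + B y"
  using B_lin[of x y 1 1] by simp

lemma A_surj: "\<exists>x\<in>DA. A x = y"
  using A_cpt unfolding compact_inverse_op_def bij_betw_def by (metis UNIV_I imageE)

text \<open>If \<open>B\<close> vanishes at the difference d, then B d = 0 lies in
  \<open>DB\<close>, so d lies in \<open>DA\<close> with A d = 0, and strict positivity of
  \<open>A\<close> forces d = 0.\<close>

lemma B_inj: "x \<in> DB \<Longrightarrow> y \<in> DB \<Longrightarrow> B x = B y \<Longrightarrow> x = y"
proof -
  assume x: "x \<in> DB" and y: "y \<in> DB" and e: "B x = B y"
  have d: "x - y \<in> DB" using x y subspace_DB by (simp add: subspace_diff)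
  have B0: "B (x - y) = 0" using B_diff[OF x y] e by simp
  then have DA: "x - y \<in> DA" using d DA_iff by simp
  then have "A (x - y) = 0" using BB[OF DA] B0 by simp
  then have "x - y = 0" using A_pos DA unfolding strictly_positive_op_def by fastforce
  then show "x = y" by simp
qed

lemma B_surj: "\<exists>x\<in>DB. B x = y"
proof -
  obtain x where "x \<in> DA" "A x = y" using A_surj by blast
  then show ?thesis using BB DA_iff by metis
qed

text \<open>This is A^(-1/2), the isometry from H onto V. It lets statements about V-valued
  functions be proved for their images under \<open>B\<close> in H.\<close>

definition G :: "'h \<Rightarrow> 'h" where "G = inv_into DB B"

lemma G_DB [simp]: "G y \<in> DB" and B_G [simp]: "B (G y) = y"
  using B_surj[of y] unfolding G_def by (auto intro: inv_into_into f_inv_into_f)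

lemma G_B: "x \<in> DB \<Longrightarrow> G (B x) = x"
  by (rule B_inj) auto

lemma G_sym: "inner (G x) y = inner x (G y)"
  using B_sym[of "G x" "G y"] by simp

lemma inner_A: "x \<in> DA \<Longrightarrow> y \<in> DB \<Longrightarrow> inner (A x) y = inner (B x) (B y)"
  using BB[of x] B_sym[of "B x" y] DA_iff by simp

lemma G_eqI: "x \<in> DB \<Longrightarrow> B x = y \<Longrightarrow> G y = x"
  using G_B by auto

lemma G_in_DA: "w \<in> DB \<Longrightarrow> G w \<in> DA"
  by (simp add: DA_iff)

lemma inv_A: "inv_into DA A y = G (G y)"
proof -
  have GG: "G (G y) \<in> DA" "A (G (G y)) = y" using BB[of "G (G y)"] by (auto simp: DA_iff)
  have "inj_on A DA" using A_cpt unfolding compact_inverse_op_def bij_betw_def by auto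
  from inv_into_f_f[OF this GG(1)] GG(2) show ?thesis by simp
qed

text \<open>The square of \<open>G\<close> is the inverse of \<open>A\<close>, which maps the unit
  ball into a bounded set, being compact. Symmetry gives |G x|^2 = <x, G (G x)>, so a bound C for
  the inverse of \<open>A\<close> becomes sqrt C for \<open>G\<close>.\<close>

lemma G_bounded_linear: "bounded_linear G"
proof -
  have "bounded (closure (inv_into DA A ` cball 0 1))"
    using A_cpt unfolding compact_inverse_op_def by (meson bounded_cball compact_imp_bounded)
  then have "bounded (inv_into DA A ` cball 0 1)" by (rule bounded_subset) (rule closure_subset)
  then have "\<exists>C. \<forall>x. norm x \<le> 1 \<longrightarrow> norm (G (G x)) \<le> C"
    by (force simp: bounded_iff inv_A)
  then obtain C where C: "\<And>x. norm x \<le> 1 \<Longrightarrow> norm (G (G x)) \<le> C"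
    by blast
  have C0: "C \<ge> 0" using C[of 0] norm_ge_zero order_trans by (metis norm_zero zero_le_one)
  have add: "G (x + y) = G x + G y" for x y
    using B_add[of "G x" "G y"] subspace_DB by (intro G_eqI) (auto simp: subspace_add)
  have scale: "G (r *\<^sub>R x) = r *\<^sub>R G x" for r x
    using B_scale[of "G x" r] subspace_DB by (intro G_eqI) (auto simp: subspace_scale)
  have unit: "norm (G x) \<le> sqrt C" if "norm x \<le> 1" for x
  proof -
    have "(norm (G x))\<^sup>2 = inner x (G (G x))" by (simp add: power2_norm_eq_inner G_sym)
    also have "\<dots> \<le> norm x * norm (G (G x))" by (rule norm_cauchy_schwarz)
    also have "\<dots> \<le> 1 * C" using that C[OF that] by (intro mult_mono) auto
    finally show ?thesis by (simp add: real_le_rsqrt)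
  qed
  show ?thesis
  proof (rule bounded_linear_intro[of _ "sqrt C"])
    fix x
    show "norm (G x) \<le> norm x * sqrt C"
    proof (cases "x = 0")
      case False
      have "G x = norm x *\<^sub>R G (x /\<^sub>R norm x)" using False by (simp flip: scale)
      then have "norm (G x) = norm x * norm (G (x /\<^sub>R norm x))" by (metis abs_norm_cancel norm_scaleR)
      then show ?thesis using unit[of "x /\<^sub>R norm x"] False by (simp add: mult_left_mono)
    qed (use scale[of 0 0] in auto)
  qed (rule add scale)+
qed

lemma G_dense: "e > 0 \<Longrightarrow> \<exists>w\<in>DB. norm (w - p) < e"
  using closure_DB closure_approachable[of p DB] by (auto simp: dist_norm)

end

section \<open>Smooth plateau functions\<close>

text \<open>The smoothness clause of \<open>test_fun\<close>, separated from the support conditions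
  because a smooth step has no compact support.\<close>

definition smooth_fun :: "(real \<Rightarrow> real) \<Rightarrow> bool" where
  "smooth_fun f \<longleftrightarrow> (\<forall>n x. ((deriv ^^ n) f) differentiable (at x))"

lemma smooth_fun_DERIV: "smooth_fun f \<Longrightarrow> ((deriv ^^ n) f has_real_derivative (deriv ^^ Suc n) f x) (at x)"
  unfolding smooth_fun_def by (simp add: DERIV_deriv_iff_real_differentiable)

text \<open>With one common scale \<open>c\<close> the shape survives differentiation: each
  derivative only gains a factor \<open>c\<close>. Two shifts are what a difference of steps
  requires.\<close>

lemma smooth_fun_affine_combination:
  fixes f g :: "real \<Rightarrow> real"
  assumes f: "smooth_fun f" and g: "smooth_fun g"
  shows "smooth_fun (\<lambda>x. \<alpha> * f (c * x + a) + \<beta> * g (c * x + b))"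
proof -
  have der: "((\<lambda>x. \<alpha> * c ^ n * (deriv ^^ n) f (c * x + a) + \<beta> * c ^ n * (deriv ^^ n) g (c * x + b))
     has_real_derivative \<alpha> * c ^ Suc n * (deriv ^^ Suc n) f (c * x + a) + \<beta> * c ^ Suc n * (deriv ^^ Suc n) g (c * x + b)) (at x)" for n x
  proof -
    have 1: "((\<lambda>x. c * x + d) has_real_derivative c) (at x)" for d
      by (auto intro!: derivative_eq_intros)
    show ?thesis
      by (rule DERIV_cong[OF DERIV_add[OF
            DERIV_cmult[OF DERIV_chain2[OF smooth_fun_DERIV[OF f] 1]]
            DERIV_cmult[OF DERIV_chain2[OF smooth_fun_DERIV[OF g] 1]]]]) (simp add: algebra_simps)
  qed
  have "(deriv ^^ n) (\<lambda>x. \<alpha> * f (c * x + a) + \<beta> * g (c * x + b)) =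
      (\<lambda>x. \<alpha> * c ^ n * (deriv ^^ n) f (c * x + a) + \<beta> * c ^ n * (deriv ^^ n) g (c * x + b))" for n
  proof (induction n)
    case (Suc n)
    have "(deriv ^^ Suc n) (\<lambda>x. \<alpha> * f (c * x + a) + \<beta> * g (c * x + b)) =
      deriv (\<lambda>x. \<alpha> * c ^ n * (deriv ^^ n) f (c * x + a) + \<beta> * c ^ n * (deriv ^^ n) g (c * x + b))"
      using Suc by simp
    then show ?case using DERIV_imp_deriv[OF der[of n]] by auto
  qed simp
  then show ?thesis
    unfolding smooth_fun_def real_differentiable_def using der by auto
qed

text \<open>A family containing \<open>exp (-1/w)\<close>, \<open>w = x (1 - x)\<close>, on \<open>(0, 1)\<close> and closed under differentiation.\<close>
definition bump :: "nat \<Rightarrow> real poly \<Rightarrow> real \<Rightarrow> real" where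
  "bump k p x = (if 0 < x \<and> x < 1
     then poly p x * (1 / (x * (1 - x))) ^ k * exp (- (1 / (x * (1 - x)))) else 0)"

text \<open>Inside (0, 1), w = y (1 - y) is at most |y - x0|. With t = 1 / w the quotient is
  therefore at most M t^(k+1) exp(-t), and t grows without bound as y approaches x0.\<close>

lemma bump_difference_quotient_tendsto_0:
  assumes x0: "x0 = 0 \<or> x0 = 1"
  shows "((\<lambda>y. (bump k p y - 0) / (y - x0)) \<longlongrightarrow> 0) (at x0)"
proof (rule LIM_I)
  fix e :: real assume e: "0 < e"
  have "bounded (poly p ` {0..1})"
    by (intro compact_imp_bounded compact_continuous_image continuous_intros) auto
  then obtain M where M: "M > 0" "\<And>y. 0 \<le> y \<Longrightarrow> y \<le> 1 \<Longrightarrow> \<bar>poly p y\<bar> \<le> M"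
    unfolding bounded_pos by auto
  have "eventually (\<lambda>t::real. t ^ Suc k / exp t < e / M) at_top"
    using tendsto_power_div_exp_0[of "Suc k"] e M by (intro order_tendstoD) auto
  then obtain T where T: "T > 0" "\<And>t. t \<ge> T \<Longrightarrow> t ^ Suc k / exp t < e / M"
    unfolding eventually_at_top_linorder by (metis gt_ex less_imp_le linorder_not_le order_trans)
  show "\<exists>s>0. \<forall>x. x \<noteq> x0 \<and> norm (x - x0) < s \<longrightarrow> norm ((bump k p x - 0) / (x - x0) - 0) < e"
  proof (intro exI[of _ "1 / T"] conjI allI impI)
    fix y assume y: "y \<noteq> x0 \<and> norm (y - x0) < 1 / T"
    show "norm ((bump k p y - 0) / (y - x0) - 0) < e"
    proof (cases "0 < y \<and> y < 1")
      case True
      define w where "w = y * (1 - y)"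
      have w: "w > 0" "w \<le> \<bar>y - x0\<bar>"
        using True x0 mult_left_mono[of "1 - y" 1 y] mult_right_mono[of y 1 "1 - y"] by (auto simp: w_def)
      then have "w < 1 / T" using y by simp
      then have wT: "1 / w \<ge> T" using w(1) T(1) by (simp add: field_simps)
      have "norm ((bump k p y - 0) / (y - x0) - 0) = \<bar>poly p y\<bar> * (1 / w) ^ k * exp (- (1 / w)) * (1 / \<bar>y - x0\<bar>)"
        using True w(1) by (simp add: bump_def abs_mult w_def[symmetric] power_abs)
      also have "\<dots> \<le> M * (1 / w) ^ k * exp (- (1 / w)) * (1 / w)"
        using w M True y by (intro mult_mono divide_left_mono mult_nonneg_nonneg) auto
      also have "\<dots> = M * ((1 / w) ^ Suc k / exp (1 / w))"
        by (simp add: exp_minus field_simps)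
      also have "\<dots> < M * (e / M)"
        using T(2)[OF wT] M by (intro mult_strict_left_mono) auto
      finally show ?thesis using M by simp
    qed (use e in \<open>auto simp: bump_def\<close>)
  qed (use T in auto)
qed

text \<open>Here [:0, 1, -1:] is w = x - x^2 and [:1, -2:] is w'. Differentiating p w^(-k) exp(-1/w)
  and putting everything over w^(k+2) leaves the numerator p' w^2 - k p w' w + p w'.\<close>

lemma bump_DERIV:
  "(bump k p has_real_derivative
      bump (k + 2) (pderiv p * [:0, 1, -1:]\<^sup>2 - smult (real k) (p * [:1, -2:] * [:0, 1, -1:]) + p * [:1, -2:]) x) (at x)"
    (is "(_ has_real_derivative bump _ ?q x) _")
proof -
  consider "x < 0 \<or> x > 1" | "x = 0 \<or> x = 1" | "0 < x" "x < 1" by linarith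
  then show ?thesis
  proof cases
    case 1
    have "((\<lambda>x::real. 0) has_real_derivative 0) (at x)" by simp
    then have "(bump k p has_real_derivative 0) (at x)"
      by (rule has_field_derivative_transform_within_open[where S = "- {0..1}"])
        (use 1 in \<open>auto simp: bump_def\<close>)
    then show ?thesis using 1 by (auto simp: bump_def)
  next
    case 2
    then have "bump k p x = 0" "bump (k + 2) ?q x = 0" by (auto simp: bump_def)
    then show ?thesis
      using bump_difference_quotient_tendsto_0[OF 2, of k p] unfolding has_field_derivative_iff by simp
  next
    case 3
    let ?w = "\<lambda>x::real. x * (1 - x)"
    have w: "?w x > 0" using 3 by simp
    have dw: "(?w has_real_derivative (1 - 2 * x)) (at x)"
      by (auto intro!: derivative_eq_intros)
    have di: "((\<lambda>x. 1 / ?w x) has_real_derivative (- (1 - 2 * x) * (1 / ?w x)\<^sup>2)) (at x)"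
      using w 3 by (auto intro!: derivative_eq_intros dw simp: power2_eq_square divide_simps)
    have "((\<lambda>x. poly p x * (1 / ?w x) ^ k * exp (- (1 / ?w x))) has_real_derivative
        (poly (pderiv p) x * (1 / ?w x) ^ k + poly p x * (real k * (1 / ?w x) ^ (k - 1) * (- (1 - 2 * x) * (1 / ?w x)\<^sup>2))) * exp (- (1 / ?w x))
        + poly p x * (1 / ?w x) ^ k * (exp (- (1 / ?w x)) * ((1 - 2 * x) * (1 / ?w x)\<^sup>2))) (at x)"
      by (rule derivative_eq_intros di poly_DERIV refl | simp add: algebra_simps)+
    also have "(poly (pderiv p) x * (1 / ?w x) ^ k + poly p x * (real k * (1 / ?w x) ^ (k - 1) * (- (1 - 2 * x) * (1 / ?w x)\<^sup>2))) * exp (- (1 / ?w x))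
        + poly p x * (1 / ?w x) ^ k * (exp (- (1 / ?w x)) * ((1 - 2 * x) * (1 / ?w x)\<^sup>2)) = bump (k + 2) ?q x"
    proof -
      define r where "r = 1 / ?w x"
      have rw: "?w x * r = 1" using w 3 by (simp add: r_def)
      \<comment> \<open>For k = 0 the truncated exponent k - 1 is harmless because the factor
        \<open>real k\<close> vanishes.\<close>
      have k: "real k * r ^ (k - 1) * r\<^sup>2 = real k * r ^ Suc k"
        by (cases k) (auto simp: power2_eq_square)
      have q: "poly ?q x = poly (pderiv p) x * (?w x)\<^sup>2 - real k * (poly p x * (1 - 2 * x) * ?w x) + poly p x * (1 - 2 * x)"
        by (simp add: algebra_simps)
      have "poly ?q x * r ^ (k + 2) = poly (pderiv p) x * (?w x * r)\<^sup>2 * r ^ k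
          - real k * poly p x * (1 - 2 * x) * (?w x * r) * r ^ Suc k + poly p x * (1 - 2 * x) * r\<^sup>2 * r ^ k"
        unfolding q by (simp add: algebra_simps power_add power2_eq_square)
      also have "\<dots> = poly (pderiv p) x * r ^ k - (real k * r ^ (k - 1) * r\<^sup>2) * poly p x * (1 - 2 * x)
          + poly p x * (1 - 2 * x) * r\<^sup>2 * r ^ k"
        unfolding rw k by simp
      finally show ?thesis
        using 3 by (simp add: bump_def r_def[symmetric]) (simp add: algebra_simps)
    qed
    finally have "((\<lambda>x. poly p x * (1 / ?w x) ^ k * exp (- (1 / ?w x))) has_real_derivative bump (k + 2) ?q x) (at x)" .
    then show ?thesis
      by (rule has_field_derivative_transform_within_open[where S = "{0<..<1}"])
        (use 3 in \<open>auto simp: bump_def\<close>)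
  qed
qed

lemma smooth_bump: "smooth_fun (bump k p)"
proof -
  have "\<exists>k' p'. (deriv ^^ n) (bump k p) = bump k' p'" for n
  proof (induction n)
    case (Suc n)
    then obtain k' p' where "(deriv ^^ n) (bump k p) = bump k' p'" by blast
    moreover obtain q where "\<And>x. (bump k' p' has_real_derivative bump (k' + 2) q x) (at x)"
      using bump_DERIV by blast
    then have "deriv (bump k' p') = bump (k' + 2) q" using DERIV_imp_deriv by blast
    ultimately show ?case by auto
  qed auto
  then show ?thesis
    unfolding smooth_fun_def real_differentiable_def using bump_DERIV by (metis (no_types))
qed

text \<open>The step is a primitive of \<open>bump 0 1\<close>, normalised by its increment over
  [0, 1]; outside that interval the primitive is constant.\<close>

lemma smooth_step_exists:
  obtains H :: "real \<Rightarrow> real" where "smooth_fun H" "mono H"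
    "\<And>x. x \<le> 0 \<Longrightarrow> H x = 0" "\<And>x. 1 \<le> x \<Longrightarrow> H x = 1"
    "\<And>x. x \<le> 0 \<or> 1 \<le> x \<Longrightarrow> deriv H x = 0"
proof -
  let ?r = "bump 0 1"
  have "\<exists>F. \<forall>x. (F has_vector_derivative ?r x) (at x)"
    using einterval_antiderivative[of "-\<infinity>" "\<infinity>" ?r] DERIV_isCont[OF bump_DERIV[of 0 1]] by simp
  then obtain F where F: "\<And>x. (F has_real_derivative ?r x) (at x)"
    by (auto simp: has_real_derivative_iff_has_vector_derivative)
  have mono: "F x \<le> F y" if "x \<le> y" for x y
    using that by (rule DERIV_nonneg_imp_nondecreasing) (use F in \<open>auto simp: bump_def intro!: exI\<close>)
  have const: "F x = F y" if "y \<le> 0 \<and> x \<le> 0 \<or> 1 \<le> x \<and> 1 \<le> y" for x y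
  proof -
    have *: "F x = F y" if "x < y" "y \<le> 0 \<or> 1 \<le> x" for x y
    proof (rule DERIV_isconst_end[OF that(1), symmetric])
      show "continuous_on {x..y} F" using F DERIV_isCont by (meson continuous_at_imp_continuous_on)
      fix z assume "x < z" "z < y"
      then have "?r z = 0" using that by (auto simp: bump_def)
      then show "(F has_real_derivative 0) (at z)" using F[of z] by simp
    qed
    show ?thesis using that
    proof (cases x y rule: linorder_cases)
      case less then show ?thesis using that by (intro *) auto
    next
      case greater then show ?thesis using that by (intro *[symmetric]) auto
    qed simp
  qed
  \<comment> \<open>Otherwise monotonicity would make \<open>F\<close> constant on (0, 1), although
    its derivative at 1/2 is positive.\<close>
  have pos: "F 0 < F 1"
  proof (rule ccontr)
    assume "\<not> F 0 < F 1"
    then have "F x = F 0" if "x \<in> {0<..<1}" for x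
      using mono[of 0 x] mono[of x 1] that by auto
    then have "(F has_real_derivative 0) (at (1/2))"
      by (intro has_field_derivative_transform_within_open[OF DERIV_const, of "{0<..<1}" _ "F 0"]) auto
    then have "?r (1/2) = 0" using F DERIV_unique by blast
    then show False by (simp add: bump_def)
  qed
  define H where "H = (\<lambda>x. (F x - F 0) / (F 1 - F 0))"
  \<comment> \<open>The vanishing second summand fits this derivative to the two-term shape of
    \<open>smooth_fun_affine_combination\<close>.\<close>
  have dH: "(H has_real_derivative (1 / (F 1 - F 0)) * ?r (1 * x + 0) + 0 * ?r (1 * x + 0)) (at x)" for x
    unfolding H_def using pos by (auto intro!: derivative_eq_intros F)
  have sm: "smooth_fun (\<lambda>x. (1 / (F 1 - F 0)) * ?r (1 * x + 0) + 0 * ?r (1 * x + 0))"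
    by (rule smooth_fun_affine_combination[OF smooth_bump smooth_bump])
  have derH: "deriv H = (\<lambda>x. (1 / (F 1 - F 0)) * ?r (1 * x + 0) + 0 * ?r (1 * x + 0))"
    using DERIV_imp_deriv[OF dH] by blast
  have "smooth_fun H"
    unfolding smooth_fun_def
  proof (intro allI)
    fix n x
    show "(deriv ^^ n) H differentiable (at x)"
    proof (cases n)
      case 0 then show ?thesis using dH real_differentiable_def by auto
    next
      case (Suc m)
      then have "(deriv ^^ n) H = (deriv ^^ m) (deriv H)" by (simp add: funpow_swap1)
      then show ?thesis using sm unfolding derH smooth_fun_def by simp
    qed
  qed
  moreover have "mono H" using mono pos by (auto intro!: monoI divide_right_mono simp: H_def)
  moreover have "H x = 0" if "x \<le> 0" for x using const[of 0 x] that by (simp add: H_def)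
  moreover have "H x = 1" if "1 \<le> x" for x using const[of 1 x] that pos by (simp add: H_def)
  moreover have "deriv H x = 0" if "x \<le> 0 \<or> 1 \<le> x" for x using that by (auto simp: derH bump_def)
  ultimately show ?thesis by (rule that)
qed

definition smooth_step :: "real \<Rightarrow> real" where
  "smooth_step = (SOME H. smooth_fun H \<and> mono H \<and> (\<forall>x\<le>0. H x = 0) \<and> (\<forall>x\<ge>1. H x = 1) \<and>
     (\<forall>x. x \<le> 0 \<or> 1 \<le> x \<longrightarrow> deriv H x = 0))"

lemma smooth_step: "smooth_fun smooth_step" "mono smooth_step"
  "\<And>x. x \<le> 0 \<Longrightarrow> smooth_step x = 0" "\<And>x. 1 \<le> x \<Longrightarrow> smooth_step x = 1"
  "\<And>x. x \<le> 0 \<or> 1 \<le> x \<Longrightarrow> deriv smooth_step x = 0"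
proof -
  have "\<exists>H. smooth_fun H \<and> mono H \<and> (\<forall>x\<le>0. H x = 0) \<and> (\<forall>x\<ge>1. H x = 1) \<and>
     (\<forall>x. x \<le> 0 \<or> 1 \<le> x \<longrightarrow> deriv H x = 0)"
    using smooth_step_exists by metis
  from someI_ex[OF this, folded smooth_step_def]
  show "smooth_fun smooth_step" "mono smooth_step"
    "\<And>x. x \<le> 0 \<Longrightarrow> smooth_step x = 0" "\<And>x. 1 \<le> x \<Longrightarrow> smooth_step x = 1"
    "\<And>x. x \<le> 0 \<or> 1 \<le> x \<Longrightarrow> deriv smooth_step x = 0" by auto
qed

lemma smooth_step_bounds: "0 \<le> smooth_step x" "smooth_step x \<le> 1"
  using smooth_step(2-4) monoD[of smooth_step "min 0 x" x] monoD[of smooth_step x "max 1 x"] by auto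

lemma smooth_step_DERIV: "(smooth_step has_real_derivative deriv smooth_step x) (at x)"
  using smooth_fun_DERIV[OF smooth_step(1), of 0 x] by simp

lemma deriv_smooth_step_nonneg: "0 \<le> deriv smooth_step x"
  by (rule mono_on_imp_deriv_nonneg[of UNIV, OF _ smooth_step_DERIV])
    (use smooth_step(2) in \<open>auto simp: mono_on_def mono_def\<close>)

text \<open>A smooth substitute for the indicator of (a, b], with ramps on [a, a + 1/n] and
  [b, b + 1/n]. Its derivative is an approximate unit mass at \<open>a\<close> minus one at
  \<open>b\<close>, so testing a distributional derivative with it yields point values.\<close>

definition plateau :: "real \<Rightarrow> real \<Rightarrow> real \<Rightarrow> real \<Rightarrow> real" where
  "plateau n a b x = smooth_step (n * (x - a)) - smooth_step (n * (x - b))"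

lemma plateau_DERIV:
  "(plateau n a b has_real_derivative n * deriv smooth_step (n * (x - a)) - n * deriv smooth_step (n * (x - b))) (at x)"
proof -
  have 1: "((\<lambda>x. n * (x - c)) has_real_derivative n) (at x)" for c
    by (auto intro!: derivative_eq_intros)
  show ?thesis unfolding plateau_def
    by (rule DERIV_cong[OF DERIV_diff[OF DERIV_chain2[OF smooth_step_DERIV 1] DERIV_chain2[OF smooth_step_DERIV 1]]])
      simp
qed

lemma deriv_plateau: "deriv (plateau n a b) x = n * deriv smooth_step (n * (x - a)) - n * deriv smooth_step (n * (x - b))"
  by (rule DERIV_imp_deriv[OF plateau_DERIV])

lemma plateau_bounds:
  assumes "0 < n" "a \<le> b" shows "0 \<le> plateau n a b x" "plateau n a b x \<le> 1"
proof -
  have "smooth_step (n * (x - b)) \<le> smooth_step (n * (x - a))"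
    using assms by (intro monoD[OF smooth_step(2)]) simp
  then show "0 \<le> plateau n a b x" "plateau n a b x \<le> 1"
    using smooth_step_bounds[of "n * (x - a)"] smooth_step_bounds[of "n * (x - b)"] by (auto simp: plateau_def)
qed

lemma plateau_eq_0:
  assumes "0 < n" "a \<le> b" "x \<le> a \<or> b + 1 / n \<le> x" shows "plateau n a b x = 0"
proof -
  have "x \<le> a \<or> 1 \<le> n * (x - b)" using assms by (auto simp: field_simps)
  then show ?thesis
  proof
    assume "x \<le> a"
    then have "n * (x - a) \<le> 0" "n * (x - b) \<le> 0" using assms by (auto simp: mult_nonneg_nonpos)
    then show ?thesis by (simp add: plateau_def smooth_step)
  next
    assume h: "1 \<le> n * (x - b)"
    also have "\<dots> \<le> n * (x - a)" using assms by (intro mult_left_mono) auto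
    finally show ?thesis using h by (simp add: plateau_def smooth_step)
  qed
qed

lemma plateau_eq_1:
  assumes "0 < n" "a + 1 / n \<le> x" "x \<le> b" shows "plateau n a b x = 1"
proof -
  have "1 \<le> n * (x - a)" "n * (x - b) \<le> 0" using assms by (auto simp: field_simps)
  then show ?thesis by (simp add: plateau_def smooth_step)
qed

lemma test_fun_plateau:
  assumes n: "0 < n" and ab: "a \<le> b" and U: "{a..b + 1 / n} \<subseteq> U"
  shows "test_fun U (plateau n a b)"
  unfolding test_fun_def
proof (intro conjI)
  have "smooth_fun (\<lambda>x. 1 * smooth_step (n * x + (- n * a)) + (- 1) * smooth_step (n * x + (- n * b)))"
    by (rule smooth_fun_affine_combination[OF smooth_step(1) smooth_step(1)])
  also have "(\<lambda>x. 1 * smooth_step (n * x + (- n * a)) + (- 1) * smooth_step (n * x + (- n * b))) = plateau n a b"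
    by (auto simp: plateau_def algebra_simps)
  finally show "\<forall>m x. (deriv ^^ m) (plateau n a b) differentiable at x"
    unfolding smooth_fun_def .
  have "{x. plateau n a b x \<noteq> 0} \<subseteq> {a..b + 1 / n}"
  proof
    fix x assume "x \<in> {x. plateau n a b x \<noteq> 0}"
    then show "x \<in> {a..b + 1 / n}" using plateau_eq_0[OF n ab, of x] by force
  qed
  then have c: "closure {x. plateau n a b x \<noteq> 0} \<subseteq> {a..b + 1 / n}"
    by (rule closure_minimal) simp
  then show "closure {x. plateau n a b x \<noteq> 0} \<subseteq> U" using U by blast
  show "compact (closure {x. plateau n a b x \<noteq> 0})"
    using c by (metis closed_closure bounded_subset bounded_closed_interval compact_eq_bounded_closed)
qed

section \<open>A Lyapunov criterion for strongly continuous contraction semigroups\<close>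

text \<open>Only right quotients are controlled, so the mean value theorem does not apply. Tilting
  \<open>k\<close> by a slope e > 0 creates room: after the last time s with g s \<le> 0, the right
  quotients of \<open>k\<close> at s would all exceed e, against a limit that is at most 0.\<close>

lemma nonincreasing_if_right_quotient_limit_nonpos:
  fixes k :: "real \<Rightarrow> real"
  assumes cont: "continuous_on {0..} k"
    and lim: "\<And>t. 0 \<le> t \<Longrightarrow> \<exists>D\<le>0. ((\<lambda>h. (k (t + h) - k t) / h) \<longlongrightarrow> D) (at_right 0)"
    and T: "0 \<le> T"
  shows "k T \<le> k 0"
proof (rule field_le_epsilon)
  fix e' :: real assume e': "0 < e'"
  define e where "e = e' / (T + 1)"
  have e: "e > 0" using e' T by (simp add: e_def)
  define g where "g = (\<lambda>t. k t - k 0 - e * t)"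
  have "g T \<le> 0"
  proof (rule ccontr)
    assume gT: "\<not> g T \<le> 0"
    have cg: "continuous_on {0..T} g"
      unfolding g_def by (intro continuous_intros continuous_on_subset[OF cont]) auto
    let ?Z = "{t \<in> {0..T}. g t \<le> 0}"
    have "closed ?Z"
      using continuous_closed_preimage[OF cg, of "{..0}"] by (simp add: vimage_def Int_def conj_commute)
    moreover have "bounded ?Z" by (rule bounded_subset[of "{0..T}"]) auto
    ultimately have "compact ?Z" by (simp add: compact_eq_bounded_closed)
    moreover have "0 \<in> ?Z" using T by (auto simp: g_def)
    ultimately obtain s where s: "s \<in> ?Z" "\<And>t. t \<in> ?Z \<Longrightarrow> t \<le> s"
      using compact_attains_sup[of ?Z] by auto
    have sT: "s < T" using s(1) gT by (auto simp: le_less)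
    obtain D where D: "D \<le> 0" "((\<lambda>h. (k (s + h) - k s) / h) \<longlongrightarrow> D) (at_right 0)"
      using lim[of s] s(1) by auto
    have "eventually (\<lambda>h. (k (s + h) - k s) / h < e) (at_right 0)"
      using order_tendstoD(2)[OF D(2), of e] D(1) e by simp
    moreover have "eventually (\<lambda>h. h \<in> {0<..<T - s}) (at_right (0::real))"
      using sT by (intro eventually_at_right_real) simp
    ultimately have "eventually (\<lambda>h. False) (at_right (0::real))"
    proof eventually_elim
      case (elim h)
      then have "g (s + h) > 0" using s(1) s(2)[of "s + h"] by force
      then have "g (s + h) > g s" using s(1) by auto
      then have "k (s + h) - k s > e * h" by (simp add: g_def algebra_simps)
      then show False using elim by (simp add: field_simps)
    qed
    then show False by simp
  qed
  then have "k T \<le> k 0 + e * T" by (simp add: g_def)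
  also have "e * T \<le> e'" using e' T by (simp add: e_def field_simps)
  finally show "k T \<le> k 0 + e'" by simp
qed

text \<open>The integrating factor exp (c t) reduces this to the monotone case; the product rule is
  carried out on the right quotients themselves.\<close>

lemma exponential_decay_if_right_quotient_limit:
  fixes f :: "real \<Rightarrow> real"
  assumes cont: "continuous_on {0..} f"
    and lim: "\<And>t. 0 \<le> t \<Longrightarrow> \<exists>D. D \<le> - c * f t \<and> ((\<lambda>h. (f (t + h) - f t) / h) \<longlongrightarrow> D) (at_right 0)"
    and T: "0 \<le> T"
  shows "f T \<le> f 0 * exp (- c * T)"
proof -
  define k where "k = (\<lambda>t. f t * exp (c * t))"
  have "k T \<le> k 0"
  proof (rule nonincreasing_if_right_quotient_limit_nonpos[OF _ _ T])
    show "continuous_on {0..} k" unfolding k_def by (intro continuous_intros cont)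
    fix t :: real assume t: "0 \<le> t"
    obtain D where D: "D \<le> - c * f t" "((\<lambda>h. (f (t + h) - f t) / h) \<longlongrightarrow> D) (at_right 0)"
      using lim[OF t] by blast
    have "((\<lambda>x. exp (c * x)) has_real_derivative exp (c * t) * c) (at t)"
      by (auto intro!: derivative_eq_intros)
    then have e: "((\<lambda>h. (exp (c * (t + h)) - exp (c * t)) / h) \<longlongrightarrow> exp (c * t) * c) (at_right 0)"
      unfolding DERIV_def by (rule tendsto_within_subset) simp
    have e0: "((\<lambda>h. exp (c * (t + h))) \<longlongrightarrow> exp (c * (t + 0))) (at_right 0)"
      by (intro tendsto_intros)
    have "((\<lambda>h. (f (t + h) - f t) / h * exp (c * (t + h)) + f t * ((exp (c * (t + h)) - exp (c * t)) / h))
       \<longlongrightarrow> D * exp (c * (t + 0)) + f t * (exp (c * t) * c)) (at_right 0)"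
      by (intro tendsto_intros D e e0)
    moreover have "(f (t + h) - f t) / h * exp (c * (t + h)) + f t * ((exp (c * (t + h)) - exp (c * t)) / h)
        = (k (t + h) - k t) / h" for h
      by (cases "h = 0") (auto simp: k_def field_simps)
    ultimately have "((\<lambda>h. (k (t + h) - k t) / h) \<longlongrightarrow> (D + c * f t) * exp (c * t)) (at_right 0)"
      by (simp add: algebra_simps)
    moreover have "(D + c * f t) * exp (c * t) \<le> 0"
      using D(1) by (intro mult_nonpos_nonneg) auto
    ultimately show "\<exists>D\<le>0. ((\<lambda>h. (k (t + h) - k t) / h) \<longlongrightarrow> D) (at_right 0)" by blast
  qed
  then have "f T * exp (c * T) \<le> f 0" by (simp add: k_def)
  then show ?thesis by (simp add: exp_minus field_simps)
qed

text \<open>The form is only semidefinite, since functions equal almost everywhere are distinct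
  states, and \<open>lin\<close> is constrained only through \<open>ip\<close>, not by vector space
  laws. The carrier is a set because the form behaves well only on states of finite energy.\<close>

locale semi_inner_space =
  fixes X :: "'s set" and lin :: "real \<Rightarrow> 's \<Rightarrow> real \<Rightarrow> 's \<Rightarrow> 's" and ip :: "'s \<Rightarrow> 's \<Rightarrow> real"
  assumes lin_closed: "x \<in> X \<Longrightarrow> y \<in> X \<Longrightarrow> lin a x b y \<in> X"
    and ip_lin: "x \<in> X \<Longrightarrow> y \<in> X \<Longrightarrow> q \<in> X \<Longrightarrow> ip (lin a x b y) q = a * ip x q + b * ip y q"
    and ip_sym: "x \<in> X \<Longrightarrow> y \<in> X \<Longrightarrow> ip x y = ip y x"
    and ip_nonneg: "x \<in> X \<Longrightarrow> 0 \<le> ip x x"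
begin

definition sn :: "'s \<Rightarrow> real" where "sn x = sqrt (ip x x)"
definition sd :: "'s \<Rightarrow> 's \<Rightarrow> real" where "sd x y = sn (lin 1 x (-1) y)"

lemma ip_lin_right: "x \<in> X \<Longrightarrow> y \<in> X \<Longrightarrow> q \<in> X \<Longrightarrow> ip q (lin a x b y) = a * ip q x + b * ip q y"
  using ip_lin[of x y q a b] ip_sym lin_closed by simp

lemma sn_nonneg [simp]: "x \<in> X \<Longrightarrow> 0 \<le> sn x" by (simp add: sn_def ip_nonneg)

lemma sn_power2: "x \<in> X \<Longrightarrow> (sn x)\<^sup>2 = ip x x" by (simp add: sn_def ip_nonneg)

lemma cauchy_schwarz:
  assumes x: "x \<in> X" and y: "y \<in> X"
  shows "\<bar>ip x y\<bar> \<le> sn x * sn y"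
proof -
  have *: "0 \<le> a\<^sup>2 * ip x x + 2 * a * b * ip x y + b\<^sup>2 * ip y y" for a b
  proof -
    have "0 \<le> ip (lin a x b y) (lin a x b y)" by (intro ip_nonneg lin_closed x y)
    also have "\<dots> = a\<^sup>2 * ip x x + 2 * a * b * ip x y + b\<^sup>2 * ip y y"
      using x y lin_closed ip_sym[OF y x]
      by (simp add: ip_lin ip_lin_right algebra_simps power2_eq_square)
    finally show ?thesis .
  qed
  have "(ip x y)\<^sup>2 \<le> ip x x * ip y y"
  proof (cases "ip x x = 0")
    case True
    have "ip x y = 0"
    proof (rule ccontr)
      assume n: "ip x y \<noteq> 0"
      \<comment> \<open>With this coefficient and b = 1 the nonnegative quadratic takes the value
        -1.\<close>
      have "0 \<le> 2 * (- (ip y y + 1) / (2 * ip x y)) * 1 * ip x y + 1\<^sup>2 * ip y y"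
        using *[of "- (ip y y + 1) / (2 * ip x y)" 1] True by simp
      then show False using n by (simp add: field_simps)
    qed
    then show ?thesis using True by simp
  next
    case False
    then have p: "ip x x > 0" using ip_nonneg[OF x] by simp
    have "0 \<le> ip x x * (ip x x * ip y y - (ip x y)\<^sup>2)"
      using *[of "- ip x y" "ip x x"] by (simp add: power2_eq_square algebra_simps)
    then show ?thesis using p by (simp add: zero_le_mult_iff)
  qed
  also have "\<dots> = (sn x * sn y)\<^sup>2" using x y by (simp add: power_mult_distrib sn_power2)
  finally have "\<bar>ip x y\<bar>\<^sup>2 \<le> (sn x * sn y)\<^sup>2" by simp
  then show ?thesis by (rule power2_le_imp_le) (use x y in auto)
qed

text \<open>The triangle inequality for a \<open>d\<close> that is the sum of \<open>d1\<close> and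
  \<open>d2\<close> only as seen by the form: pair with \<open>d\<close> itself and divide by its
  seminorm.\<close>

lemma sn_le_addI:
  assumes X: "d \<in> X" "d1 \<in> X" "d2 \<in> X" and d: "\<And>q. q \<in> X \<Longrightarrow> ip d q = ip d1 q + ip d2 q"
  shows "sn d \<le> sn d1 + sn d2"
proof (cases "sn d = 0")
  case False
  then have p: "sn d > 0" using X sn_nonneg[of d] by linarith
  have "sn d * sn d = ip d1 d + ip d2 d" using d[OF X(1)] sn_power2[OF X(1)] by (simp add: power2_eq_square)
  also have "\<dots> \<le> sn d1 * sn d + sn d2 * sn d"
    using cauchy_schwarz[of d1 d] cauchy_schwarz[of d2 d] X by linarith
  finally have "sn d * sn d \<le> (sn d1 + sn d2) * sn d" by (simp add: algebra_simps)
  then show ?thesis using p by simp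
qed (use X in auto)

lemma sd_triangle: "x \<in> X \<Longrightarrow> y \<in> X \<Longrightarrow> z \<in> X \<Longrightarrow> sd x z \<le> sd x y + sd y z"
  unfolding sd_def by (rule sn_le_addI) (auto simp: lin_closed ip_lin)

lemma sd_sym: "x \<in> X \<Longrightarrow> y \<in> X \<Longrightarrow> sd x y = sd y x"
  unfolding sd_def sn_def by (simp add: lin_closed ip_lin ip_lin_right)

lemma sn_le_sd: "x \<in> X \<Longrightarrow> y \<in> X \<Longrightarrow> sn x \<le> sd x y + sn y"
  unfolding sd_def by (rule sn_le_addI) (auto simp: lin_closed ip_lin)

text \<open>The semigroup laws hold only up to distance zero; this is how they enter computations.
  It is Cauchy-Schwarz applied to the difference.\<close>

lemma ip_eq_if_sd_0: "x \<in> X \<Longrightarrow> y \<in> X \<Longrightarrow> sd x y = 0 \<Longrightarrow> q \<in> X \<Longrightarrow> ip x q = ip y q"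
  using cauchy_schwarz[of "lin 1 x (-1) y" q] by (simp add: sd_def lin_closed ip_lin)

lemma sn_cong: "x \<in> X \<Longrightarrow> y \<in> X \<Longrightarrow> (\<And>q. q \<in> X \<Longrightarrow> ip x q = ip y q) \<Longrightarrow> sn x = sn y"
proof -
  assume X: "x \<in> X" "y \<in> X" and e: "\<And>q. q \<in> X \<Longrightarrow> ip x q = ip y q"
  have "ip x x = ip y x" "ip y y = ip x y" using e X by auto
  then show ?thesis using ip_sym[OF X] by (simp add: sn_def)
qed

end

text \<open>\<open>Gen_exI\<close> grants membership in the domain only: the image it provides need
  not be the limit \<open>w\<close> itself.\<close>

locale generated_semigroup = semi_inner_space X lin ip
  for X :: "'s set" and lin ip +
  fixes S :: "real \<Rightarrow> 's \<Rightarrow> 's" and Gen :: "'s \<Rightarrow> 's \<Rightarrow> bool"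
  assumes S_closed: "0 \<le> t \<Longrightarrow> x \<in> X \<Longrightarrow> S t x \<in> X"
    and S_lin: "0 \<le> t \<Longrightarrow> x \<in> X \<Longrightarrow> y \<in> X \<Longrightarrow> sd (S t (lin a x b y)) (lin a (S t x) b (S t y)) = 0"
    and S_contraction: "0 \<le> t \<Longrightarrow> x \<in> X \<Longrightarrow> sn (S t x) \<le> sn x"
    and S_0: "x \<in> X \<Longrightarrow> sd (S 0 x) x = 0"
    and S_add: "0 \<le> t \<Longrightarrow> 0 \<le> s \<Longrightarrow> x \<in> X \<Longrightarrow> sd (S (t + s) x) (S t (S s x)) = 0"
    and S_cont: "0 \<le> t \<Longrightarrow> x \<in> X \<Longrightarrow> ((\<lambda>s. sd (S s x) (S t x)) \<longlongrightarrow> 0) (at t within {0..})"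
    and Gen_closed: "Gen x w \<Longrightarrow> x \<in> X \<and> w \<in> X"
    and Gen_exI: "x \<in> X \<Longrightarrow> w \<in> X \<Longrightarrow> ((\<lambda>h. sd (lin (1/h) (S h x) (-1/h) x) w) \<longlongrightarrow> 0) (at_right 0)
        \<Longrightarrow> \<exists>w. Gen x w"
    and Gen_lim: "Gen x w \<Longrightarrow> ((\<lambda>h. sd (lin (1/h) (S h x) (-1/h) x) w) \<longlongrightarrow> 0) (at_right 0)"
begin

text \<open>The difference quotient at S t x is, up to distance zero, S t applied to the one at x.
  Its distance to S t w is thus at most the distance of the original quotient to \<open>w\<close>,
  by contraction.\<close>

lemma Gen_S:
  assumes G: "Gen x w" and t: "0 \<le> t"
  shows "\<exists>w'. Gen (S t x) w'"
proof (rule Gen_exI)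
  have X: "x \<in> X" "w \<in> X" using Gen_closed[OF G] by auto
  show X': "S t x \<in> X" "S t w \<in> X" using X t by (auto intro: S_closed)
  show "((\<lambda>h. sd (lin (1/h) (S h (S t x)) (-1/h) (S t x)) (S t w)) \<longlongrightarrow> 0) (at_right 0)"
  proof (rule tendsto_sandwich[OF _ _ tendsto_const Gen_lim[OF G]])
    have h: "eventually (\<lambda>h. h \<in> {0<..<1}) (at_right (0::real))"
      by (intro eventually_at_right_real) simp
    show "eventually (\<lambda>h. 0 \<le> sd (lin (1/h) (S h (S t x)) (-1/h) (S t x)) (S t w)) (at_right 0)"
      using h by eventually_elim (auto simp: sd_def intro!: sn_nonneg lin_closed S_closed X X' t)
    show "eventually (\<lambda>h. sd (lin (1/h) (S h (S t x)) (-1/h) (S t x)) (S t w)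
        \<le> sd (lin (1/h) (S h x) (-1/h) x) w) (at_right 0)"
      using h
    proof eventually_elim
      case (elim h)
      then have h0: "0 \<le> h" by simp
      define D where "D = lin (1/h) (S h x) (-1/h) x"
      have Sh: "S h x \<in> X" "S h (S t x) \<in> X" "S t (S h x) \<in> X" "S (t + h) x \<in> X"
        using h0 t X X' by (auto intro!: S_closed)
      have D: "D \<in> X" unfolding D_def by (intro lin_closed Sh X)
      have E: "lin 1 D (-1) w \<in> X" by (intro lin_closed D X)
      have StD: "S t D \<in> X" using D t by (auto intro!: S_closed)
      have StE: "S t (lin 1 D (-1) w) \<in> X" using E t by (auto intro!: S_closed)
      have "sd (lin (1/h) (S h (S t x)) (-1/h) (S t x)) (S t w) = sn (S t (lin 1 D (-1) w))"
        unfolding sd_def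
      proof (rule sn_cong)
        fix q assume q: "q \<in> X"
        \<comment> \<open>Equalities of states hold only up to distance zero, so all four identities
          are expressed as equalities of pairings with an arbitrary \<open>q\<close>.\<close>
        have 1: "ip (S t (lin 1 D (-1) w)) q = ip (S t D) q - ip (S t w) q"
          using ip_eq_if_sd_0[OF StE _ S_lin[OF t D X(2)] q] by (simp add: lin_closed StD X' ip_lin q)
        have 2: "ip (S t D) q = (1/h) * ip (S t (S h x)) q - (1/h) * ip (S t x) q"
          using ip_eq_if_sd_0[OF StD _ S_lin[OF t Sh(1) X(1), of "1/h" "-1/h", folded D_def] q] by (simp add: lin_closed Sh X' ip_lin q)
        have 3: "ip (S t (S h x)) q = ip (S (t + h) x) q"
          using ip_eq_if_sd_0[OF Sh(4,3) S_add[OF t h0 X(1)] q] by simp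
        have 4: "ip (S (t + h) x) q = ip (S h (S t x)) q"
          using ip_eq_if_sd_0[OF _ Sh(2) S_add[OF h0 t X(1)] q] Sh(4) by (simp add: add.commute)
        show "ip (lin 1 (lin (1/h) (S h (S t x)) (-1/h) (S t x)) (-1) (S t w)) q = ip (S t (lin 1 D (-1) w)) q"
          unfolding 1 2 3 4 by (simp add: lin_closed Sh X' ip_lin q)
      qed (intro lin_closed Sh X' StE)+
      also have "\<dots> \<le> sd D w" unfolding sd_def by (rule S_contraction[OF t E])
      finally show ?case unfolding D_def .
    qed
  qed
qed

text \<open>For a start in the domain, f t = Q (S t y) (S t y) has the right derivative 2 Q (S t y)
  w', where w' is the image of S t y. It is at most - r |S t y|^2, hence at most - (r / C) f t,
  since f is at most C |S t y|^2. Passing from the square to the norm halves the exponent and turns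
  C / c into its root. Density and contraction extend the bound to all states.\<close>

theorem exponential_stability:
  assumes Q_lin: "\<And>x y q a b. x \<in> X \<Longrightarrow> y \<in> X \<Longrightarrow> q \<in> X \<Longrightarrow> Q (lin a x b y) q = a * Q x q + b * Q y q"
    and Q_sym: "\<And>x y. x \<in> X \<Longrightarrow> y \<in> X \<Longrightarrow> Q x y = Q y x"
    and Q_bounded: "\<And>x y. x \<in> X \<Longrightarrow> y \<in> X \<Longrightarrow> \<bar>Q x y\<bar> \<le> C * sn x * sn y"
    and Q_coercive: "\<And>x. x \<in> X \<Longrightarrow> c * (sn x)\<^sup>2 \<le> Q x x"
    and Q_decreasing: "\<And>x w. Gen x w \<Longrightarrow> 2 * Q x w \<le> - r * (sn x)\<^sup>2"
    and pos: "0 < C" "0 < c" "0 < r"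
    and dense: "\<And>x e. x \<in> X \<Longrightarrow> 0 < e \<Longrightarrow> \<exists>y w. Gen y w \<and> sd x y < e"
    and x: "x \<in> X" and t: "0 \<le> t"
  shows "sn (S t x) \<le> sqrt (C / c) * exp (- (r / (2 * C)) * t) * sn x"
proof -
  define K where "K = sqrt (C / c) * exp (- (r / (2 * C)) * t)"
  have K0: "0 \<le> K" using pos by (simp add: K_def)
  have diff: "\<bar>Q x q - Q y q\<bar> \<le> C * sd x y * sn q" if "x \<in> X" "y \<in> X" "q \<in> X" for x y q
    using Q_bounded[of "lin 1 x (-1) y" q] that by (simp add: Q_lin lin_closed sd_def)
  have sd0: "0 \<le> sd x y" if "x \<in> X" "y \<in> X" for x y using that by (simp add: sd_def lin_closed)
  have dom: "sn (S t y) \<le> K * sn y" if G: "Gen y w" for y w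
  proof -
    have y: "y \<in> X" using Gen_closed[OF G] by simp
    have Sy: "S t y \<in> X" if "0 \<le> t" for t using that y by (rule S_closed)
    define f where "f = (\<lambda>t. Q (S t y) (S t y))"
    have f_le: "f t \<le> C * (sn (S t y))\<^sup>2" if "0 \<le> t" for t
      using Q_bounded[OF Sy[OF that] Sy[OF that]] by (simp add: f_def power2_eq_square algebra_simps)
    have "continuous_on {0..} f"
      unfolding continuous_on_def
    proof
      fix t :: real assume "t \<in> {0..}"
      then have t: "0 \<le> t" by simp
      have "((\<lambda>s. f s - f t) \<longlongrightarrow> 0) (at t within {0..})"
      proof (rule Lim_null_comparison)
        have "eventually (\<lambda>s. s \<in> {0..}) (at t within {0..})" by (simp add: eventually_at_filter)
        then show "eventually (\<lambda>s. norm (f s - f t) \<le> sd (S s y) (S t y) * (2 * C * sn y)) (at t within {0..})"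
        proof eventually_elim
          case (elim s)
          then have s: "0 \<le> s" by simp
          note XX = Sy[OF s] Sy[OF t]
          \<comment> \<open>The two middle terms cancel by symmetry, and each bracket changes only
            one argument of \<open>Q\<close>.\<close>
          have "f s - f t = (Q (S s y) (S s y) - Q (S t y) (S s y)) + (Q (S s y) (S t y) - Q (S t y) (S t y))"
            using Q_sym[OF XX] by (simp add: f_def)
          also have "norm \<dots> \<le> C * sd (S s y) (S t y) * sn (S s y) + C * sd (S s y) (S t y) * sn (S t y)"
            using diff[OF XX XX(1)] diff[OF XX XX(2)] by (simp add: abs_le_iff)
          also have "\<dots> \<le> C * sd (S s y) (S t y) * sn y + C * sd (S s y) (S t y) * sn y"
            using S_contraction[OF s y] S_contraction[OF t y] pos sd0[OF XX]
            by (intro add_mono mult_left_mono mult_nonneg_nonneg) auto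
          finally show ?case by (simp add: algebra_simps)
        qed
        show "((\<lambda>s. sd (S s y) (S t y) * (2 * C * sn y)) \<longlongrightarrow> 0) (at t within {0..})"
          using tendsto_mult_right[OF S_cont[OF t y], of "2 * C * sn y"] by simp
      qed
      then show "(f \<longlongrightarrow> f t) (at t within {0..})" by (simp add: LIM_zero_iff)
    qed
    moreover have "\<exists>D. D \<le> - (r / C) * f t \<and> ((\<lambda>h. (f (t + h) - f t) / h) \<longlongrightarrow> D) (at_right 0)" if t: "0 \<le> t" for t
    proof -
      obtain w' where G': "Gen (S t y) w'" using Gen_S[OF G t] by blast
      have w': "w' \<in> X" using Gen_closed[OF G'] by simp
      let ?y = "S t y" and ?D = "\<lambda>h. lin (1/h) (S h (S t y)) (-1/h) (S t y)"
      have yX: "?y \<in> X" by (rule Sy[OF t])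
      have "((\<lambda>h. (f (t + h) - f t) / h - 2 * Q ?y w') \<longlongrightarrow> 0) (at_right 0)"
      proof (rule Lim_null_comparison)
        have "eventually (\<lambda>h. h \<in> {0<..<1}) (at_right (0::real))"
          by (intro eventually_at_right_real) simp
        \<comment> \<open>\<open>S 0 ?y\<close> appears instead of \<open>?y\<close> because
          \<open>S 0\<close> is the identity only up to distance zero and strong continuity at time
          0 compares with \<open>S 0\<close>.\<close>
        then show "eventually (\<lambda>h. norm ((f (t + h) - f t) / h - 2 * Q ?y w') \<le>
            sd (?D h) w' * (2 * C * sn ?y) + sd (S h ?y) (S 0 ?y) * (C * sn w')) (at_right 0)"
        proof eventually_elim
          case (elim h)
          then have h: "h \<noteq> 0" "0 \<le> h" by auto
          have Sh: "S h ?y \<in> X" "S 0 ?y \<in> X" "S (t + h) y \<in> X" using h t yX Sy[of "t + h"] by (auto intro: S_closed)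
          have D: "?D h \<in> X" by (intro lin_closed Sh yX)
          have e: "Q (S (t + h) y) q = Q (S h ?y) q" if "q \<in> X" for q
            using diff[OF Sh(3,1) that] S_add[OF h(2) t y] by (simp add: add.commute)
          have "f (t + h) = Q (S h ?y) (S h ?y)"
            unfolding f_def using e[OF Sh(3)] e[OF Sh(1)] Q_sym Sh by metis
          \<comment> \<open>Difference of squares for a symmetric form: Q a a - Q b b = Q (a - b) a
            + Q (a - b) b.\<close>
          then have "(f (t + h) - f t) / h = Q (?D h) (S h ?y) + Q (?D h) ?y"
            using h Q_sym[OF Sh(1) yX] by (simp add: f_def Q_lin Sh yX field_simps)
          moreover have "Q w' (S 0 ?y) = Q w' ?y"
            using diff[OF Sh(2) yX w'] S_0[OF yX] Q_sym w' Sh yX by simp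
          ultimately have eq: "(f (t + h) - f t) / h - 2 * Q ?y w' = (Q (?D h) (S h ?y) - Q w' (S h ?y))
             + (Q (?D h) ?y - Q w' ?y) + (Q (S h ?y) w' - Q (S 0 ?y) w')"
            using Q_sym w' Sh yX by simp
          have "norm ((f (t + h) - f t) / h - 2 * Q ?y w') \<le> C * sd (?D h) w' * sn (S h ?y) + C * sd (?D h) w' * sn ?y + C * sd (S h ?y) (S 0 ?y) * sn w'"
            using diff[OF D w' Sh(1)] diff[OF D w' yX] diff[OF Sh(1,2) w'] unfolding eq real_norm_def by linarith
          also have "\<dots> \<le> C * sd (?D h) w' * sn ?y + C * sd (?D h) w' * sn ?y + C * sd (S h ?y) (S 0 ?y) * sn w'"
            using S_contraction[OF h(2) yX] pos sd0[OF D w'] by (intro add_mono mult_left_mono mult_nonneg_nonneg order_refl) auto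
          finally show ?case by (simp add: algebra_simps)
        qed
        have 2: "((\<lambda>h. sd (S h ?y) (S 0 ?y)) \<longlongrightarrow> 0) (at_right 0)"
          using S_cont[OF order_refl yX] by (rule tendsto_within_subset) auto
        show "((\<lambda>h. sd (?D h) w' * (2 * C * sn ?y) + sd (S h ?y) (S 0 ?y) * (C * sn w')) \<longlongrightarrow> 0) (at_right 0)"
          using tendsto_add[OF tendsto_mult_right[OF Gen_lim[OF G'], of "2 * C * sn ?y"] tendsto_mult_right[OF 2, of "C * sn w'"]] by simp
      qed
      then have "((\<lambda>h. (f (t + h) - f t) / h) \<longlongrightarrow> 2 * Q ?y w') (at_right 0)" by (simp add: LIM_zero_iff)
      moreover have "2 * Q ?y w' \<le> - (r / C) * f t"
      proof -
        have "r / C * f t \<le> r / C * (C * (sn ?y)\<^sup>2)"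
          using f_le[OF t] pos by (intro mult_left_mono) auto
        then show ?thesis using Q_decreasing[OF G'] pos by simp
      qed
      ultimately show ?thesis by blast
    qed
    ultimately have "f t \<le> f 0 * exp (- (r / C) * t)"
      using t by (rule exponential_decay_if_right_quotient_limit)
    moreover have "c * (sn (S t y))\<^sup>2 \<le> f t" unfolding f_def by (rule Q_coercive[OF Sy[OF t]])
    moreover have "f 0 * exp (- (r / C) * t) \<le> C * (sn y)\<^sup>2 * exp (- (r / C) * t)"
    proof (rule mult_right_mono)
      have "f 0 \<le> C * (sn (S 0 y))\<^sup>2" by (rule f_le) simp
      also have "\<dots> \<le> C * (sn y)\<^sup>2"
        using S_contraction[OF order_refl y] pos Sy[of 0] by (intro mult_left_mono power_mono) auto
      finally show "f 0 \<le> C * (sn y)\<^sup>2" .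
    qed simp
    ultimately have "c * (sn (S t y))\<^sup>2 \<le> C * (sn y)\<^sup>2 * exp (- (r / C) * t)" by linarith
    then have "(sn (S t y))\<^sup>2 \<le> (C / c) * exp (- (r / C) * t) * (sn y)\<^sup>2" using pos by (simp add: field_simps)
    also have "\<dots> = (K * sn y)\<^sup>2"
      using pos by (simp add: K_def power_mult_distrib exp_double[symmetric] field_simps)
    finally show ?thesis by (rule power2_le_imp_le) (use K0 y Sy[OF t] in auto)
  qed
  have "sn (S t x) \<le> K * sn x + e" if e: "e > 0" for e
  proof -
    \<comment> \<open>One \<open>e1\<close> is lost between the two orbits and K times
      \<open>e1\<close> when the norm of \<open>y\<close> is replaced by that of \<open>x\<close>;
      together this is \<open>e\<close>.\<close>
    define e1 where "e1 = e / (K + 1)"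
    have e1: "0 < e1" using e K0 by (simp add: e1_def)
    obtain y w where G: "Gen y w" and xy: "sd x y < e1" using dense[OF x e1] by blast
    have y: "y \<in> X" using Gen_closed[OF G] by simp
    have StX: "S t x \<in> X" "S t y \<in> X" using t x y by (auto intro: S_closed)
    let ?d = "lin 1 x (-1) y"
    have d: "?d \<in> X" by (intro lin_closed x y)
    have Sd: "S t ?d \<in> X" using t d by (rule S_closed)
    have "sd (S t x) (S t y) = sn (S t ?d)"
      unfolding sd_def
    proof (rule sn_cong)
      fix q assume "q \<in> X"
      then show "ip (lin 1 (S t x) (- 1) (S t y)) q = ip (S t ?d) q"
        using ip_eq_if_sd_0[OF Sd _ S_lin[OF t x y]] by (simp add: lin_closed StX)
    qed (intro lin_closed StX Sd)+
    also have "\<dots> \<le> sd x y" unfolding sd_def by (rule S_contraction[OF t d])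
    finally have 1: "sd (S t x) (S t y) < e1" using xy by simp
    have "sn (S t x) \<le> e1 + K * sn y" using sn_le_sd[OF StX] 1 dom[OF G] by linarith
    moreover have "K * sn y \<le> K * (e1 + sn x)"
      using sn_le_sd[OF y x] sd_sym[OF x y] xy K0 by (intro mult_left_mono) auto
    ultimately have "sn (S t x) \<le> (K + 1) * e1 + K * sn x" by (simp add: algebra_simps)
    then show ?thesis using K0 by (simp add: e1_def)
  qed
  then show ?thesis unfolding K_def by (rule field_le_epsilon)
qed

end

section \<open>The weighted space of memory functions\<close>

definition square_integrable :: "'a measure \<Rightarrow> ('a \<Rightarrow> 'b::{real_inner,second_countable_topology}) \<Rightarrow> bool" where
  "square_integrable M f \<longleftrightarrow> f \<in> borel_measurable M \<and> integrable M (\<lambda>x. (norm (f x))\<^sup>2)"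

lemma square_integrable_norm: "square_integrable M f \<Longrightarrow> square_integrable M (\<lambda>x. norm (f x))"
  unfolding square_integrable_def by auto

lemma square_integrable_norm_mult:
  assumes f: "square_integrable M f" and g: "square_integrable M g"
  shows "integrable M (\<lambda>x. norm (f x) * norm (g x))"
proof (rule Bochner_Integration.integrable_bound[of M "\<lambda>x. (norm (f x))\<^sup>2 + (norm (g x))\<^sup>2"])
  show "AE x in M. norm (norm (f x) * norm (g x)) \<le> norm ((norm (f x))\<^sup>2 + (norm (g x))\<^sup>2)"
  proof (rule AE_I2)
    fix x
    have "2 * (norm (f x) * norm (g x)) \<le> (norm (f x))\<^sup>2 + (norm (g x))\<^sup>2"
      using sum_squares_bound[of "norm (f x)" "norm (g x)"] by simp
    moreover have "0 \<le> norm (f x) * norm (g x)" by simp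
    ultimately show "norm (norm (f x) * norm (g x)) \<le> norm ((norm (f x))\<^sup>2 + (norm (g x))\<^sup>2)"
      unfolding real_norm_def by linarith
  qed
qed (use f g in \<open>auto simp: square_integrable_def\<close>)

lemma square_integrable_inner:
  assumes f: "square_integrable M f" and g: "square_integrable M g"
  shows "integrable M (\<lambda>x. inner (f x) (g x))"
  by (rule Bochner_Integration.integrable_bound[OF square_integrable_norm_mult[OF f g]])
    (use f g in \<open>auto simp: square_integrable_def abs_mult Cauchy_Schwarz_ineq2\<close>)

lemma square_integrable_lin:
  assumes f: "square_integrable M f" and g: "square_integrable M g"
  shows "square_integrable M (\<lambda>x. a *\<^sub>R f x + b *\<^sub>R g x)"
proof -
  have "integrable M (\<lambda>x. a\<^sup>2 * (norm (f x))\<^sup>2 + b\<^sup>2 * (norm (g x))\<^sup>2 + 2 * a * b * inner (f x) (g x))"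
    using f g square_integrable_inner[OF f g] by (auto simp: square_integrable_def)
  also have "(\<lambda>x. a\<^sup>2 * (norm (f x))\<^sup>2 + b\<^sup>2 * (norm (g x))\<^sup>2 + 2 * a * b * inner (f x) (g x))
      = (\<lambda>x. (norm (a *\<^sub>R f x + b *\<^sub>R g x))\<^sup>2)"
    by (intro ext) (simp add: power2_norm_eq_inner inner_add_left inner_add_right inner_commute algebra_simps power2_eq_square[of a] power2_eq_square[of b])
  finally show ?thesis using f g by (auto simp: square_integrable_def)
qed

lemma square_integrable_dominated:
  assumes "square_integrable M f" "g \<in> borel_measurable M" "AE x in M. norm (g x) \<le> C * norm (f x)"
  shows "square_integrable M g"
  unfolding square_integrable_def
proof
  show "integrable M (\<lambda>x. (norm (g x))\<^sup>2)"
  proof (rule Bochner_Integration.integrable_bound[of M "\<lambda>x. C\<^sup>2 * (norm (f x))\<^sup>2"])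
    show "AE x in M. norm ((norm (g x))\<^sup>2) \<le> norm (C\<^sup>2 * (norm (f x))\<^sup>2)"
      using assms(3)
    proof eventually_elim
      case (elim x)
      from power_mono[OF this, of 2] show ?case by (simp add: power_mult_distrib)
    qed
  qed (use assms in \<open>auto simp: square_integrable_def\<close>)
qed (rule assms)

definition L2_norm :: "'a measure \<Rightarrow> ('a \<Rightarrow> 'b::real_normed_vector) \<Rightarrow> real" where
  "L2_norm M f = sqrt (\<integral>x. (norm (f x))\<^sup>2 \<partial>M)"

text \<open>Makes the abstract Cauchy-Schwarz and triangle inequalities available for functions,
  without forming classes modulo null sets.\<close>

lemma L2_semi_inner_space:
  "semi_inner_space (Collect (square_integrable M)) (\<lambda>a f b g x. a *\<^sub>R f x + b *\<^sub>R g x) (\<lambda>f g. \<integral>x. inner (f x) (g x) \<partial>M)"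
proof
  fix f g q :: "'a \<Rightarrow> 'b" and a b :: real
  assume "f \<in> Collect (square_integrable M)" "g \<in> Collect (square_integrable M)" "q \<in> Collect (square_integrable M)"
  then have I: "integrable M (\<lambda>x. inner (f x) (q x))" "integrable M (\<lambda>x. inner (g x) (q x))"
    by (auto intro: square_integrable_inner)
  show "(\<integral>x. inner (a *\<^sub>R f x + b *\<^sub>R g x) (q x) \<partial>M) = a * (\<integral>x. inner (f x) (q x) \<partial>M) + b * (\<integral>x. inner (g x) (q x) \<partial>M)"
    using I by (simp add: inner_add_left)
qed (auto simp: square_integrable_lin inner_commute)

lemma L2_Cauchy_Schwarz:
  assumes "square_integrable M f" "square_integrable M g"
  shows "\<bar>\<integral>x. inner (f x) (g x) \<partial>M\<bar> \<le> L2_norm M f * L2_norm M g"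
proof -
  interpret semi_inner_space "Collect (square_integrable M)" "\<lambda>a f b g x. a *\<^sub>R f x + b *\<^sub>R g x"
     "\<lambda>f g. \<integral>x. inner (f x) (g x) \<partial>M" by (rule L2_semi_inner_space)
  show ?thesis
    using cauchy_schwarz[of f g] assms by (simp add: sn_def L2_norm_def power2_norm_eq_inner)
qed

lemma L2_Cauchy_Schwarz_norm:
  assumes "square_integrable M f" "square_integrable M g"
  shows "(\<integral>x. norm (f x) * norm (g x) \<partial>M) \<le> L2_norm M f * L2_norm M g"
  using L2_Cauchy_Schwarz[OF assms[THEN square_integrable_norm]] by (simp add: L2_norm_def)

lemma L2_norm_nonneg [simp]: "0 \<le> L2_norm M f" by (simp add: L2_norm_def)

lemma L2_norm_power2: "(L2_norm M f)\<^sup>2 = (\<integral>x. (norm (f x))\<^sup>2 \<partial>M)" by (simp add: L2_norm_def)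

lemma L2_norm_triangle:
  fixes f g h :: "'a \<Rightarrow> 'b::{real_inner,second_countable_topology}"
  assumes "square_integrable M f" "square_integrable M g" "square_integrable M h"
  shows "L2_norm M (\<lambda>x. f x - h x) \<le> L2_norm M (\<lambda>x. f x - g x) + L2_norm M (\<lambda>x. g x - h x)"
proof -
  interpret L: semi_inner_space "Collect (square_integrable M)" "\<lambda>a f b g x. a *\<^sub>R f x + b *\<^sub>R (g x :: 'b)"
     "\<lambda>f g. \<integral>x. inner (f x) (g x) \<partial>M" by (rule L2_semi_inner_space)
  show ?thesis
    using L.sd_triangle[of f g h] assms by (simp add: L.sd_def L.sn_def L2_norm_def power2_norm_eq_inner)
qed

lemma square_integrable_diff:
  fixes f g :: "'a \<Rightarrow> 'b::{real_inner,second_countable_topology}"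
  assumes "square_integrable M f" "square_integrable M g"
  shows "square_integrable M (\<lambda>x. f x - g x)"
  using square_integrable_lin[OF assms, of 1 "-1"] by simp

lemma L2_norm_scaled_bound:
  fixes f g :: "'a \<Rightarrow> 'b::{real_inner,second_countable_topology}"
  assumes g: "square_integrable M g" and f: "f \<in> borel_measurable M" and C: "0 \<le> C"
    and le: "\<And>x. norm (f x) \<le> C * norm (g x)"
  shows "L2_norm M f \<le> C * L2_norm M g"
proof -
  have sf: "square_integrable M f" by (rule square_integrable_dominated[OF g f]) (use le in auto)
  have "(\<integral>x. (norm (f x))\<^sup>2 \<partial>M) \<le> (\<integral>x. C\<^sup>2 * (norm (g x))\<^sup>2 \<partial>M)"
  proof (rule integral_mono)
    show "(norm (f x))\<^sup>2 \<le> C\<^sup>2 * (norm (g x))\<^sup>2" for x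
      using power_mono[OF le[of x], of 2] by (simp add: power_mult_distrib)
  qed (use sf g in \<open>auto simp: square_integrable_def\<close>)
  then have "L2_norm M f \<le> sqrt (C\<^sup>2 * (\<integral>x. (norm (g x))\<^sup>2 \<partial>M))" unfolding L2_norm_def by simp
  then show ?thesis using C by (simp add: L2_norm_def real_sqrt_mult)
qed

lemma set_integrable_lebesgue_continuous:
  fixes f :: "real \<Rightarrow> 'b::{banach,second_countable_topology}"
  assumes "continuous_on {a..b} f"
  shows "set_integrable lebesgue {a..b} f"
proof -
  have "integrable lborel (\<lambda>x. indicator {a..b} x *\<^sub>R f x)"
    using assms by (intro borel_integrable_compact) auto
  then show ?thesis
    unfolding set_integrable_def by (subst integrable_completion) auto
qed

section \<open>The kernel, its reciprocal and the measure with density 1/\<mu>\<close>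

locale memory_kernel =
  fixes ell :: ereal and \<mu> :: "real \<Rightarrow> real" and \<delta> :: real
  assumes ell_pos: "0 < ell"
    and mu: "kernel_ok ell \<mu>"
    and delta_pos: "\<delta> > 0"
    and mu_decay: "AE s in lebesgue. s \<in> Omega ell \<longrightarrow>
                     (\<forall>d. (\<mu> has_real_derivative d) (at s) \<longrightarrow> d + \<delta> * \<mu> s \<le> 0)"
begin

abbreviation \<Omega> :: "real set" where "\<Omega> \<equiv> Omega ell"

lemma Omega_einterval: "\<Omega> = einterval 0 ell"
  by (auto simp: Omega_def einterval_def)

lemma open_Omega [simp]: "open \<Omega>" and Omega_borel [measurable, simp]: "\<Omega> \<in> sets borel"
  and Omega_lebesgue [measurable, simp]: "\<Omega> \<in> sets lebesgue"
  by (auto simp: Omega_einterval)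

lemma Icc_subset_Omega: "s \<in> \<Omega> \<Longrightarrow> t \<in> \<Omega> \<Longrightarrow> {s..t} \<subseteq> \<Omega>"
  unfolding Omega_def by (auto intro: le_less_trans[of "ereal _" "ereal t"])

lemma mu_pos: "s \<in> \<Omega> \<Longrightarrow> 0 < \<mu> s"
  and mu_antimono: "s \<in> \<Omega> \<Longrightarrow> t \<in> \<Omega> \<Longrightarrow> s \<le> t \<Longrightarrow> \<mu> t \<le> \<mu> s"
  and mu_set_integrable: "set_integrable lebesgue \<Omega> \<mu>"
  using mu unfolding kernel_ok_def by (simp_all add: Ball_def)

lemma mu_integral_decay: "s \<in> \<Omega> \<Longrightarrow> t \<in> \<Omega> \<Longrightarrow> s \<le> t \<Longrightarrow> \<delta> * integral {s..t} \<mu> \<le> \<mu> s - \<mu> t"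
  by (rule kernel_integral_decay(1)[OF mu mu_decay])

lemma mu_continuous_Icc: "s \<in> \<Omega> \<Longrightarrow> t \<in> \<Omega> \<Longrightarrow> continuous_on {s..t} \<mu>"
  using kernel_integral_decay(2)[OF mu mu_decay, of s t] by (cases "s \<le> t") auto

text \<open>The differential inequality \<nu>' \<ge> \<delta> \<nu> in increments, where \<nu> is
  1/\<mu>. Monotonicity bounds the integral of \<open>\<mu>\<close> over [s, t] below by (t - s)
  \<mu>(t); dividing by \<mu>(s) \<mu>(t) cancels \<mu>(t).\<close>

lemma inverse_mu_growth:
  assumes s: "s \<in> \<Omega>" and t: "t \<in> \<Omega>" and st: "s \<le> t"
  shows "\<delta> * (t - s) * (1 / \<mu> s) \<le> 1 / \<mu> t - 1 / \<mu> s"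
proof -
  have "(t - s) * \<mu> t = integral {s..t} (\<lambda>_. \<mu> t)" using st by simp
  also have "\<dots> \<le> integral {s..t} \<mu>"
  proof (rule integral_le)
    show "\<mu> integrable_on {s..t}" using mu_continuous_Icc[OF s t] by (rule integrable_continuous_interval)
    show "\<mu> t \<le> \<mu> x" if "x \<in> {s..t}" for x
      using Icc_subset_Omega[OF s t] that t by (intro mu_antimono) auto
  qed auto
  finally have "\<delta> * ((t - s) * \<mu> t) \<le> \<mu> s - \<mu> t"
    using mu_integral_decay[OF s t st] delta_pos by (meson less_imp_le mult_left_mono order_trans)
  then have "\<delta> * ((t - s) * \<mu> t) / (\<mu> s * \<mu> t) \<le> (\<mu> s - \<mu> t) / (\<mu> s * \<mu> t)"
    using mu_pos[OF s] mu_pos[OF t] by (intro divide_right_mono) auto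
  moreover have "\<delta> * ((t - s) * \<mu> t) / (\<mu> s * \<mu> t) = \<delta> * (t - s) * (1 / \<mu> s)"
    "(\<mu> s - \<mu> t) / (\<mu> s * \<mu> t) = 1 / \<mu> t - 1 / \<mu> s"
    using mu_pos[OF s] mu_pos[OF t] by (simp_all add: field_simps)
  ultimately show ?thesis by simp
qed

abbreviation \<nu> :: "real \<Rightarrow> real" where "\<nu> \<tau> \<equiv> 1 / \<mu> \<tau>"

text \<open>Putting the weight into the measure turns the memory space into an ordinary L^2 space,
  to which the lemmas above apply.\<close>

definition M\<nu> :: "real measure" where "M\<nu> = density (lebesgue_on \<Omega>) (\<lambda>\<tau>. ennreal (\<nu> \<tau>))"

lemma mu_integrable [simp]: "integrable (lebesgue_on \<Omega>) \<mu>"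
  using mu_set_integrable by (simp add: integrable_restrict_space set_integrable_def)

lemma mu_measurable [measurable]: "\<mu> \<in> borel_measurable (lebesgue_on \<Omega>)"
  using mu_integrable by (rule borel_measurable_integrable)

lemma space_Mnu [simp]: "space M\<nu> = \<Omega>" and sets_Mnu: "sets M\<nu> = sets (lebesgue_on \<Omega>)"
  and measurable_Mnu: "f \<in> borel_measurable M\<nu> \<longleftrightarrow> f \<in> borel_measurable (lebesgue_on \<Omega>)"
  by (auto simp: M\<nu>_def space_restrict_space)

lemma nu_nonneg_AE: "AE x in lebesgue_on \<Omega>. 0 \<le> \<nu> x"
  using mu_pos by (intro AE_I2) (auto simp: space_restrict_space less_imp_le)

lemma integral_Mnu:
  fixes f :: "real \<Rightarrow> 'b::{banach,second_countable_topology}"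
  assumes "f \<in> borel_measurable (lebesgue_on \<Omega>)"
  shows "(\<integral>x. f x \<partial>M\<nu>) = (LINT \<tau>:\<Omega>|lebesgue. \<nu> \<tau> *\<^sub>R f \<tau>)"
  unfolding M\<nu>_def using assms nu_nonneg_AE
  by (subst integral_density) (auto simp: integral_restrict_space set_lebesgue_integral_def)

lemma integrable_Mnu:
  fixes f :: "real \<Rightarrow> 'b::{banach,second_countable_topology}"
  assumes "f \<in> borel_measurable (lebesgue_on \<Omega>)"
  shows "integrable M\<nu> f \<longleftrightarrow> set_integrable lebesgue \<Omega> (\<lambda>\<tau>. \<nu> \<tau> *\<^sub>R f \<tau>)"
  unfolding M\<nu>_def using assms nu_nonneg_AE
  by (subst integrable_density) (auto simp: integrable_restrict_space set_integrable_def)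

lemma set_borel_measurable_Omega:
  fixes f :: "real \<Rightarrow> 'b::real_normed_vector"
  shows "set_borel_measurable lebesgue \<Omega> f \<longleftrightarrow> f \<in> borel_measurable (lebesgue_on \<Omega>)"
  by (simp add: set_borel_measurable_def borel_measurable_restrict_space_iff)

text \<open>The density is strictly positive on \<open>\<Omega>\<close>, so the weighted measure has
  the same null sets there as Lebesgue measure.\<close>

lemma AE_Mnu_iff: "(AE x in M\<nu>. P x) \<longleftrightarrow> (AE x in lebesgue. x \<in> \<Omega> \<longrightarrow> P x)"
proof -
  have "(AE x in M\<nu>. P x) \<longleftrightarrow> (AE x in lebesgue_on \<Omega>. 0 < ennreal (\<nu> x) \<longrightarrow> P x)"
    unfolding M\<nu>_def by (rule AE_density) measurable
  also have "\<dots> \<longleftrightarrow> (AE x in lebesgue_on \<Omega>. P x)"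
    using mu_pos by (intro AE_cong) (auto simp: space_restrict_space)
  also have "\<dots> \<longleftrightarrow> (AE x in lebesgue. x \<in> \<Omega> \<longrightarrow> P x)"
    by (rule AE_restrict_space_iff) simp
  finally show ?thesis .
qed

lemma square_integrable_Mnu_iff:
  fixes f :: "real \<Rightarrow> 'h::{real_inner,banach,second_countable_topology}"
  shows "square_integrable M\<nu> f \<longleftrightarrow> set_borel_measurable lebesgue \<Omega> f \<and>
     set_integrable lebesgue \<Omega> (\<lambda>\<tau>. (1 / \<mu> \<tau>) * (norm (f \<tau>))\<^sup>2)"
  unfolding square_integrable_def set_borel_measurable_Omega measurable_Mnu
  by (auto simp: integrable_Mnu)

lemma L2_norm_Mnu:
  fixes f :: "real \<Rightarrow> 'h::{real_inner,banach,second_countable_topology}"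
  assumes "square_integrable M\<nu> f"
  shows "L2_norm M\<nu> f = sqrt (LINT \<tau>:\<Omega>|lebesgue. (1 / \<mu> \<tau>) * (norm (f \<tau>))\<^sup>2)"
proof -
  have "f \<in> borel_measurable (lebesgue_on \<Omega>)"
    using assms by (simp add: square_integrable_def measurable_Mnu)
  then have "(\<lambda>x. (norm (f x))\<^sup>2) \<in> borel_measurable (lebesgue_on \<Omega>)" by measurable
  then show ?thesis unfolding L2_norm_def by (subst integral_Mnu) auto
qed

definition \<kappa> :: real where "\<kappa> = (LINT \<tau>:\<Omega>|lebesgue. \<mu> \<tau>)"

text \<open>Since \<open>\<nu> \<mu> = 1\<close>, pairing with \<open>\<mu>\<close> in \<open>L\<^sup>2\<^sub>\<nu>\<close> turns Cauchy--Schwarz into an \<open>L\<^sup>1\<close> bound.\<close>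
lemma L1_bound:
  fixes f :: "real \<Rightarrow> 'h::{real_inner,banach,second_countable_topology}"
  assumes f: "square_integrable M\<nu> f" and T: "T \<in> sets lebesgue"
  shows "set_integrable lebesgue (\<Omega> \<inter> T) f"
    and "(LINT x:\<Omega> \<inter> T|lebesgue. norm (f x)) \<le>
      sqrt (LINT x:\<Omega> \<inter> T|lebesgue. \<mu> x) * sqrt (LINT x:\<Omega> \<inter> T|lebesgue. \<nu> x * (norm (f x))\<^sup>2)"
proof -
  let ?g = "\<lambda>x. indicator T x * \<mu> x" and ?f = "\<lambda>x. indicator T x *\<^sub>R f x"
  have fm: "f \<in> borel_measurable (lebesgue_on \<Omega>)"
    using f by (simp add: square_integrable_def measurable_Mnu)
  have [measurable]: "T \<in> sets lebesgue" by (rule T)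
  have Tm[measurable]: "(indicator T :: real \<Rightarrow> real) \<in> borel_measurable (lebesgue_on \<Omega>)"
    by (intro measurable_restrict_space1) measurable
  have g2: "set_integrable lebesgue (\<Omega> \<inter> T) \<mu>"
    by (rule set_integrable_subset[OF mu_set_integrable]) (use T in auto)
  have sg: "square_integrable M\<nu> ?g"
    unfolding square_integrable_Mnu_iff set_borel_measurable_Omega
  proof
    have "indicator \<Omega> x *\<^sub>R (1 / \<mu> x * (norm (?g x))\<^sup>2) = indicator (\<Omega> \<inter> T) x *\<^sub>R \<mu> x" for x
      using mu_pos[of x] by (auto simp: indicator_def power2_eq_square)
    then show "set_integrable lebesgue \<Omega> (\<lambda>x. 1 / \<mu> x * (norm (?g x))\<^sup>2)"
      using g2 by (simp add: set_integrable_def)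
  qed measurable
  have sf: "square_integrable M\<nu> ?f"
    by (rule square_integrable_dominated[OF f, of _ 1])
      (use fm Tm in \<open>auto simp: measurable_Mnu intro!: borel_measurable_scaleR AE_I2 split: split_indicator\<close>)
  have m1: "(\<lambda>x. norm (?f x) * norm (?g x)) \<in> borel_measurable (lebesgue_on \<Omega>)"
    by (intro borel_measurable_times measurable_compose[OF _ borel_measurable_norm] borel_measurable_scaleR Tm fm mu_measurable)
  have eq1: "indicator \<Omega> x *\<^sub>R (\<nu> x *\<^sub>R (norm (?f x) * norm (?g x))) = indicator (\<Omega> \<inter> T) x *\<^sub>R norm (f x)" for x
    using mu_pos[of x] by (auto simp: indicator_def)
  have i1: "set_integrable lebesgue (\<Omega> \<inter> T) (\<lambda>x. norm (f x))"
    using square_integrable_norm_mult[OF sf sg] unfolding integrable_Mnu[OF m1] set_integrable_def eq1 .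
  show "set_integrable lebesgue (\<Omega> \<inter> T) f"
  proof -
    have "(\<lambda>x. indicator \<Omega> x *\<^sub>R f x) \<in> borel_measurable lebesgue"
      using f unfolding square_integrable_Mnu_iff set_borel_measurable_def by simp
    then have "(\<lambda>x. indicator T x *\<^sub>R (indicator \<Omega> x *\<^sub>R f x)) \<in> borel_measurable lebesgue" by measurable
    moreover have "(\<lambda>x. indicator T x *\<^sub>R (indicator \<Omega> x *\<^sub>R f x)) = (\<lambda>x. indicator (\<Omega> \<inter> T) x *\<^sub>R f x)"
      by (auto simp: indicator_def)
    ultimately have m: "(\<lambda>x. indicator (\<Omega> \<inter> T) x *\<^sub>R f x) \<in> borel_measurable lebesgue" by simp
    show ?thesis
      unfolding set_integrable_def
      by (rule Bochner_Integration.integrable_bound[OF i1[unfolded set_integrable_def] m]) auto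
  qed
  have "(LINT x:\<Omega> \<inter> T|lebesgue. norm (f x)) = (\<integral>x. norm (?f x) * norm (?g x) \<partial>M\<nu>)"
    unfolding integral_Mnu[OF m1] set_lebesgue_integral_def eq1 ..
  also have "\<dots> \<le> L2_norm M\<nu> ?f * L2_norm M\<nu> ?g" by (rule L2_Cauchy_Schwarz_norm[OF sf sg])
  also have "L2_norm M\<nu> ?f = sqrt (LINT x:\<Omega> \<inter> T|lebesgue. \<nu> x * (norm (f x))\<^sup>2)"
    unfolding L2_norm_Mnu[OF sf] set_lebesgue_integral_def
    by (intro arg_cong[of _ _ sqrt] Bochner_Integration.integral_cong) (auto simp: indicator_def)
  also have "L2_norm M\<nu> ?g = sqrt (LINT x:\<Omega> \<inter> T|lebesgue. \<mu> x)"
    unfolding L2_norm_Mnu[OF sg] set_lebesgue_integral_def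
    using mu_pos by (intro arg_cong[of _ _ sqrt] Bochner_Integration.integral_cong)
      (auto simp: indicator_def power2_eq_square)
  finally show "(LINT x:\<Omega> \<inter> T|lebesgue. norm (f x)) \<le>
      sqrt (LINT x:\<Omega> \<inter> T|lebesgue. \<mu> x) * sqrt (LINT x:\<Omega> \<inter> T|lebesgue. \<nu> x * (norm (f x))\<^sup>2)"
    by (simp add: mult.commute)
qed

lemma L1_bound_Omega:
  fixes f :: "real \<Rightarrow> 'h::{real_inner,banach,second_countable_topology}"
  assumes f: "square_integrable M\<nu> f"
  shows "set_integrable lebesgue \<Omega> f" and "(LINT x:\<Omega>|lebesgue. norm (f x)) \<le> sqrt \<kappa> * L2_norm M\<nu> f"
  using L1_bound[OF f, of UNIV] by (simp_all add: L2_norm_Mnu[OF f] \<kappa>_def)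

end

section \<open>Pointwise values from distributional derivatives\<close>

text \<open>A substitute for the sign of a derivative that may not exist. On a fine partition the
  local inequalities telescope to \<Phi> b - \<Phi> a \<ge> - \<epsilon> (M b - M a), and \<epsilon>
  is arbitrary.\<close>

lemma nondecreasing_if_locally_almost:
  fixes \<Phi> M :: "real \<Rightarrow> real"
  assumes ab: "a \<le> b"
    and loc: "\<And>\<epsilon>. 0 < \<epsilon> \<Longrightarrow> \<exists>d>0. \<forall>s t. a \<le> s \<longrightarrow> s \<le> t \<longrightarrow> t \<le> b \<longrightarrow> t - s < d \<longrightarrow> - \<epsilon> * (M t - M s) \<le> \<Phi> t - \<Phi> s"
  shows "\<Phi> a \<le> \<Phi> b"
proof (rule field_le_epsilon)
  fix e :: real assume e: "0 < e"
  define \<epsilon> where "\<epsilon> = e / (\<bar>M b - M a\<bar> + 1)"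
  have \<epsilon>: "0 < \<epsilon>" using e by (simp add: \<epsilon>_def)
  obtain d where d: "d > 0" and D: "\<And>s t. a \<le> s \<Longrightarrow> s \<le> t \<Longrightarrow> t \<le> b \<Longrightarrow> t - s < d \<Longrightarrow> - \<epsilon> * (M t - M s) \<le> \<Phi> t - \<Phi> s"
    using loc[OF \<epsilon>] by blast
  obtain N :: nat where N: "(b - a) / d < real N" using reals_Archimedean2 by blast
  have N0: "N > 0" using N ab d by (cases N) (auto simp: divide_less_0_iff)
  define h where "h = (b - a) / real N"
  define p where "p = (\<lambda>i::nat. a + real i * h)"
  have step: "p (Suc i) - p i = h" for i by (simp add: p_def algebra_simps)
  have "0 \<le> h" using ab by (simp add: h_def)
  then have p_mono: "p i \<le> p j" if "i \<le> j" for i j using that by (auto simp: p_def intro!: mult_right_mono)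
  have pN: "p N = b" "p 0 = a" using N0 by (auto simp: p_def h_def)
  have lt: "h < d" using N N0 d by (simp add: field_simps h_def)
  have "(\<Sum>i<N. - \<epsilon> * (M (p (Suc i)) - M (p i))) \<le> (\<Sum>i<N. \<Phi> (p (Suc i)) - \<Phi> (p i))"
  proof (rule sum_mono)
    fix i assume "i \<in> {..<N}"
    then show "- \<epsilon> * (M (p (Suc i)) - M (p i)) \<le> \<Phi> (p (Suc i)) - \<Phi> (p i)"
      using p_mono[of 0 i] p_mono[of i "Suc i"] p_mono[of "Suc i" N] step[of i] lt pN by (intro D) auto
  qed
  then have "- \<epsilon> * (M b - M a) \<le> \<Phi> b - \<Phi> a"
    unfolding sum_distrib_left[symmetric] sum_lessThan_telescope[of "\<lambda>i. M (p i)"]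
      sum_lessThan_telescope[of "\<lambda>i. \<Phi> (p i)"] pN .
  moreover have "\<epsilon> * (M b - M a) \<le> e"
  proof -
    have "\<epsilon> * (M b - M a) \<le> \<epsilon> * (\<bar>M b - M a\<bar> + 1)" using \<epsilon> by (intro mult_left_mono) auto
    then show ?thesis by (simp add: \<epsilon>_def)
  qed
  ultimately show "\<Phi> a \<le> \<Phi> b + e" by simp
qed

lemma continuous_deriv_smooth_step: "continuous_on S (\<lambda>x. deriv smooth_step (n * (x - a)))"
proof -
  have "continuous_on UNIV (deriv smooth_step)"
    using smooth_fun_DERIV[OF smooth_step(1), of 1] DERIV_isCont
    by (intro continuous_at_imp_continuous_on) auto
  then show ?thesis by (rule continuous_on_compose2) (auto intro!: continuous_intros)
qed

text \<open>The kernel is nonnegative, has mass one and lives on [a, a + 1/n]. It is an approximate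
  identity that looks only to the right of \<open>a\<close>.\<close>

lemma smooth_step_mollifier:
  fixes \<zeta> :: "real \<Rightarrow> 'b::{banach,second_countable_topology}"
  assumes cont: "continuous_on {a..c} \<zeta>" and ac: "a < c" and U: "{a..c} \<subseteq> U"
  shows "(\<lambda>n::nat. LINT x:U|lebesgue. (real n * deriv smooth_step (real n * (x - a))) *\<^sub>R \<zeta> x) \<longlonglongrightarrow> \<zeta> a"
proof (rule LIMSEQ_I)
  fix e :: real assume e: "0 < e"
  have aac: "a \<in> {a..c}" using ac by simp
  obtain d where d: "d > 0" "\<And>x. x \<in> {a..c} \<Longrightarrow> dist x a < d \<Longrightarrow> dist (\<zeta> x) (\<zeta> a) < e / 2"
    using cont aac e unfolding continuous_on_iff by (metis half_gt_zero)
  obtain N :: nat where N: "N > 0" "1 / real N < min d (c - a)"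
    using d(1) ac real_arch_inverse[of "min d (c - a)"] by (auto simp: inverse_eq_divide)
  show "\<exists>no. \<forall>n\<ge>no. norm ((LINT x:U|lebesgue. (real n * deriv smooth_step (real n * (x - a))) *\<^sub>R \<zeta> x) - \<zeta> a) < e"
  proof (intro exI[of _ N] allI impI)
    fix n assume n: "N \<le> n"
    then have n0: "real n > 0" using N by simp
    have "1 / real n \<le> 1 / real N" using n N by (intro divide_left_mono) auto
    then have small: "1 / real n < d" "a + 1 / real n < c" using N by auto
    define J where "J = {a..a + 1 / real n}"
    define k where "k = (\<lambda>x. real n * deriv smooth_step (real n * (x - a)))"
    have J: "J \<subseteq> {a..c}" using small by (auto simp: J_def)
    have k0: "k x = 0" if "x \<notin> J" for x
    proof -
      have "real n * (x - a) \<le> 0 \<or> 1 \<le> real n * (x - a)"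
        using that n0 by (auto simp: J_def field_simps mult_le_0_iff)
      then show ?thesis using smooth_step(5) by (simp add: k_def)
    qed
    have kc: "continuous_on J k" unfolding k_def by (intro continuous_intros continuous_deriv_smooth_step)
    have knn: "0 \<le> k x" for x using deriv_smooth_step_nonneg n0 by (simp add: k_def)
    have kint: "set_integrable lebesgue J k"
      unfolding J_def by (rule set_integrable_lebesgue_continuous) (use kc J_def in simp)
    \<comment> \<open>The primitive of the kernel climbs from \<open>smooth_step\<close> 0 = 0 to
      \<open>smooth_step\<close> 1 = 1.\<close>
    have "(k has_integral (smooth_step (real n * (a + 1 / real n - a)) - smooth_step (real n * (a - a)))) J"
      unfolding J_def k_def
    proof (rule fundamental_theorem_of_calculus)
      fix x
      have "((\<lambda>x. smooth_step (real n * (x - a))) has_real_derivative deriv smooth_step (real n * (x - a)) * real n) (at x)"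
        by (rule DERIV_chain2[OF smooth_step_DERIV]) (auto intro!: derivative_eq_intros)
      then show "((\<lambda>x. smooth_step (real n * (x - a))) has_vector_derivative real n * deriv smooth_step (real n * (x - a)))
           (at x within {a..a + 1 / real n})"
        by (auto simp: has_real_derivative_iff_has_vector_derivative mult.commute intro: has_vector_derivative_at_within)
    qed (use n0 in auto)
    then have "integral J k = 1" using n0 smooth_step by (simp add: integral_unique)
    then have k1: "(LINT x:J|lebesgue. k x) = 1"
      using set_lebesgue_integral_eq_integral(2)[OF kint] by simp
    have kz: "set_integrable lebesgue J (\<lambda>x. k x *\<^sub>R \<zeta> x)" and kd: "set_integrable lebesgue J (\<lambda>x. k x *\<^sub>R (\<zeta> x - \<zeta> a))"
      unfolding J_def using kc continuous_on_subset[OF cont J]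
      by (intro set_integrable_lebesgue_continuous continuous_intros; simp add: J_def)+
    have "(LINT x:U|lebesgue. k x *\<^sub>R \<zeta> x) = (LINT x:J|lebesgue. k x *\<^sub>R \<zeta> x)"
      unfolding set_lebesgue_integral_def
    proof (rule Bochner_Integration.integral_cong[OF refl])
      fix x show "indicat_real U x *\<^sub>R k x *\<^sub>R \<zeta> x = indicat_real J x *\<^sub>R k x *\<^sub>R \<zeta> x"
        using k0[of x] J U by (cases "x \<in> J") auto
    qed
    also have "\<dots> - \<zeta> a = (LINT x:J|lebesgue. k x *\<^sub>R (\<zeta> x - \<zeta> a))"
    proof -
      have "(LINT x:J|lebesgue. k x *\<^sub>R \<zeta> a) = \<zeta> a"
        using k1 integral_scaleR_left[OF kint[unfolded set_integrable_def], of "\<zeta> a"]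
        by (simp add: set_lebesgue_integral_def)
      moreover have "set_integrable lebesgue J (\<lambda>x. k x *\<^sub>R \<zeta> a)"
        using kint by simp
      ultimately show ?thesis using kz by (simp add: scaleR_diff_right set_integral_diff)
    qed
    also have "norm \<dots> \<le> (LINT x:J|lebesgue. k x * (e / 2))"
    proof (rule order_trans)
      show "norm (LINT x:J|lebesgue. k x *\<^sub>R (\<zeta> x - \<zeta> a)) \<le> (LINT x:J|lebesgue. norm (k x *\<^sub>R (\<zeta> x - \<zeta> a)))"
        by (rule set_integral_norm_bound[OF kd])
      show "(LINT x:J|lebesgue. norm (k x *\<^sub>R (\<zeta> x - \<zeta> a))) \<le> (LINT x:J|lebesgue. k x * (e / 2))"
      proof (rule set_integral_mono)
        show "set_integrable lebesgue J (\<lambda>x. norm (k x *\<^sub>R (\<zeta> x - \<zeta> a)))" by (rule set_integrable_norm[OF kd])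
        show "set_integrable lebesgue J (\<lambda>x. k x * (e / 2))" using kint by simp
        fix x assume x: "x \<in> J"
        then have "norm (\<zeta> x - \<zeta> a) \<le> e / 2"
          using d(2)[of x] J small by (force simp: J_def dist_norm dist_real_def)
        then show "norm (k x *\<^sub>R (\<zeta> x - \<zeta> a)) \<le> k x * (e / 2)"
          using mult_left_mono[OF _ knn[of x], of "norm (\<zeta> x - \<zeta> a)" "e / 2"] knn[of x] by simp
      qed
    qed
    also have "\<dots> < e" using k1 e by simp
    finally show "norm ((LINT x:U|lebesgue. (real n * deriv smooth_step (real n * (x - a))) *\<^sub>R \<zeta> x) - \<zeta> a) < e"
      by (simp add: k_def)
  qed
qed

text \<open>The half-open interval is forced: every plateau vanishes at \<open>a\<close>, while for
  a < b it is eventually 1 at \<open>b\<close>.\<close>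

lemma plateau_tendsto_indicator:
  assumes ab: "a \<le> b"
  shows "(\<lambda>n::nat. plateau (real n) a b x) \<longlonglongrightarrow> indicator {a<..b} x"
proof (rule tendsto_eventually)
  consider "x \<le> a" | "a < x" "x \<le> b" | "b < x" by linarith
  then show "eventually (\<lambda>n::nat. plateau (real n) a b x = indicator {a<..b} x) sequentially"
  proof cases
    case 1
    then show ?thesis using plateau_eq_0[OF _ ab, of _ x]
      by (intro eventually_sequentiallyI[of 1]) auto
  next
    case 2
    obtain N :: nat where N: "N > 0" "1 / real N < x - a"
      using 2 real_arch_inverse[of "x - a"] by (auto simp: inverse_eq_divide)
    show ?thesis
    proof (rule eventually_sequentiallyI[of N])
      fix n assume n: "N \<le> n"
      then have "1 / real n \<le> 1 / real N" using N by (intro divide_left_mono) auto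
      then show "plateau (real n) a b x = indicator {a<..b} x"
        using N n 2 plateau_eq_1[of "real n" a x b] by simp
    qed
  next
    case 3
    obtain N :: nat where N: "N > 0" "1 / real N < x - b"
      using 3 real_arch_inverse[of "x - b"] by (auto simp: inverse_eq_divide)
    show ?thesis
    proof (rule eventually_sequentiallyI[of N])
      fix n assume n: "N \<le> n"
      then have "1 / real n \<le> 1 / real N" using N by (intro divide_left_mono) auto
      then show "plateau (real n) a b x = indicator {a<..b} x"
        using N n 3 plateau_eq_0[of "real n" a b x] ab by simp
    qed
  qed
qed

lemma continuous_plateau: "continuous_on S (plateau n a b)"
  using plateau_DERIV DERIV_isCont by (meson continuous_at_imp_continuous_on)

context memory_kernel
begin

lemma Omega_right_neighbourhood:
  assumes "b \<in> \<Omega>" obtains c where "b < c" "{b..c} \<subseteq> \<Omega>" "c \<in> \<Omega>"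
proof -
  obtain e where e: "e > 0" "cball b e \<subseteq> \<Omega>"
    using open_Omega assms by (auto simp: open_contains_cball)
  then have "{b..b + e} \<subseteq> \<Omega>" "b + e \<in> \<Omega>" by (auto simp: cball_def dist_real_def subset_eq)
  then show ?thesis using e by (intro that[of "b + e"]) auto
qed

text \<open>Testing with plateaus, the side with the derivative of the test function tends to
  \<zeta> a - \<zeta> b by mollification, and the other side tends to minus the integral over (a, b]
  by dominated convergence.\<close>

lemma distr_deriv_imp_FTC:
  fixes \<zeta> \<theta> :: "real \<Rightarrow> 'b::{real_normed_vector,banach,second_countable_topology}"
  assumes cont: "continuous_on \<Omega> \<zeta>" and int: "set_integrable lebesgue \<Omega> \<theta>"
    and d: "distr_deriv \<Omega> \<zeta> \<theta>" and a: "a \<in> \<Omega>" and b: "b \<in> \<Omega>" and ab: "a < b"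
  shows "\<zeta> b - \<zeta> a = (LINT x:{a..b}|lebesgue. \<theta> x)"
proof -
  \<comment> \<open>The falling ramp of the plateau reaches b + 1/n, so room to the right of
    \<open>b\<close> inside \<open>\<Omega>\<close> is required.\<close>
  obtain c where c: "b < c" "{b..c} \<subseteq> \<Omega>" "c \<in> \<Omega>" using Omega_right_neighbourhood[OF b] .
  have sub: "{a..c} \<subseteq> \<Omega>" by (rule Icc_subset_Omega[OF a c(3)])
  obtain N :: nat where N: "N > 0" "1 / real N < c - b"
    using c(1) real_arch_inverse[of "c - b"] by (auto simp: inverse_eq_divide)
  let ?k = "\<lambda>n::nat. \<lambda>a x. real n * deriv smooth_step (real n * (x - a))"
  have Nn: "real n > 0" "{a..b + 1 / real n} \<subseteq> \<Omega>" if "n \<ge> N" for n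
  proof -
    show "real n > 0" using that N by simp
    have "1 / real n \<le> 1 / real N" using that N by (intro divide_left_mono) auto
    then show "{a..b + 1 / real n} \<subseteq> \<Omega>" using N sub by (force simp: subset_eq)
  qed
  have left: "(\<lambda>n. (LINT x:\<Omega>|lebesgue. ?k n a x *\<^sub>R \<zeta> x) - (LINT x:\<Omega>|lebesgue. ?k n b x *\<^sub>R \<zeta> x)) \<longlonglongrightarrow> \<zeta> a - \<zeta> b"
  proof (intro tendsto_diff)
    show "(\<lambda>n. LINT x:\<Omega>|lebesgue. ?k n a x *\<^sub>R \<zeta> x) \<longlonglongrightarrow> \<zeta> a"
      using sub ab c(1) by (intro smooth_step_mollifier[of a c] continuous_on_subset[OF cont]) auto
    show "(\<lambda>n. LINT x:\<Omega>|lebesgue. ?k n b x *\<^sub>R \<zeta> x) \<longlonglongrightarrow> \<zeta> b"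
      using c by (intro smooth_step_mollifier[of b c] continuous_on_subset[OF cont]) auto
  qed
  have right: "(\<lambda>n. LINT x:\<Omega>|lebesgue. plateau (real n) a b x *\<^sub>R \<theta> x) \<longlonglongrightarrow> (LINT x:\<Omega>|lebesgue. indicator {a<..b} x *\<^sub>R \<theta> x)"
    unfolding set_lebesgue_integral_def
  proof (rule integral_dominated_convergence[where w = "\<lambda>x. norm (indicator \<Omega> x *\<^sub>R \<theta> x)"])
    have m: "(\<lambda>x. indicator \<Omega> x *\<^sub>R \<theta> x) \<in> borel_measurable lebesgue"
      using int unfolding set_integrable_def by (rule borel_measurable_integrable)
    have "(\<lambda>x. indicator {a<..b} x *\<^sub>R (indicator \<Omega> x *\<^sub>R \<theta> x)) \<in> borel_measurable lebesgue"
      by (intro borel_measurable_scaleR m borel_measurable_indicator) auto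
    then show "(\<lambda>x. indicator \<Omega> x *\<^sub>R indicator {a<..b} x *\<^sub>R \<theta> x) \<in> borel_measurable lebesgue"
      by (simp add: mult.commute)
    fix n
    have "plateau (real n) a b \<in> borel_measurable borel"
      by (intro borel_measurable_continuous_onI continuous_plateau)
    then have "plateau (real n) a b \<in> borel_measurable lebesgue" by (intro measurable_completion) simp
    then have "(\<lambda>x. plateau (real n) a b x *\<^sub>R (indicator \<Omega> x *\<^sub>R \<theta> x)) \<in> borel_measurable lebesgue"
      by (intro borel_measurable_scaleR m borel_measurable_indicator) auto
    then show "(\<lambda>x. indicator \<Omega> x *\<^sub>R plateau (real n) a b x *\<^sub>R \<theta> x) \<in> borel_measurable lebesgue"
      by (simp add: mult.commute)
    show "AE x in lebesgue. norm (indicator \<Omega> x *\<^sub>R plateau (real n) a b x *\<^sub>R \<theta> x) \<le> norm (indicator \<Omega> x *\<^sub>R \<theta> x)"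
    proof (rule AE_I2)
      fix x
      \<comment> \<open>For n = 0 both steps are evaluated at 0 and the plateau is identically
        zero.\<close>
      have "\<bar>plateau (real n) a b x\<bar> \<le> 1"
        using plateau_bounds[of "real n" a b x] ab by (cases "n = 0") (auto simp: plateau_def)
      then show "norm (indicator \<Omega> x *\<^sub>R plateau (real n) a b x *\<^sub>R \<theta> x) \<le> norm (indicator \<Omega> x *\<^sub>R \<theta> x)"
        by (auto simp: indicator_def mult_left_le_one_le)
    qed
  next
    show "AE x in lebesgue. (\<lambda>n. indicator \<Omega> x *\<^sub>R plateau (real n) a b x *\<^sub>R \<theta> x) \<longlonglongrightarrow> indicator \<Omega> x *\<^sub>R indicator {a<..b} x *\<^sub>R \<theta> x"
      using ab by (intro AE_I2 tendsto_intros plateau_tendsto_indicator) simp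
    show "integrable lebesgue (\<lambda>x. norm (indicat_real \<Omega> x *\<^sub>R \<theta> x))"
      using int unfolding set_integrable_def by (rule integrable_norm)
  qed
  have eq: "(LINT x:\<Omega>|lebesgue. ?k n a x *\<^sub>R \<zeta> x) - (LINT x:\<Omega>|lebesgue. ?k n b x *\<^sub>R \<zeta> x)
      = - (LINT x:\<Omega>|lebesgue. plateau (real n) a b x *\<^sub>R \<theta> x)" if n: "n \<ge> N" for n
  proof -
    \<comment> \<open>The kernels vanish off this compact interval, so continuity of
      \<open>\<zeta>\<close> on \<open>\<Omega>\<close> already gives integrability.\<close>
    have cut: "indicator \<Omega> x *\<^sub>R (?k n y x *\<^sub>R \<zeta> x) = indicator {a..b + 1 / real n} x *\<^sub>R (?k n y x *\<^sub>R \<zeta> x)"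
      if y: "y \<in> {a, b}" for x y
    proof (cases "x \<in> {a..b + 1 / real n}")
      case True then show ?thesis using Nn[OF n] by (simp add: subset_eq)
    next
      case False
      have "real n * (x - y) \<le> 0 \<or> 1 \<le> real n * (x - y)"
      proof (cases "x < a")
        case True then show ?thesis using y ab Nn[OF n] by (auto simp: mult_le_0_iff)
      next
        case False': False
        then have "1 / real n \<le> x - y" using False y ab by auto
        then show ?thesis using Nn(1)[OF n] by (simp add: field_simps)
      qed
      then show ?thesis using False smooth_step(5) by simp
    qed
    have int1: "set_integrable lebesgue \<Omega> (\<lambda>x. ?k n y x *\<^sub>R \<zeta> x)" if y: "y \<in> {a, b}" for y
      unfolding set_integrable_def cut[OF y]
      unfolding set_integrable_def[symmetric]
      using Nn[OF n] by (intro set_integrable_lebesgue_continuous continuous_intros continuous_deriv_smooth_step continuous_on_subset[OF cont])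
    have "test_fun \<Omega> (plateau (real n) a b)"
      using Nn[OF n] ab by (intro test_fun_plateau) auto
    then have "(LINT x:\<Omega>|lebesgue. deriv (plateau (real n) a b) x *\<^sub>R \<zeta> x) = - (LINT x:\<Omega>|lebesgue. plateau (real n) a b x *\<^sub>R \<theta> x)"
      using d unfolding distr_deriv_def by blast
    moreover have "(LINT x:\<Omega>|lebesgue. deriv (plateau (real n) a b) x *\<^sub>R \<zeta> x)
       = (LINT x:\<Omega>|lebesgue. ?k n a x *\<^sub>R \<zeta> x) - (LINT x:\<Omega>|lebesgue. ?k n b x *\<^sub>R \<zeta> x)"
      unfolding deriv_plateau scaleR_diff_left using int1 by (intro set_integral_diff) auto
    ultimately show ?thesis by simp
  qed
  have "(\<lambda>n. - (LINT x:\<Omega>|lebesgue. plateau (real n) a b x *\<^sub>R \<theta> x)) \<longlonglongrightarrow> \<zeta> a - \<zeta> b"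
    using eq by (intro Lim_transform_eventually[OF left] eventually_sequentiallyI[of N])
  moreover have "(\<lambda>n. - (LINT x:\<Omega>|lebesgue. plateau (real n) a b x *\<^sub>R \<theta> x)) \<longlonglongrightarrow> - (LINT x:\<Omega>|lebesgue. indicator {a<..b} x *\<^sub>R \<theta> x)"
    by (intro tendsto_minus right)
  ultimately have "\<zeta> a - \<zeta> b = - (LINT x:\<Omega>|lebesgue. indicator {a<..b} x *\<^sub>R \<theta> x)" by (rule LIMSEQ_unique)
  also have "(LINT x:\<Omega>|lebesgue. indicator {a<..b} x *\<^sub>R \<theta> x) = (LINT x:{a..b}|lebesgue. \<theta> x)"
    unfolding set_lebesgue_integral_def
  proof (rule integral_cong_AE)
    have "AE x in lebesgue. x \<noteq> a" by (rule AE_I'[of "{a}"]) auto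
    then show "AE x in lebesgue. indicat_real \<Omega> x *\<^sub>R indicat_real {a<..b} x *\<^sub>R \<theta> x = indicat_real {a..b} x *\<^sub>R \<theta> x"
    proof eventually_elim
      case (elim x)
      then show ?case using sub c(1) by (auto simp: indicator_def)
    qed
    have m: "(\<lambda>x. indicator \<Omega> x *\<^sub>R \<theta> x) \<in> borel_measurable lebesgue"
      using int unfolding set_integrable_def by (rule borel_measurable_integrable)
    have "(\<lambda>x. indicator {a<..b} x *\<^sub>R (indicator \<Omega> x *\<^sub>R \<theta> x)) \<in> borel_measurable lebesgue"
      by (intro borel_measurable_scaleR m borel_measurable_indicator) auto
    then show "(\<lambda>x. indicator \<Omega> x *\<^sub>R indicator {a<..b} x *\<^sub>R \<theta> x) \<in> borel_measurable lebesgue"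
      by (simp add: mult.commute)
    have "set_integrable lebesgue {a..b} \<theta>"
      by (rule set_integrable_subset[OF int]) (use sub c(1) in auto)
    then show "(\<lambda>x. indicat_real {a..b} x *\<^sub>R \<theta> x) \<in> borel_measurable lebesgue"
      unfolding set_integrable_def by (rule borel_measurable_integrable)
  qed
  finally show ?thesis by (simp add: algebra_simps)
qed

end

section \<open>Dissipation of the memory\<close>

context memory_kernel
begin

lemma nu_continuous_Icc: "s \<in> \<Omega> \<Longrightarrow> t \<in> \<Omega> \<Longrightarrow> continuous_on {s..t} \<nu>"
  using Icc_subset_Omega[of s t] mu_pos
  by (intro continuous_intros mu_continuous_Icc) (auto simp: subset_eq less_le)

text \<open>Treats finite and infinite \<open>ell\<close> alike, so that later limits run along
  sequences of compact intervals.\<close>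

lemma Omega_exhaustion:
  obtains l u :: "nat \<Rightarrow> real" where "\<And>i. l i \<in> \<Omega>" "\<And>i. u i \<in> \<Omega>" "\<And>i. l i < u i" "incseq u" "decseq l"
    "\<Omega> = (\<Union>i. {l i..u i})" "\<And>x. x \<in> \<Omega> \<Longrightarrow> eventually (\<lambda>i. x < u i) sequentially"
proof -
  obtain u l where ul: "einterval 0 ell = (\<Union>i. {l i .. u i})" "incseq u" "decseq l" "\<And>i. l i < u i"
    "\<And>i. 0 < ereal (l i)" "\<And>i. ereal (u i) < ell" "(\<lambda>i. ereal (u i)) \<longlonglongrightarrow> ell"
  proof (rule einterval_Icc_approximation[OF ell_pos], goal_cases)
    case (1 u l)
    then show thesis by (intro that[of l u]) (simp_all add: zero_ereal_def)
  qed
  have "l i \<in> \<Omega>" "u i \<in> \<Omega>" for i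
    using ul(1) ul(4)[of i] unfolding Omega_einterval by (auto intro!: exI[of _ i])
  moreover have "eventually (\<lambda>i. x < u i) sequentially" if "x \<in> \<Omega>" for x
    using order_tendstoD(1)[OF ul(7), of "ereal x"] that by (auto simp: Omega_def)
  moreover have "\<Omega> = (\<Union>i. {l i..u i})" using ul(1) by (simp add: Omega_einterval)
  ultimately show ?thesis using ul(2-4) by (intro that[of l u])
qed

lemma Omega_nonempty: "\<exists>x. x \<in> \<Omega>"
  by (rule Omega_exhaustion) blast

lemma to_ell_eventually:
  assumes "b \<in> \<Omega>" shows "eventually (\<lambda>c. c \<in> \<Omega> \<and> b < c) (to_ell ell)"
proof (cases ell)
  case PInf
  have "0 < b" using assms by (auto simp: Omega_def)
  then have "eventually (\<lambda>c. 0 < c \<and> b < c) at_top"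
    by (intro eventually_mono[OF eventually_gt_at_top[of b]]) auto
  then show ?thesis using PInf by (simp add: to_ell_def Omega_def)
next
  case (real r)
  then have "b < r" "0 < b" using assms by (auto simp: Omega_def)
  then show ?thesis using real eventually_at_left_real[of b r]
    by (auto simp: to_ell_def Omega_def elim!: eventually_mono)
qed (use ell_pos in auto)

lemma to_ell_nontrivial: "to_ell ell \<noteq> bot"
  by (auto simp: to_ell_def)

text \<open>In the decay inequality on [b, u i] the term - \<mu>(u i) is dropped, and u i is sent to
  ell.\<close>

lemma mu_tail_integral:
  assumes b: "b \<in> \<Omega>"
  shows "(LINT x:\<Omega> \<inter> {b..}|lebesgue. \<mu> x) \<le> \<mu> b / \<delta>"
proof -
  obtain l u where ul: "\<And>i. l i \<in> \<Omega>" "\<And>i. u i \<in> \<Omega>" "\<And>i. l i < u i" "incseq u" "decseq l"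
    "\<Omega> = (\<Union>i. {l i..u i})" "\<And>x. x \<in> \<Omega> \<Longrightarrow> eventually (\<lambda>i. x < u i) sequentially"
    by (rule Omega_exhaustion) (rule that)
  have U: "(\<Union>i. {b..u i}) = \<Omega> \<inter> {b..}"
  proof safe
    fix x i assume "x \<in> {b..u i}"
    then show "x \<in> \<Omega>" using Icc_subset_Omega[OF b ul(2)[of i]] by auto
  next
    fix x assume "x \<in> \<Omega>" "b \<le> x"
    then show "x \<in> (\<Union>i. {b..u i})" using eventually_happens[OF ul(7)[of x]] by (auto intro: less_imp_le)
  qed auto
  have si: "set_integrable lebesgue (\<Omega> \<inter> {b..}) \<mu>"
    by (rule set_integrable_subset[OF mu_set_integrable]) auto
  have "(\<lambda>i. LINT x:{b..u i}|lebesgue. \<mu> x) \<longlonglongrightarrow> (LINT x:(\<Union>i. {b..u i})|lebesgue. \<mu> x)"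
    using si unfolding U[symmetric]
    by (intro set_integral_cont_up) (use ul(4) in \<open>auto simp: incseq_def intro: order_trans\<close>)
  moreover have "(LINT x:{b..u i}|lebesgue. \<mu> x) \<le> \<mu> b / \<delta>" for i
  proof (cases "b \<le> u i")
    case True
    have "set_integrable lebesgue {b..u i} \<mu>"
      by (intro set_integrable_lebesgue_continuous mu_continuous_Icc b ul)
    then have "(LINT x:{b..u i}|lebesgue. \<mu> x) = integral {b..u i} \<mu>"
      by (rule set_lebesgue_integral_eq_integral(2))
    then show ?thesis
      using mu_integral_decay[OF b ul(2) True] mu_pos[OF ul(2)[of i]] delta_pos by (simp add: field_simps)
  next
    case False
    then show ?thesis using mu_pos[OF b] delta_pos by (simp add: set_lebesgue_integral_def)
  qed
  ultimately show ?thesis unfolding U by (intro LIMSEQ_le_const2) auto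
qed

section \<open>Trace bound and energy inequality for one function in the domain of the memory
  operator, with \<open>\<theta>\<close> as its derivative\<close>

context
  fixes \<zeta> \<theta> :: "real \<Rightarrow> 'h::{real_inner,banach,second_countable_topology}"
  assumes \<zeta>: "square_integrable M\<nu> \<zeta>" and \<theta>: "square_integrable M\<nu> \<theta>"
    and cont: "continuous_on \<Omega> \<zeta>" and dd: "distr_deriv \<Omega> \<zeta> \<theta>"
    and lim: "(\<zeta> \<longlongrightarrow> 0) (to_ell ell)"
begin

lemma FTC: "a \<in> \<Omega> \<Longrightarrow> b \<in> \<Omega> \<Longrightarrow> a \<le> b \<Longrightarrow> \<zeta> b - \<zeta> a = (LINT x:{a..b}|lebesgue. \<theta> x)"
proof (cases "a = b")
  case True
  have "(LINT x:{b}|lebesgue. \<theta> x) = 0"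
    unfolding set_lebesgue_integral_def
    by (rule integral_eq_zero_AE, rule AE_I'[of "{b}"]) (auto simp: indicator_def)
  then show ?thesis using True by simp
qed (auto intro: distr_deriv_imp_FTC[OF cont L1_bound_Omega(1)[OF \<theta>] dd])

text \<open>Since \<open>\<zeta>\<close> vanishes at ell, |\<zeta> b| is at most the integral of
  |\<theta>| over the tail. Cauchy-Schwarz in the weighted space bounds this by the root of the tail
  mass of \<open>\<mu>\<close> times the weighted tail norm, and the tail mass is at most \<mu>(b) /
  \<delta>, which cancels the weight at b. This controls the boundary term where the weight
  explodes.\<close>

lemma weighted_pointwise_bound:
  assumes b: "b \<in> \<Omega>"
  shows "\<nu> b * (norm (\<zeta> b))\<^sup>2 \<le> (LINT x:\<Omega> \<inter> {b..}|lebesgue. \<nu> x * (norm (\<theta> x))\<^sup>2) / \<delta>"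
proof -
  define R where "R = (LINT x:\<Omega> \<inter> {b..}|lebesgue. norm (\<theta> x))"
  have T: "{b..} \<in> sets lebesgue" by simp
  note L1 = L1_bound[OF \<theta> T]
  have "eventually (\<lambda>c. norm (\<zeta> b) \<le> norm (\<zeta> c) + R) (to_ell ell)"
    using to_ell_eventually[OF b]
  proof eventually_elim
    case (elim c)
    have sub: "{b..c} \<subseteq> \<Omega> \<inter> {b..}" using Icc_subset_Omega[OF b] elim by auto
    have si: "set_integrable lebesgue {b..c} \<theta>"
      by (rule set_integrable_subset[OF L1(1)]) (use sub in auto)
    have "norm (\<zeta> c - \<zeta> b) \<le> (LINT x:{b..c}|lebesgue. norm (\<theta> x))"
      using set_integral_norm_bound[OF si] FTC[OF b, of c] elim by simp
    also have "\<dots> \<le> R"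
      unfolding R_def set_lebesgue_integral_def
      using set_integrable_norm[OF L1(1)] set_integrable_norm[OF si] sub
      by (intro integral_mono) (auto simp: set_integrable_def indicator_def)
    finally show ?case using norm_triangle_ineq4[of "\<zeta> c" "\<zeta> c - \<zeta> b"] by simp
  qed
  moreover have "((\<lambda>c. norm (\<zeta> c) + R) \<longlongrightarrow> norm (0::'h) + R) (to_ell ell)"
    by (intro tendsto_intros lim)
  ultimately have "norm (\<zeta> b) \<le> R"
    using tendsto_lowerbound[OF _ _ to_ell_nontrivial] by fastforce
  also have "R \<le> sqrt (LINT x:\<Omega> \<inter> {b..}|lebesgue. \<mu> x) * sqrt (LINT x:\<Omega> \<inter> {b..}|lebesgue. \<nu> x * (norm (\<theta> x))\<^sup>2)"
    unfolding R_def by (rule L1(2))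
  also have "\<dots> = sqrt ((LINT x:\<Omega> \<inter> {b..}|lebesgue. \<mu> x) * (LINT x:\<Omega> \<inter> {b..}|lebesgue. \<nu> x * (norm (\<theta> x))\<^sup>2))"
    by (simp add: real_sqrt_mult)
  finally have le: "norm (\<zeta> b) \<le> sqrt ((LINT x:\<Omega> \<inter> {b..}|lebesgue. \<mu> x) * (LINT x:\<Omega> \<inter> {b..}|lebesgue. \<nu> x * (norm (\<theta> x))\<^sup>2))" .
  then have "(norm (\<zeta> b))\<^sup>2 \<le> (LINT x:\<Omega> \<inter> {b..}|lebesgue. \<mu> x) * (LINT x:\<Omega> \<inter> {b..}|lebesgue. \<nu> x * (norm (\<theta> x))\<^sup>2)"
    by (intro sqrt_ge_absD) simp
  also have "\<dots> \<le> (\<mu> b / \<delta>) * (LINT x:\<Omega> \<inter> {b..}|lebesgue. \<nu> x * (norm (\<theta> x))\<^sup>2)"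
    using mu_tail_integral[OF b] mu_pos unfolding set_lebesgue_integral_def
    by (intro mult_right_mono Bochner_Integration.integral_nonneg) (auto simp: indicator_def less_imp_le)
  finally show ?thesis using mu_pos[OF b] by (simp add: field_simps)
qed

text \<open>The dissipation inequality says exactly that this function has nonpositive integral over
  \<open>\<Omega>\<close>.\<close>

definition production :: "real \<Rightarrow> real" where
  "production r = \<nu> r * (2 * inner (\<theta> r) (\<zeta> r) + \<delta> * (norm (\<zeta> r))\<^sup>2)"

lemma production_integrable: "set_integrable lebesgue \<Omega> production"
proof -
  have m: "\<zeta> \<in> borel_measurable (lebesgue_on \<Omega>)" "\<theta> \<in> borel_measurable (lebesgue_on \<Omega>)"
    using \<zeta> \<theta> by (auto simp: square_integrable_def measurable_Mnu)
  have "integrable M\<nu> (\<lambda>r. 2 * inner (\<theta> r) (\<zeta> r) + \<delta> * (norm (\<zeta> r))\<^sup>2)"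
    using square_integrable_inner[OF \<theta> \<zeta>] \<zeta> by (auto simp: square_integrable_def)
  moreover have "(\<lambda>r. 2 * inner (\<theta> r) (\<zeta> r) + \<delta> * (norm (\<zeta> r))\<^sup>2) \<in> borel_measurable (lebesgue_on \<Omega>)"
    using m by measurable
  moreover have "production = (\<lambda>r. \<nu> r *\<^sub>R (2 * inner (\<theta> r) (\<zeta> r) + \<delta> * (norm (\<zeta> r))\<^sup>2))"
    by (auto simp: production_def)
  ultimately show ?thesis by (simp only: integrable_Mnu)
qed

text \<open>Integration by parts against the weight \<open>\<nu>\<close>, which is only monotone: on a short interval the increment of
  \<open>\<nu> \<parallel>\<zeta>\<parallel>\<^sup>2\<close> dominates the integral of \<open>production\<close> up to an error proportional to the \<open>L\<^sup>1\<close> mass of \<open>\<theta>\<close>.\<close>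
lemma production_le_boundary_term:
  assumes a: "a \<in> \<Omega>" and b: "b \<in> \<Omega>" and ab: "a \<le> b"
  shows "(LINT x:{a..b}|lebesgue. production x) \<le> \<nu> b * (norm (\<zeta> b))\<^sup>2"
proof -
  have sub: "{a..b} \<subseteq> \<Omega>" by (rule Icc_subset_Omega[OF a b])
  have in\<Omega>: "x \<in> \<Omega>" if "a \<le> x" "x \<le> b" for x using sub that by auto
  have fI: "set_integrable lebesgue {a..b} production"
    by (rule set_integrable_subset[OF production_integrable]) (use sub in auto)
  then have fi: "production integrable_on {a..b}" by (rule set_lebesgue_integral_eq_integral(1))
  have \<theta>I: "set_integrable lebesgue {s..t} \<theta>" if "s \<in> \<Omega>" "t \<in> \<Omega>" for s t
    by (rule set_integrable_subset[OF L1_bound_Omega(1)[OF \<theta>]]) (use Icc_subset_Omega[OF that] in auto)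
  have n\<theta>: "(\<lambda>x. norm (\<theta> x)) integrable_on {a..b}"
    using set_lebesgue_integral_eq_integral(1)[OF set_integrable_norm[OF \<theta>I[OF a b]]] .
  \<comment> \<open>The local error will be \<open>\<epsilon>\<close> times the integral of
    \<open>m\<close>: |\<theta>| from freezing the weight and \<open>\<zeta>\<close> inside the
    inner product, \<open>\<delta>\<close> from freezing the quadratic term.\<close>
  define m where "m = (\<lambda>x. norm (\<theta> x) + \<delta>)"
  have mi: "m integrable_on {a..b}"
    unfolding m_def by (intro Henstock_Kurzweil_Integration.integrable_add n\<theta> integrable_continuous_interval continuous_intros)
  have comb: "integral {a..t} g - integral {a..s} g = integral {s..t} g"
    if "g integrable_on {a..b}" "a \<le> s" "s \<le> t" "t \<le> b" for g :: "real \<Rightarrow> real" and s t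
    using Henstock_Kurzweil_Integration.integral_combine[of a s t g] that
      integrable_on_subinterval[OF that(1), of a t] by auto
  have \<zeta>c: "continuous_on {a..b} \<zeta>" by (rule continuous_on_subset[OF cont sub])
  have \<nu>c: "continuous_on {a..b} \<nu>" by (rule nu_continuous_Icc[OF a b])
  \<comment> \<open>Monotonicity of this difference is the claim; its value at \<open>a\<close> is
    nonnegative.\<close>
  define \<Phi> where "\<Phi> = (\<lambda>t. \<nu> t * (norm (\<zeta> t))\<^sup>2 - integral {a..t} production)"
  have "\<Phi> a \<le> \<Phi> b"
  proof (rule nondecreasing_if_locally_almost[OF ab, where M = "\<lambda>t. integral {a..t} m"])
    fix \<epsilon> :: real assume \<epsilon>: "0 < \<epsilon>"
    \<comment> \<open>Two variables are needed because the weight frozen at t multiplies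
      \<open>\<zeta>\<close> at the other endpoint s as well.\<close>
    have "uniformly_continuous_on ({a..b} \<times> {a..b}) (\<lambda>p. \<nu> (fst p) *\<^sub>R \<zeta> (snd p))"
      by (intro compact_uniformly_continuous compact_Times continuous_intros
          continuous_on_compose2[OF \<nu>c] continuous_on_compose2[OF \<zeta>c]) auto
    then obtain d1 where d1: "d1 > 0" "\<And>p p'. p \<in> {a..b} \<times> {a..b} \<Longrightarrow> p' \<in> {a..b} \<times> {a..b} \<Longrightarrow> dist p' p < d1
        \<Longrightarrow> dist (\<nu> (fst p') *\<^sub>R \<zeta> (snd p')) (\<nu> (fst p) *\<^sub>R \<zeta> (snd p)) < \<epsilon> / 2"
      unfolding uniformly_continuous_on_def using \<epsilon> by (metis half_gt_zero)
    have "uniformly_continuous_on {a..b} (\<lambda>x. \<nu> x * (norm (\<zeta> x))\<^sup>2)"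
      by (intro compact_uniformly_continuous continuous_intros \<nu>c \<zeta>c) auto
    then obtain d2 where d2: "d2 > 0" "\<And>x y. x \<in> {a..b} \<Longrightarrow> y \<in> {a..b} \<Longrightarrow> dist y x < d2
        \<Longrightarrow> dist (\<nu> y * (norm (\<zeta> y))\<^sup>2) (\<nu> x * (norm (\<zeta> x))\<^sup>2) < \<epsilon>"
      unfolding uniformly_continuous_on_def using \<epsilon> by metis
    \<comment> \<open>Half of \<open>d1\<close>, because both coordinates of the pair move by less
      than \<open>d\<close>.\<close>
    define d where "d = min (d1 / 2) d2"
    have d: "d > 0" using d1 d2 by (simp add: d_def)
    show "\<exists>d>0. \<forall>s t. a \<le> s \<longrightarrow> s \<le> t \<longrightarrow> t \<le> b \<longrightarrow> t - s < d \<longrightarrow>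
        - \<epsilon> * (integral {a..t} m - integral {a..s} m) \<le> \<Phi> t - \<Phi> s"
    proof (intro exI[of _ d] conjI allI impI d)
      fix s t assume st: "a \<le> s" "s \<le> t" "t \<le> b" "t - s < d"
      have s\<Omega>: "s \<in> \<Omega>" and t\<Omega>: "t \<in> \<Omega>" using st by (auto intro: in\<Omega>)
      \<comment> \<open>Pairing the increment of \<open>\<zeta>\<close> with the sum of its endpoint
        values gives the increment of the squared norm. With the weight frozen at t, what remains of
        the increment of the weighted square is the growth of the weight times |\<zeta> s|^2, which
        \<open>inverse_mu_growth\<close> bounds below.\<close>
      let ?w = "\<nu> t *\<^sub>R (\<zeta> t + \<zeta> s)"
      let ?c = "\<delta> * (\<nu> s * (norm (\<zeta> s))\<^sup>2)"
      have wI: "set_integrable lebesgue {s..t} (\<lambda>r. inner (\<theta> r) ?w)"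
        using integrable_inner_left[OF \<theta>I[OF s\<Omega> t\<Omega>, unfolded set_integrable_def], of ?w]
        by (simp add: set_integrable_def)
      have w_int: "integral {s..t} (\<lambda>r. inner (\<theta> r) ?w) = inner (\<zeta> t - \<zeta> s) ?w"
      proof -
        have "integral {s..t} (\<lambda>r. inner (\<theta> r) ?w) = (LINT r:{s..t}|lebesgue. inner (\<theta> r) ?w)"
          by (rule set_lebesgue_integral_eq_integral(2)[OF wI, symmetric])
        also have "\<dots> = inner (LINT r:{s..t}|lebesgue. \<theta> r) ?w"
          using integral_inner_left[OF \<theta>I[OF s\<Omega> t\<Omega>, unfolded set_integrable_def], of ?w]
          by (simp add: set_lebesgue_integral_def)
        finally show ?thesis using FTC[OF s\<Omega> t\<Omega>] st by simp
      qed
      have wi: "(\<lambda>r. inner (\<theta> r) ?w) integrable_on {s..t}"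
        by (rule set_lebesgue_integral_eq_integral(1)[OF wI])
      have mi': "m integrable_on {s..t}" using integrable_on_subinterval[OF mi] st by auto
      have fi': "production integrable_on {s..t}" using integrable_on_subinterval[OF fi] st by auto
      have HI: "((\<lambda>r. inner (\<theta> r) ?w + ?c + \<epsilon> * m r) has_integral
          (inner (\<zeta> t - \<zeta> s) ?w + (t - s) *\<^sub>R ?c + \<epsilon> * integral {s..t} m)) {s..t}"
        using integrable_integral[OF wi] has_integral_const_real[of ?c s t] st mi'
        unfolding w_int by (intro has_integral_add has_integral_mult_right) (auto simp: integrable_integral)
      have "integral {s..t} production \<le> integral {s..t} (\<lambda>r. inner (\<theta> r) ?w + ?c + \<epsilon> * m r)"
      proof (rule integral_le[OF fi'])
        show "(\<lambda>r. inner (\<theta> r) ?w + ?c + \<epsilon> * m r) integrable_on {s..t}"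
          using HI by (rule has_integral_integrable)
        fix r assume r: "r \<in> {s..t}"
        have r1: "dist (\<nu> r *\<^sub>R \<zeta> r) (\<nu> t *\<^sub>R \<zeta> t) < \<epsilon> / 2"
          using d1(2)[of "(t, t)" "(r, r)"] st r
            sqrt_sum_squares_le_sum_abs[of "r - t" "r - t"] by (auto simp: dist_prod_def dist_real_def d_def)
        have r2: "dist (\<nu> r *\<^sub>R \<zeta> r) (\<nu> t *\<^sub>R \<zeta> s) < \<epsilon> / 2"
          using d1(2)[of "(t, s)" "(r, r)"] st r
            sqrt_sum_squares_le_sum_abs[of "r - t" "r - s"] by (auto simp: dist_prod_def dist_real_def d_def)
        have r3: "\<nu> r * (norm (\<zeta> r))\<^sup>2 \<le> \<nu> s * (norm (\<zeta> s))\<^sup>2 + \<epsilon>"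
          using d2(2)[of s r] st r by (auto simp: dist_real_def d_def)
        have "2 * (\<nu> r * inner (\<theta> r) (\<zeta> r)) - inner (\<theta> r) ?w
            = inner (\<theta> r) ((\<nu> r *\<^sub>R \<zeta> r - \<nu> t *\<^sub>R \<zeta> t) + (\<nu> r *\<^sub>R \<zeta> r - \<nu> t *\<^sub>R \<zeta> s))"
          by (simp add: inner_add_right inner_diff_right algebra_simps)
        also have "\<dots> \<le> norm (\<theta> r) * norm ((\<nu> r *\<^sub>R \<zeta> r - \<nu> t *\<^sub>R \<zeta> t) + (\<nu> r *\<^sub>R \<zeta> r - \<nu> t *\<^sub>R \<zeta> s))"
          by (rule norm_cauchy_schwarz)
        also have "\<dots> \<le> norm (\<theta> r) * \<epsilon>"
          using r1 r2 norm_triangle_ineq[of "\<nu> r *\<^sub>R \<zeta> r - \<nu> t *\<^sub>R \<zeta> t" "\<nu> r *\<^sub>R \<zeta> r - \<nu> t *\<^sub>R \<zeta> s"]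
          by (intro mult_left_mono) (auto simp: dist_norm)
        finally have A: "2 * (\<nu> r * inner (\<theta> r) (\<zeta> r)) \<le> inner (\<theta> r) ?w + norm (\<theta> r) * \<epsilon>" by simp
        have C: "\<delta> * (\<nu> r * (norm (\<zeta> r))\<^sup>2) \<le> \<delta> * (\<nu> s * (norm (\<zeta> s))\<^sup>2 + \<epsilon>)"
          using r3 delta_pos by (intro mult_left_mono) auto
        have "production r = 2 * (\<nu> r * inner (\<theta> r) (\<zeta> r)) + \<delta> * (\<nu> r * (norm (\<zeta> r))\<^sup>2)"
          by (simp add: production_def ring_distribs)
        also have "\<dots> \<le> (inner (\<theta> r) ?w + norm (\<theta> r) * \<epsilon>) + \<delta> * (\<nu> s * (norm (\<zeta> s))\<^sup>2 + \<epsilon>)"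
          using A C by (rule add_mono)
        also have "\<dots> = inner (\<theta> r) ?w + ?c + \<epsilon> * m r" by (simp only: m_def ring_distribs mult.commute add.assoc add.commute add.left_commute)
        finally show "production r \<le> inner (\<theta> r) ?w + ?c + \<epsilon> * m r" .
      qed
      also have "\<dots> = inner (\<zeta> t - \<zeta> s) ?w + ?c * (t - s) + \<epsilon> * integral {s..t} m"
        using integral_unique[OF HI] by (simp add: mult.commute)
      also have "\<dots> \<le> \<nu> t * (norm (\<zeta> t))\<^sup>2 - \<nu> s * (norm (\<zeta> s))\<^sup>2 + \<epsilon> * integral {s..t} m"
      proof -
        have "inner (\<zeta> t - \<zeta> s) ?w = \<nu> t * ((norm (\<zeta> t))\<^sup>2 - (norm (\<zeta> s))\<^sup>2)"
          by (simp add: power2_norm_eq_inner inner_add_right inner_diff_left inner_commute[of "\<zeta> s" "\<zeta> t"])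
        moreover have "?c * (t - s) \<le> (\<nu> t - \<nu> s) * (norm (\<zeta> s))\<^sup>2"
          using mult_right_mono[OF inverse_mu_growth[OF s\<Omega> t\<Omega> st(2)], of "(norm (\<zeta> s))\<^sup>2"]
          by (simp add: mult_ac)
        ultimately show ?thesis by (simp add: ring_distribs left_diff_distrib right_diff_distrib)
      qed
      finally show "- \<epsilon> * (integral {a..t} m - integral {a..s} m) \<le> \<Phi> t - \<Phi> s"
        using comb[OF mi st(1-3)] comb[OF fi st(1-3)] unfolding \<Phi>_def by simp
    qed
  qed
  moreover have "integral {a..a} production = 0" by simp
  moreover have "0 \<le> \<nu> a * (norm (\<zeta> a))\<^sup>2" using mu_pos[OF a] by simp
  ultimately have "integral {a..b} production \<le> \<nu> b * (norm (\<zeta> b))\<^sup>2" unfolding \<Phi>_def by linarith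
  then show ?thesis using set_lebesgue_integral_eq_integral(2)[OF fI] by simp
qed

text \<open>On [l i, u i] the integral of \<open>production\<close> is bounded by the boundary term
  at u i alone, and \<open>weighted_pointwise_bound\<close> estimates that term by a tail of a
  convergent integral, which tends to 0.\<close>

theorem dissipation: "2 * (\<integral>x. inner (\<theta> x) (\<zeta> x) \<partial>M\<nu>) \<le> - \<delta> * (L2_norm M\<nu> \<zeta>)\<^sup>2"
proof -
  obtain l u where ul: "\<And>i. l i \<in> \<Omega>" "\<And>i. u i \<in> \<Omega>" "\<And>i. l i < u i" "incseq u" "decseq l"
    "\<Omega> = (\<Union>i. {l i..u i})" "\<And>x. x \<in> \<Omega> \<Longrightarrow> eventually (\<lambda>i. x < u i) sequentially"
    by (rule Omega_exhaustion) (rule that)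
  have m: "\<zeta> \<in> borel_measurable (lebesgue_on \<Omega>)" "\<theta> \<in> borel_measurable (lebesgue_on \<Omega>)"
    using \<zeta> \<theta> by (auto simp: square_integrable_def measurable_Mnu)
  have "(\<lambda>i. LINT x:{l i..u i}|lebesgue. production x) \<longlonglongrightarrow> (LINT x:(\<Union>i. {l i..u i})|lebesgue. production x)"
  proof (rule set_integral_cont_up)
    show "incseq (\<lambda>i. {l i..u i})" using ul(4,5) by (force simp: incseq_def decseq_def intro: order_trans)
    show "set_integrable lebesgue (\<Union>i. {l i..u i}) production" using production_integrable ul(6) by simp
  qed simp
  moreover have "(\<lambda>i. (LINT x:\<Omega> \<inter> {u i..}|lebesgue. \<nu> x * (norm (\<theta> x))\<^sup>2) / \<delta>) \<longlonglongrightarrow> 0 / \<delta>"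
  proof (intro tendsto_divide tendsto_const)
    have "(\<Inter>i. \<Omega> \<inter> {u i..}) = {}"
    proof -
      have False if "\<And>i. x \<in> \<Omega> \<inter> {u i..}" for x
      proof -
        have "x \<in> \<Omega>" using that by auto
        from eventually_happens[OF ul(7)[OF this]] obtain i where "x < u i" by auto
        then show False using that[of i] by simp
      qed
      then show ?thesis by blast
    qed
    moreover have "(\<lambda>i. LINT x:\<Omega> \<inter> {u i..}|lebesgue. \<nu> x * (norm (\<theta> x))\<^sup>2) \<longlonglongrightarrow>
        (LINT x:(\<Inter>i. \<Omega> \<inter> {u i..})|lebesgue. \<nu> x * (norm (\<theta> x))\<^sup>2)"
    proof (rule set_integral_cont_down)
      show "decseq (\<lambda>i. \<Omega> \<inter> {u i..})" using ul(4) by (force simp: incseq_def decseq_def intro: order_trans)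
      have "set_integrable lebesgue \<Omega> (\<lambda>x. \<nu> x * (norm (\<theta> x))\<^sup>2)"
        using \<theta> by (simp add: square_integrable_Mnu_iff)
      then show "set_integrable lebesgue (\<Omega> \<inter> {u 0..}) (\<lambda>x. \<nu> x * (norm (\<theta> x))\<^sup>2)"
        by (rule set_integrable_subset) auto
    qed auto
    ultimately show "(\<lambda>i. LINT x:\<Omega> \<inter> {u i..}|lebesgue. \<nu> x * (norm (\<theta> x))\<^sup>2) \<longlonglongrightarrow> 0"
      by (simp add: set_lebesgue_integral_def)
  qed (use delta_pos in simp)
  moreover have "(LINT x:{l i..u i}|lebesgue. production x) \<le> (LINT x:\<Omega> \<inter> {u i..}|lebesgue. \<nu> x * (norm (\<theta> x))\<^sup>2) / \<delta>" for i
    using production_le_boundary_term[OF ul(1,2)] ul(3)[of i] weighted_pointwise_bound[OF ul(2)]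
    by (meson less_imp_le order_trans)
  ultimately have "(LINT x:\<Omega>|lebesgue. production x) \<le> 0 / \<delta>"
    unfolding ul(6)[symmetric] by (intro LIMSEQ_le) auto
  moreover have "(LINT x:\<Omega>|lebesgue. production x) = (\<integral>x. 2 * inner (\<theta> x) (\<zeta> x) + \<delta> * (norm (\<zeta> x))\<^sup>2 \<partial>M\<nu>)"
    using m by (subst integral_Mnu) (auto simp: production_def[abs_def])
  moreover have "\<dots> = 2 * (\<integral>x. inner (\<theta> x) (\<zeta> x) \<partial>M\<nu>) + \<delta> * (\<integral>x. (norm (\<zeta> x))\<^sup>2 \<partial>M\<nu>)"
    using square_integrable_inner[OF \<theta> \<zeta>] \<zeta> by (simp add: square_integrable_def)
  ultimately show ?thesis by (simp add: L2_norm_power2)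
qed

end

end

section \<open>Memory functions with values in the form domain\<close>

text \<open>Changes on a null set keep measurability because Lebesgue measure is complete.\<close>

lemma lebesgue_measurable_AE_cong:
  fixes f g :: "real \<Rightarrow> 'b::topological_space"
  assumes f: "f \<in> borel_measurable lebesgue" and ae: "AE x in lebesgue. f x = g x"
  shows "g \<in> borel_measurable lebesgue"
proof (rule measurableI)
  fix A :: "'b set" assume A: "A \<in> sets borel"
  obtain N where N: "{x \<in> space lebesgue. \<not> f x = g x} \<subseteq> N" "N \<in> null_sets lebesgue"
    using ae unfolding eventually_ae_filter by blast
  then have eq: "f x = g x" if "x \<notin> N" for x using that by auto
  have "g -` A \<inter> N \<in> sets lebesgue"
    using N(2) by (meson Int_lower2 completion.complete null_setsD2)
  moreover have "f -` A \<in> sets lebesgue" using measurable_sets[OF f A] by simp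
  ultimately have "(f -` A - N) \<union> (g -` A \<inter> N) \<in> sets lebesgue" using N(2) by auto
  also have "(f -` A - N) \<union> (g -` A \<inter> N) = g -` A" using eq by auto
  finally show "g -` A \<inter> space lebesgue \<in> sets lebesgue" by simp
qed simp

text \<open>Off the closed support the function vanishes on an open set, so its derivative vanishes
  there too; on the compact support both are bounded by continuity.\<close>

lemma test_fun_bounded_continuous:
  assumes t: "test_fun U \<phi>"
  obtains C where "C > 0" "\<And>x. \<bar>\<phi> x\<bar> \<le> C" "\<And>x. \<bar>deriv \<phi> x\<bar> \<le> C"
    "continuous_on UNIV \<phi>" "continuous_on UNIV (deriv \<phi>)"
proof -
  let ?K = "closure {x. \<phi> x \<noteq> 0}"
  have sm: "smooth_fun \<phi>" and K: "compact ?K" using t by (auto simp: test_fun_def smooth_fun_def)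
  have c: "continuous_on UNIV ((deriv ^^ n) \<phi>)" for n
    using smooth_fun_DERIV[OF sm] DERIV_isCont by (metis continuous_at_imp_continuous_on)
  have c0: "continuous_on UNIV \<phi>" and c1: "continuous_on UNIV (deriv \<phi>)"
    using c[of 0] c[of 1] by simp_all
  obtain C0 where C0: "C0 > 0" "\<And>x. x \<in> ?K \<Longrightarrow> \<bar>\<phi> x\<bar> \<le> C0"
    using compact_imp_bounded[OF compact_continuous_image[OF continuous_on_subset[OF c0] K]]
    unfolding bounded_pos by auto
  obtain C1 where C1: "C1 > 0" "\<And>x. x \<in> ?K \<Longrightarrow> \<bar>deriv \<phi> x\<bar> \<le> C1"
    using compact_imp_bounded[OF compact_continuous_image[OF continuous_on_subset[OF c1] K]]
    unfolding bounded_pos by auto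
  have z0: "\<phi> x = 0" if "x \<in> - ?K" for x using that closure_subset[of "{x. \<phi> x \<noteq> 0}"] by blast
  have z1: "deriv \<phi> x = 0" if x: "x \<in> - ?K" for x
  proof (rule DERIV_imp_deriv)
    show "(\<phi> has_real_derivative 0) (at x)"
    proof (rule has_field_derivative_transform_within_open[OF DERIV_const[of 0]])
      show "open (- ?K)" by (rule open_Compl[OF closed_closure])
      show "x \<in> - ?K" by (rule x)
      show "0 = \<phi> y" if "y \<in> - ?K" for y using z0[OF that] by (rule sym)
    qed
  qed
  show ?thesis
  proof (rule that[of "max C0 C1", OF _ _ _ c0 c1])
    show "\<bar>\<phi> x\<bar> \<le> max C0 C1" for x
      using C0(1) C0(2)[of x] z0[of x] unfolding Compl_iff by linarith
    show "\<bar>deriv \<phi> x\<bar> \<le> max C0 C1" for x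
      using C1(1) C1(2)[of x] z1[of x] unfolding Compl_iff by linarith
    show "0 < max C0 C1" using C0(1) by simp
  qed
qed

context memory_kernel
begin

lemma square_integrable_Mnu_AE_cong:
  fixes f g :: "real \<Rightarrow> 'b::{real_inner,banach,second_countable_topology}"
  assumes f: "square_integrable M\<nu> f" and ae: "AE x in M\<nu>. f x = g x"
  shows "square_integrable M\<nu> g"
proof (rule square_integrable_dominated[OF f, of _ 1])
  have "(\<lambda>x. indicat_real \<Omega> x *\<^sub>R f x) \<in> borel_measurable lebesgue"
    using f by (simp add: square_integrable_Mnu_iff set_borel_measurable_def)
  moreover have "AE x in lebesgue. indicat_real \<Omega> x *\<^sub>R f x = indicat_real \<Omega> x *\<^sub>R g x"
    using ae unfolding AE_Mnu_iff by eventually_elim (auto simp: indicator_def)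
  ultimately have "(\<lambda>x. indicat_real \<Omega> x *\<^sub>R g x) \<in> borel_measurable lebesgue"
    by (rule lebesgue_measurable_AE_cong)
  then show "g \<in> borel_measurable M\<nu>"
    by (simp add: measurable_Mnu set_borel_measurable_Omega[symmetric] set_borel_measurable_def)
  show "AE x in M\<nu>. norm (g x) \<le> 1 * norm (f x)" using ae by eventually_elim simp
qed

lemma L2_norm_Mnu_AE_cong:
  fixes f g :: "real \<Rightarrow> 'b::{real_inner,banach,second_countable_topology}"
  assumes f: "square_integrable M\<nu> f" and ae: "AE x in M\<nu>. f x = g x"
  shows "L2_norm M\<nu> f = L2_norm M\<nu> g"
proof -
  have "(\<integral>x. (norm (f x))\<^sup>2 \<partial>M\<nu>) = (\<integral>x. (norm (g x))\<^sup>2 \<partial>M\<nu>)"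
    using f square_integrable_Mnu_AE_cong[OF f ae] ae
    by (intro integral_cong_AE) (auto simp: square_integrable_def)
  then show ?thesis by (simp add: L2_norm_def)
qed

lemma kappa_nonneg: "0 \<le> \<kappa>"
  using mu_pos unfolding \<kappa>_def set_lebesgue_integral_def
  by (intro Bochner_Integration.integral_nonneg) (auto simp: indicator_def less_imp_le)

text \<open>The squared norm carries the weight (1/\<mu>) \<mu>^2 = \<mu>, which is
  summable.\<close>

lemma square_integrable_mu: "square_integrable M\<nu> (\<lambda>\<tau>. \<mu> \<tau> *\<^sub>R (w::'b::{real_inner,banach,second_countable_topology}))"
  unfolding square_integrable_Mnu_iff set_borel_measurable_Omega
proof
  have "indicator \<Omega> x *\<^sub>R (1 / \<mu> x * (norm (\<mu> x *\<^sub>R w))\<^sup>2) = (indicator \<Omega> x *\<^sub>R \<mu> x) * (norm w)\<^sup>2" for x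
    using mu_pos[of x] by (auto simp: indicator_def power2_eq_square)
  then show "set_integrable lebesgue \<Omega> (\<lambda>x. 1 / \<mu> x * (norm (\<mu> x *\<^sub>R w))\<^sup>2)"
    using mu_set_integrable by (simp add: set_integrable_def)
qed measurable

lemma weighted_set_integrable:
  fixes f :: "real \<Rightarrow> 'b::{real_inner,banach,second_countable_topology}"
  assumes f: "square_integrable M\<nu> f" and \<phi>: "continuous_on UNIV \<phi>" "\<And>x. \<bar>\<phi> x\<bar> \<le> C"
  shows "set_integrable lebesgue \<Omega> (\<lambda>x. \<phi> x *\<^sub>R f x)"
    and "norm (LINT x:\<Omega>|lebesgue. \<phi> x *\<^sub>R f x) \<le> C * (sqrt \<kappa> * L2_norm M\<nu> f)"
proof -
  have C: "C \<ge> 0" using \<phi>(2)[of 0] by linarith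
  note L1 = L1_bound_Omega[OF f]
  have m1: "(\<lambda>x. indicator \<Omega> x *\<^sub>R f x) \<in> borel_measurable lebesgue"
    using L1(1) unfolding set_integrable_def by (rule borel_measurable_integrable)
  have "\<phi> \<in> borel_measurable lebesgue"
    using \<phi>(1) by (intro measurable_completion) (simp add: borel_measurable_continuous_onI)
  then have "(\<lambda>x. \<phi> x *\<^sub>R (indicator \<Omega> x *\<^sub>R f x)) \<in> borel_measurable lebesgue"
    using m1 by (rule borel_measurable_scaleR)
  then have m: "(\<lambda>x. indicator \<Omega> x *\<^sub>R \<phi> x *\<^sub>R f x) \<in> borel_measurable lebesgue"
    by (simp add: mult.commute)
  have n: "set_integrable lebesgue \<Omega> (\<lambda>x. C * norm (f x))"
    using set_integrable_norm[OF L1(1)] by simp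
  have le: "norm (indicator \<Omega> x *\<^sub>R \<phi> x *\<^sub>R f x) \<le> norm (indicator \<Omega> x *\<^sub>R (C * norm (f x)))" for x
    using \<phi>(2)[of x] C by (auto simp: indicator_def abs_mult intro!: mult_right_mono)
  show I: "set_integrable lebesgue \<Omega> (\<lambda>x. \<phi> x *\<^sub>R f x)"
    unfolding set_integrable_def
    by (rule Bochner_Integration.integrable_bound[OF n[unfolded set_integrable_def] m]) (use le in auto)
  have "norm (LINT x:\<Omega>|lebesgue. \<phi> x *\<^sub>R f x) \<le> (LINT x:\<Omega>|lebesgue. norm (\<phi> x *\<^sub>R f x))"
    by (rule set_integral_norm_bound[OF I])
  also have "\<dots> \<le> (LINT x:\<Omega>|lebesgue. C * norm (f x))"
  proof (rule set_integral_mono[OF set_integrable_norm[OF I] n])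
    show "norm (\<phi> x *\<^sub>R f x) \<le> C * norm (f x)" for x using \<phi>(2)[of x] by (simp add: mult_right_mono)
  qed
  also have "\<dots> = C * (LINT x:\<Omega>|lebesgue. norm (f x))" by simp
  also have "\<dots> \<le> C * (sqrt \<kappa> * L2_norm M\<nu> f)" using L1(2) C by (rule mult_left_mono)
  finally show "norm (LINT x:\<Omega>|lebesgue. \<phi> x *\<^sub>R f x) \<le> C * (sqrt \<kappa> * L2_norm M\<nu> f)" .
qed

text \<open>On a compact subinterval of \<open>\<Omega>\<close> the weight is continuous, hence
  bounded.\<close>

lemma square_integrable_compact_support:
  fixes c :: "'b::{real_inner,banach,second_countable_topology}" and \<phi> :: "real \<Rightarrow> real"
  assumes a: "a \<in> \<Omega>" and b: "b \<in> \<Omega>" and m: "\<phi> \<in> borel_measurable lebesgue"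
    and bd: "\<And>x. \<bar>\<phi> x\<bar> \<le> C * indicator {a..b} x"
  shows "square_integrable M\<nu> (\<lambda>x. \<phi> x *\<^sub>R c)"
proof -
  have sub: "{a..b} \<subseteq> \<Omega>" by (rule Icc_subset_Omega[OF a b])
  have 1: "square_integrable M\<nu> (\<lambda>x. indicator {a..b} x *\<^sub>R c)"
    unfolding square_integrable_Mnu_iff set_borel_measurable_Omega
  proof
    show "(\<lambda>x. indicator {a..b} x *\<^sub>R c) \<in> borel_measurable (lebesgue_on \<Omega>)"
      by (intro measurable_restrict_space1 borel_measurable_scaleR borel_measurable_indicator) auto
    have "set_integrable lebesgue {a..b} (\<lambda>x. \<nu> x * (norm c)\<^sup>2)"
      by (intro set_integrable_lebesgue_continuous continuous_on_mult_right nu_continuous_Icc a b)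
    moreover have "(\<lambda>x. indicat_real \<Omega> x *\<^sub>R (1 / \<mu> x * (norm (indicat_real {a..b} x *\<^sub>R c))\<^sup>2))
        = (\<lambda>x. indicat_real {a..b} x *\<^sub>R (\<nu> x * (norm c)\<^sup>2))"
    proof
      fix x show "indicat_real \<Omega> x *\<^sub>R (1 / \<mu> x * (norm (indicat_real {a..b} x *\<^sub>R c))\<^sup>2)
          = indicat_real {a..b} x *\<^sub>R (\<nu> x * (norm c)\<^sup>2)"
        by (cases "x \<in> {a..b}") (use sub in auto)
    qed
    ultimately show "set_integrable lebesgue \<Omega> (\<lambda>x. 1 / \<mu> x * (norm (indicat_real {a..b} x *\<^sub>R c))\<^sup>2)"
      unfolding set_integrable_def by (simp only:)
  qed
  show ?thesis
  proof (rule square_integrable_dominated[OF 1, of _ C])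
    show "(\<lambda>x. \<phi> x *\<^sub>R c) \<in> borel_measurable M\<nu>"
      unfolding measurable_Mnu using m by (intro measurable_restrict_space1 borel_measurable_scaleR) auto
    show "AE x in M\<nu>. norm (\<phi> x *\<^sub>R c) \<le> C * norm (indicat_real {a..b} x *\<^sub>R c)"
    proof (rule AE_I2)
      fix x
      show "norm (\<phi> x *\<^sub>R c) \<le> C * norm (indicat_real {a..b} x *\<^sub>R c)"
        using mult_right_mono[OF bd[of x], of "norm c"] by (simp add: mult_ac)
    qed
  qed
qed

lemma Omega_left_neighbourhood:
  assumes "a \<in> \<Omega>" obtains c where "c < a" "c \<in> \<Omega>"
proof -
  obtain e where e: "e > 0" "cball a e \<subseteq> \<Omega>"
    using open_Omega assms by (auto simp: open_contains_cball)
  then have "a - e \<in> \<Omega>" by (auto simp: cball_def dist_real_def subset_eq)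
  then show ?thesis using e by (intro that[of "a - e"]) auto
qed

text \<open>Any plateau supported inside \<open>\<Omega>\<close> serves: \<open>\<mu>\<close> is
  positive and nonincreasing, so it is at least \<mu>(c) > 0 where the plateau equals 1.\<close>

lemma weight_exists:
  obtains \<psi> where "test_fun \<Omega> \<psi>" "\<And>x. \<bar>\<psi> x\<bar> \<le> 1" "(LINT \<tau>:\<Omega>|lebesgue. \<psi> \<tau> * \<mu> \<tau>) > 0"
proof -
  obtain a where a: "a \<in> \<Omega>" using Omega_nonempty by blast
  obtain c where c: "a < c" "{a..c} \<subseteq> \<Omega>" "c \<in> \<Omega>" by (rule Omega_right_neighbourhood[OF a])
  \<comment> \<open>The interval [a, c] is cut into thirds: a rising ramp, a stretch of value 1 and
    a falling ramp, each of length 1/n.\<close>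
  define n where "n = 3 / (c - a)"
  define b where "b = a + 2 / n"
  have n: "n > 0" "b + 1 / n = c" using c by (auto simp: n_def b_def field_simps)
  have n1: "1 / n > 0" using n by simp
  have ab: "a \<le> b" "b \<le> c" using n(2) n1 unfolding b_def by (auto simp: field_simps)
  let ?p = "plateau n a b"
  have t: "test_fun \<Omega> ?p" using n c ab by (intro test_fun_plateau) auto
  have bd: "\<bar>?p x\<bar> \<le> 1" for x using plateau_bounds[OF n(1) ab(1), of x] by auto
  have pos: "(LINT \<tau>:\<Omega>|lebesgue. ?p \<tau> * \<mu> \<tau>) > 0"
  proof -
    have pm: "?p \<in> borel_measurable lebesgue"
      by (intro measurable_completion) (simp add: borel_measurable_continuous_onI continuous_plateau)
    have mm: "(\<lambda>x. indicator \<Omega> x *\<^sub>R \<mu> x) \<in> borel_measurable lebesgue"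
      using mu_set_integrable unfolding set_integrable_def by (rule borel_measurable_integrable)
    have "(\<lambda>x. ?p x * (indicator \<Omega> x *\<^sub>R \<mu> x)) \<in> borel_measurable lebesgue"
      using pm mm by (rule borel_measurable_times)
    then have m: "(\<lambda>x. indicator \<Omega> x *\<^sub>R (?p x * \<mu> x)) \<in> borel_measurable lebesgue" by (simp add: mult_ac)
    have I: "integrable lebesgue (\<lambda>x. indicator \<Omega> x *\<^sub>R (?p x * \<mu> x))"
    proof (rule Bochner_Integration.integrable_bound[OF _ m])
      show "integrable lebesgue (\<lambda>x. indicator \<Omega> x *\<^sub>R \<mu> x)"
        using mu_set_integrable by (simp add: set_integrable_def)
      show "AE x in lebesgue. norm (indicator \<Omega> x *\<^sub>R (?p x * \<mu> x)) \<le> norm (indicator \<Omega> x *\<^sub>R \<mu> x)"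
        using bd by (intro AE_I2) (auto simp: indicator_def abs_mult intro!: mult_left_le_one_le)
    qed
    have "\<mu> c * (1 / n) = (LINT x:{a + 1 / n..b}|lebesgue. \<mu> c)"
      using n1 by (simp add: set_lebesgue_integral_def b_def field_simps)
    also have "\<dots> \<le> (LINT \<tau>:\<Omega>|lebesgue. ?p \<tau> * \<mu> \<tau>)"
      unfolding set_lebesgue_integral_def
    proof (rule integral_mono[OF _ I])
      show "integrable lebesgue (\<lambda>x. indicat_real {a + 1 / n..b} x *\<^sub>R \<mu> c)"
        using set_integrable_lebesgue_continuous[of "a + 1 / n" b "\<lambda>_. \<mu> c"] by (simp add: set_integrable_def)
      fix x
      show "indicat_real {a + 1 / n..b} x *\<^sub>R \<mu> c \<le> indicator \<Omega> x *\<^sub>R (?p x * \<mu> x)"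
      proof (cases "x \<in> {a + 1 / n..b}")
        case True
        then have "a + 1 / n \<le> x" "x \<le> b" by simp_all
        then have "a \<le> x" "x \<le> c" using n1 ab by linarith+
        then have x: "x \<in> {a..c}" by simp
        then have "x \<in> \<Omega>" using c(2) by blast
        moreover have "?p x = 1" using True by (intro plateau_eq_1[OF n(1)]) auto
        moreover have "\<mu> c \<le> \<mu> x" using x c(3) \<open>x \<in> \<Omega>\<close> by (intro mu_antimono) auto
        ultimately show ?thesis using True by simp
      next
        case False
        then show ?thesis using plateau_bounds(1)[OF n(1) ab(1), of x] mu_pos[of x]
          by (auto simp: indicator_def less_imp_le)
      qed
    qed
    finally show ?thesis using mu_pos[OF c(3)] n1 by (meson less_le_trans mult_pos_pos)
  qed
  show ?thesis by (rule that[OF t bd pos])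
qed

end

locale viscoelastic = sqrt_operator DA DB A B + memory_kernel ell \<mu> \<delta>
  for DA DB :: "'h::{real_inner,banach,second_countable_topology} set" and A B :: "'h \<Rightarrow> 'h"
    and ell :: ereal and \<mu> :: "real \<Rightarrow> real" and \<delta> :: real
begin

definition mem :: "(real \<Rightarrow> 'h) \<Rightarrow> bool" where "mem \<xi> \<longleftrightarrow> in_mem ell \<mu> DB B \<xi>"

lemma mem_iff: "mem \<xi> \<longleftrightarrow> (AE \<tau> in M\<nu>. \<xi> \<tau> \<in> DB) \<and> square_integrable M\<nu> (\<lambda>\<tau>. B (\<xi> \<tau>))"
  unfolding mem_def in_mem_def square_integrable_Mnu_iff AE_Mnu_iff by simp

lemma mem_norm_eq: "mem \<xi> \<Longrightarrow> mem_norm ell \<mu> B \<xi> = L2_norm M\<nu> (\<lambda>\<tau>. B (\<xi> \<tau>))"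
  unfolding mem_iff mem_norm_def by (simp add: L2_norm_Mnu)

text \<open>\<open>B\<close> is linear on \<open>DB\<close> only, and memory functions take values
  there only almost everywhere; pointwise identities for \<open>B\<close> hold only in this
  sense.\<close>

lemma mem_AE_B_lin:
  assumes "mem \<xi>" "mem \<xi>'"
  shows "AE \<tau> in M\<nu>. B (a *\<^sub>R \<xi> \<tau> + b *\<^sub>R \<xi>' \<tau>) = a *\<^sub>R B (\<xi> \<tau>) + b *\<^sub>R B (\<xi>' \<tau>)"
  using assms unfolding mem_iff by (auto elim!: eventually_elim2 simp: B_lin)

lemma mem_lin:
  assumes "mem \<xi>" "mem \<xi>'"
  shows "mem (\<lambda>\<tau>. a *\<^sub>R \<xi> \<tau> + b *\<^sub>R \<xi>' \<tau>)"
proof -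
  have DBae: "AE \<tau> in M\<nu>. a *\<^sub>R \<xi> \<tau> + b *\<^sub>R \<xi>' \<tau> \<in> DB"
    using assms unfolding mem_iff by (auto elim!: eventually_elim2 simp: DB_lin)
  have "square_integrable M\<nu> (\<lambda>\<tau>. a *\<^sub>R B (\<xi> \<tau>) + b *\<^sub>R B (\<xi>' \<tau>))"
    using assms unfolding mem_iff by (intro square_integrable_lin) auto
  moreover have "AE \<tau> in M\<nu>. a *\<^sub>R B (\<xi> \<tau>) + b *\<^sub>R B (\<xi>' \<tau>) = B (a *\<^sub>R \<xi> \<tau> + b *\<^sub>R \<xi>' \<tau>)"
    using mem_AE_B_lin[OF assms, of a b] by eventually_elim simp
  ultimately have "square_integrable M\<nu> (\<lambda>\<tau>. B (a *\<^sub>R \<xi> \<tau> + b *\<^sub>R \<xi>' \<tau>))"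
    by (rule square_integrable_Mnu_AE_cong)
  with DBae show ?thesis by (simp add: mem_iff)
qed

lemma mem_mu:
  assumes "v \<in> DB" shows "mem (\<lambda>\<tau>. \<mu> \<tau> *\<^sub>R v)"
proof -
  have "(\<lambda>\<tau>. B (\<mu> \<tau> *\<^sub>R v)) = (\<lambda>\<tau>. \<mu> \<tau> *\<^sub>R B v)" using assms by (simp add: B_scale)
  then show ?thesis using assms subspace_DB
    by (simp add: mem_iff square_integrable_mu subspace_scale)
qed

text \<open>A bounded operator commutes with the Bochner integral, and G (B \<xi>) = \<xi> almost
  everywhere. This provides measurability in H, where membership in the memory space only records
  that of B \<xi>, and it places the integral in \<open>DB\<close>.\<close>

lemma weighted_integral_G:
  assumes \<xi>: "mem \<xi>" and \<phi>: "continuous_on UNIV \<phi>" "\<And>x. \<bar>\<phi> x\<bar> \<le> C"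
  shows "set_integrable lebesgue \<Omega> (\<lambda>\<tau>. \<phi> \<tau> *\<^sub>R \<xi> \<tau>)"
    and "(LINT \<tau>:\<Omega>|lebesgue. \<phi> \<tau> *\<^sub>R \<xi> \<tau>) = G (LINT \<tau>:\<Omega>|lebesgue. \<phi> \<tau> *\<^sub>R B (\<xi> \<tau>))"
proof -
  interpret G: bounded_linear G by (rule G_bounded_linear)
  have I: "set_integrable lebesgue \<Omega> (\<lambda>\<tau>. \<phi> \<tau> *\<^sub>R B (\<xi> \<tau>))"
    using \<xi> \<phi> unfolding mem_iff by (intro weighted_set_integrable(1)) auto
  then have I1: "integrable lebesgue (\<lambda>\<tau>. indicator \<Omega> \<tau> *\<^sub>R \<phi> \<tau> *\<^sub>R B (\<xi> \<tau>))" by (simp add: set_integrable_def)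
  have I2: "integrable lebesgue (\<lambda>\<tau>. G (indicator \<Omega> \<tau> *\<^sub>R \<phi> \<tau> *\<^sub>R B (\<xi> \<tau>)))"
    by (rule integrable_bounded_linear[OF G_bounded_linear I1])
  have ae: "AE \<tau> in lebesgue. G (indicator \<Omega> \<tau> *\<^sub>R \<phi> \<tau> *\<^sub>R B (\<xi> \<tau>)) = indicator \<Omega> \<tau> *\<^sub>R \<phi> \<tau> *\<^sub>R \<xi> \<tau>"
    using \<xi> unfolding mem_iff AE_Mnu_iff
    by (auto elim!: eventually_mono simp: indicator_def G.scaleR G_B G.zero)
  have m: "(\<lambda>\<tau>. indicator \<Omega> \<tau> *\<^sub>R \<phi> \<tau> *\<^sub>R \<xi> \<tau>) \<in> borel_measurable lebesgue"
    by (rule lebesgue_measurable_AE_cong[OF borel_measurable_integrable[OF I2] ae])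
  show "set_integrable lebesgue \<Omega> (\<lambda>\<tau>. \<phi> \<tau> *\<^sub>R \<xi> \<tau>)"
    unfolding set_integrable_def using I2 m ae by (rule integrable_cong_AE_imp) 
  have "(LINT \<tau>:\<Omega>|lebesgue. \<phi> \<tau> *\<^sub>R \<xi> \<tau>) = (\<integral>\<tau>. G (indicator \<Omega> \<tau> *\<^sub>R \<phi> \<tau> *\<^sub>R B (\<xi> \<tau>)) \<partial>lebesgue)"
    unfolding set_lebesgue_integral_def
    using m borel_measurable_integrable[OF I2] ae by (intro integral_cong_AE) (auto elim: eventually_mono)
  also have "\<dots> = G (LINT \<tau>:\<Omega>|lebesgue. \<phi> \<tau> *\<^sub>R B (\<xi> \<tau>))"
    unfolding set_lebesgue_integral_def by (rule integral_bounded_linear[OF G_bounded_linear I1])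
  finally show "(LINT \<tau>:\<Omega>|lebesgue. \<phi> \<tau> *\<^sub>R \<xi> \<tau>) = G (LINT \<tau>:\<Omega>|lebesgue. \<phi> \<tau> *\<^sub>R B (\<xi> \<tau>))" .
qed

lemma integral_G:
  assumes \<xi>: "mem \<xi>"
  shows "set_integrable lebesgue \<Omega> \<xi>" "(LINT \<tau>:\<Omega>|lebesgue. \<xi> \<tau>) = G (LINT \<tau>:\<Omega>|lebesgue. B (\<xi> \<tau>))"
  using weighted_integral_G[OF \<xi>, of "\<lambda>_. 1" 1] by (simp_all add: continuous_on_const)

text \<open>\<open>dissipation\<close> is applied to the images under \<open>B\<close>. The
  derivative relation is given in H for \<xi> and must be lifted to V, and the continuous
  representative replaces \<xi> throughout.\<close>

lemma P_rel_dissipation: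
  assumes P: "P_rel ell \<mu> DB B \<xi> \<eta>"
  shows "2 * (\<integral>\<tau>. inner (B (\<xi> \<tau>)) (B (\<eta> \<tau>)) \<partial>M\<nu>) \<le> - \<delta> * (L2_norm M\<nu> (\<lambda>\<tau>. B (\<xi> \<tau>)))\<^sup>2"
proof -
  have \<xi>: "mem \<xi>" and \<eta>: "mem \<eta>" and dd: "distr_deriv \<Omega> \<xi> \<eta>" using P by (auto simp: P_rel_def mem_def)
  obtain \<xi>' where ae: "AE \<tau> in lebesgue. \<tau> \<in> \<Omega> \<longrightarrow> \<xi>' \<tau> = \<xi> \<tau>" and DB': "\<And>\<tau>. \<tau> \<in> \<Omega> \<Longrightarrow> \<xi>' \<tau> \<in> DB"
    and c: "continuous_on \<Omega> (\<lambda>\<tau>. B (\<xi>' \<tau>))" and l: "((\<lambda>\<tau>. B (\<xi>' \<tau>)) \<longlongrightarrow> 0) (to_ell ell)"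
    using P unfolding P_rel_def by blast
  let ?\<zeta> = "\<lambda>\<tau>. B (\<xi>' \<tau>)" and ?\<theta> = "\<lambda>\<tau>. B (\<eta> \<tau>)"
  have aeM: "AE \<tau> in M\<nu>. \<xi>' \<tau> = \<xi> \<tau>" using ae by (simp add: AE_Mnu_iff)
  have aeB: "AE \<tau> in M\<nu>. B (\<xi> \<tau>) = B (\<xi>' \<tau>)" using aeM by eventually_elim simp
  have s\<xi>: "square_integrable M\<nu> (\<lambda>\<tau>. B (\<xi> \<tau>))" and s\<theta>: "square_integrable M\<nu> ?\<theta>"
    using \<xi> \<eta> by (auto simp: mem_iff)
  have s\<zeta>: "square_integrable M\<nu> ?\<zeta>" by (rule square_integrable_Mnu_AE_cong[OF s\<xi> aeB])
  have \<xi>'m: "mem \<xi>'" using s\<zeta> aeM \<xi> unfolding mem_iff by (auto elim: eventually_elim2)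
  have "distr_deriv \<Omega> ?\<zeta> ?\<theta>"
    unfolding distr_deriv_def
  proof (intro allI impI)
    fix \<phi> assume t: "test_fun \<Omega> \<phi>"
    obtain C where C: "C > 0" "\<And>x. \<bar>\<phi> x\<bar> \<le> C" "\<And>x. \<bar>deriv \<phi> x\<bar> \<le> C"
      "continuous_on UNIV \<phi>" "continuous_on UNIV (deriv \<phi>)" by (rule test_fun_bounded_continuous[OF t]) (rule that)
    \<comment> \<open>The lifted identity is checked after applying the injective operator
      \<open>G\<close>, where it becomes the given relation in H; \<open>B\<close> then undoes
      \<open>G\<close>.\<close>
    have "G (LINT \<tau>:\<Omega>|lebesgue. deriv \<phi> \<tau> *\<^sub>R ?\<zeta> \<tau>) = (LINT \<tau>:\<Omega>|lebesgue. deriv \<phi> \<tau> *\<^sub>R \<xi>' \<tau>)"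
      by (rule weighted_integral_G(2)[OF \<xi>'m C(5,3), symmetric])
    also have "\<dots> = (LINT \<tau>:\<Omega>|lebesgue. deriv \<phi> \<tau> *\<^sub>R \<xi> \<tau>)"
      unfolding set_lebesgue_integral_def
      using weighted_integral_G(1)[OF \<xi>'m C(5,3)] weighted_integral_G(1)[OF \<xi> C(5,3)] ae
      by (intro integral_cong_AE) (auto simp: set_integrable_def indicator_def elim!: eventually_mono
          dest!: borel_measurable_integrable)
    also have "\<dots> = - (LINT \<tau>:\<Omega>|lebesgue. \<phi> \<tau> *\<^sub>R \<eta> \<tau>)"
      using dd t unfolding distr_deriv_def by blast
    also have "\<dots> = - G (LINT \<tau>:\<Omega>|lebesgue. \<phi> \<tau> *\<^sub>R ?\<theta> \<tau>)"
      using weighted_integral_G(2)[OF \<eta> C(4,2)] by simp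
    also have "\<dots> = G (- (LINT \<tau>:\<Omega>|lebesgue. \<phi> \<tau> *\<^sub>R ?\<theta> \<tau>))"
      by (rule linear_neg[OF bounded_linear.linear[OF G_bounded_linear], symmetric])
    finally show "(LINT \<tau>:\<Omega>|lebesgue. deriv \<phi> \<tau> *\<^sub>R ?\<zeta> \<tau>) = - (LINT \<tau>:\<Omega>|lebesgue. \<phi> \<tau> *\<^sub>R ?\<theta> \<tau>)"
      using B_G by metis
  qed
  from dissipation[OF s\<zeta> s\<theta> c this l]
  have "2 * (\<integral>\<tau>. inner (?\<theta> \<tau>) (?\<zeta> \<tau>) \<partial>M\<nu>) \<le> - \<delta> * (L2_norm M\<nu> ?\<zeta>)\<^sup>2" .
  moreover have "(\<integral>\<tau>. inner (?\<theta> \<tau>) (?\<zeta> \<tau>) \<partial>M\<nu>) = (\<integral>\<tau>. inner (B (\<xi> \<tau>)) (B (\<eta> \<tau>)) \<partial>M\<nu>)"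
    using square_integrable_inner[OF s\<theta> s\<zeta>] square_integrable_inner[OF s\<xi> s\<theta>] aeB
    by (intro integral_cong_AE) (auto elim!: eventually_mono simp: inner_commute)
  ultimately show ?thesis using L2_norm_Mnu_AE_cong[OF s\<xi> aeB] by simp
qed

end

section \<open>The phase space and the Lyapunov form\<close>

context viscoelastic
begin

definition phase :: "'h state set" where "phase = {(u, v, \<xi>). u \<in> DB \<and> mem \<xi>}"

definition phase_inner :: "'h state \<Rightarrow> 'h state \<Rightarrow> real" where
  "phase_inner z z' = (case z of (u, v, \<xi>) \<Rightarrow> case z' of (u', v', \<xi>') \<Rightarrow>
     inner (B u) (B u') + inner v v' + (\<integral>\<tau>. inner (B (\<xi> \<tau>)) (B (\<xi>' \<tau>)) \<partial>M\<nu>))"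

lemma in_phase_iff: "in_phase ell \<mu> DB B z \<longleftrightarrow> z \<in> phase"
  by (auto simp: in_phase_def phase_def mem_def)

lemma mem_inner_integrable: "mem \<xi> \<Longrightarrow> mem \<xi>' \<Longrightarrow> integrable M\<nu> (\<lambda>\<tau>. inner (B (\<xi> \<tau>)) (B (\<xi>' \<tau>)))"
  by (simp add: mem_iff square_integrable_inner)

lemma mem_inner_lin:
  assumes "mem \<xi>" "mem \<xi>'" "mem \<eta>"
  shows "(\<integral>\<tau>. inner (B (a *\<^sub>R \<xi> \<tau> + b *\<^sub>R \<xi>' \<tau>)) (B (\<eta> \<tau>)) \<partial>M\<nu>)
    = a * (\<integral>\<tau>. inner (B (\<xi> \<tau>)) (B (\<eta> \<tau>)) \<partial>M\<nu>) + b * (\<integral>\<tau>. inner (B (\<xi>' \<tau>)) (B (\<eta> \<tau>)) \<partial>M\<nu>)"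
proof -
  note I = mem_inner_integrable[OF assms(1,3)] mem_inner_integrable[OF assms(2,3)]
  have "(\<integral>\<tau>. inner (B (a *\<^sub>R \<xi> \<tau> + b *\<^sub>R \<xi>' \<tau>)) (B (\<eta> \<tau>)) \<partial>M\<nu>)
    = (\<integral>\<tau>. a * inner (B (\<xi> \<tau>)) (B (\<eta> \<tau>)) + b * inner (B (\<xi>' \<tau>)) (B (\<eta> \<tau>)) \<partial>M\<nu>)"
  proof (rule integral_cong_AE)
    show "AE \<tau> in M\<nu>. inner (B (a *\<^sub>R \<xi> \<tau> + b *\<^sub>R \<xi>' \<tau>)) (B (\<eta> \<tau>))
        = a * inner (B (\<xi> \<tau>)) (B (\<eta> \<tau>)) + b * inner (B (\<xi>' \<tau>)) (B (\<eta> \<tau>))"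
      using mem_AE_B_lin[OF assms(1,2), of a b] by eventually_elim (simp add: inner_add_left)
  qed (use I mem_inner_integrable[OF mem_lin[OF assms(1,2)] assms(3)] in auto)
  then show ?thesis using I by simp
qed

sublocale phase: semi_inner_space phase st_lin phase_inner
proof
  fix x y q :: "'h state" and a b :: real
  assume x: "x \<in> phase" and y: "y \<in> phase"
  show "st_lin a x b y \<in> phase"
    using x y by (auto simp: phase_def st_lin_def DB_lin mem_lin)
  show "phase_inner x y = phase_inner y x"
    by (auto simp: phase_inner_def inner_commute split: prod.splits)
  show "0 \<le> phase_inner x x" by (auto simp: phase_inner_def split: prod.splits)
  assume "q \<in> phase"
  with x y show "phase_inner (st_lin a x b y) q = a * phase_inner x q + b * phase_inner y q"
    by (auto simp: phase_def phase_inner_def st_lin_def B_lin mem_inner_lin inner_add_left algebra_simps)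
qed

lemma phase_norm_eq: "z \<in> phase \<Longrightarrow> phase_norm ell \<mu> B z = phase.sn z"
  by (auto simp: phase_def phase_norm_def phase.sn_def phase_inner_def mem_norm_eq L2_norm_power2 power2_norm_eq_inner)

lemma phase_sn_components:
  assumes "(u, v, \<xi>) \<in> phase"
  shows "(phase.sn (u, v, \<xi>))\<^sup>2 = (norm (B u))\<^sup>2 + (norm v)\<^sup>2 + (L2_norm M\<nu> (\<lambda>\<tau>. B (\<xi> \<tau>)))\<^sup>2"
    and "norm (B u) \<le> phase.sn (u, v, \<xi>)" "norm v \<le> phase.sn (u, v, \<xi>)"
    "L2_norm M\<nu> (\<lambda>\<tau>. B (\<xi> \<tau>)) \<le> phase.sn (u, v, \<xi>)"
proof -
  show e: "(phase.sn (u, v, \<xi>))\<^sup>2 = (norm (B u))\<^sup>2 + (norm v)\<^sup>2 + (L2_norm M\<nu> (\<lambda>\<tau>. B (\<xi> \<tau>)))\<^sup>2"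
    using phase.sn_power2[OF assms] by (simp add: phase_inner_def L2_norm_power2 power2_norm_eq_inner)
  note nn = phase.sn_nonneg[OF assms]
  show "norm (B u) \<le> phase.sn (u, v, \<xi>)"
    by (rule power2_le_imp_le[OF _ nn]) (simp add: e)
  show "norm v \<le> phase.sn (u, v, \<xi>)"
    by (rule power2_le_imp_le[OF _ nn]) (simp add: e)
  show "L2_norm M\<nu> (\<lambda>\<tau>. B (\<xi> \<tau>)) \<le> phase.sn (u, v, \<xi>)"
    by (rule power2_le_imp_le[OF _ nn]) (simp add: e)
qed

lemma gen_rel_cases:
  assumes "gen_rel ell \<mu> DA A DB B (u, v, \<xi>) w"
  obtains \<eta> where "u \<in> DB" "v \<in> DB" "mem \<xi>" "mem \<eta>" "u + (LINT \<tau>:\<Omega>|lebesgue. \<xi> \<tau>) \<in> DA"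
    "P_rel ell \<mu> DB B \<xi> \<eta>" "w = (v, - A (u + (LINT \<tau>:\<Omega>|lebesgue. \<xi> \<tau>)), \<lambda>\<tau>. \<eta> \<tau> + \<mu> \<tau> *\<^sub>R v)"
  using assms by (auto simp: gen_rel_def in_phase_iff phase_def P_rel_def mem_def)

lemma gen_rel_phase:
  assumes "gen_rel ell \<mu> DA A DB B z w"
  shows "z \<in> phase" "w \<in> phase"
proof -
  obtain u v \<xi> where z: "z = (u, v, \<xi>)" by (cases z)
  from assms[unfolded z] show "w \<in> phase"
  proof (rule gen_rel_cases)
    fix \<eta> assume *: "v \<in> DB" "mem \<eta>"
      "w = (v, - A (u + (LINT \<tau>:\<Omega>|lebesgue. \<xi> \<tau>)), \<lambda>\<tau>. \<eta> \<tau> + \<mu> \<tau> *\<^sub>R v)"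
    then show ?thesis using mem_lin[OF *(2) mem_mu[OF *(1)], of 1 1] by (simp add: phase_def)
  qed
  show "z \<in> phase" using assms by (auto simp: gen_rel_def in_phase_iff)
qed

text \<open>Translates the concrete semigroup conditions into the abstract setting. Norm and
  seminorm are compared on \<open>phase\<close> only, so each limit is transferred through an
  eventual equality.\<close>

lemma generated_semigroup_phase:
  assumes S: "generated_contraction_semigroup ell \<mu> DA A DB B S"
  shows "generated_semigroup phase st_lin phase_inner S (gen_rel ell \<mu> DA A DB B)"
proof -
  note S' = S[unfolded generated_contraction_semigroup_def Let_def in_phase_iff]
  note S1 = S'[THEN conjunct1] and S2 = S'[THEN conjunct2, THEN conjunct1] and S3 = S'[THEN conjunct2, THEN conjunct2, THEN conjunct1] and S4 = S'[THEN conjunct2, THEN conjunct2, THEN conjunct2, THEN conjunct1] and S5 = S'[THEN conjunct2, THEN conjunct2, THEN conjunct2, THEN conjunct2, THEN conjunct1] and S6 = S'[THEN conjunct2, THEN conjunct2, THEN conjunct2, THEN conjunct2, THEN conjunct2, THEN conjunct1] and S7 = S'[THEN conjunct2, THEN conjunct2, THEN conjunct2, THEN conjunct2, THEN conjunct2, THEN conjunct2, THEN conjunct1] and S8 = S'[THEN conjunct2, THEN conjunct2, THEN conjunct2, THEN conjunct2, THEN conjunct2, THEN conjunct2, THEN conjunct2]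
  have d: "phase_norm ell \<mu> B (st_lin 1 z (-1) w) = phase.sd z w" if "z \<in> phase" "w \<in> phase" for z w
    using phase_norm_eq[OF phase.lin_closed[OF that]] by (simp add: phase.sd_def)
  have cl: "S t z \<in> phase" if "0 \<le> t" "z \<in> phase" for t z using S1 that by blast
  have ev: "eventually (\<lambda>h. phase_norm ell \<mu> B (st_lin 1 (st_lin (1/h) (S h z) (-1/h) z) (-1) w)
      = phase.sd (st_lin (1/h) (S h z) (-1/h) z) w) (at_right (0::real))" if "z \<in> phase" "w \<in> phase" for z w
    using eventually_at_right_less[of "0::real"]
  proof eventually_elim
    case (elim h)
    then have "S h z \<in> phase" using cl[of h z] that by simp
    then show ?case using that by (intro d phase.lin_closed)
  qed
  show ?thesis
  proof
    show "S t x \<in> phase" if "0 \<le> t" "x \<in> phase" for t x by (rule cl[OF that])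
    show "phase.sd (S t (st_lin a x b y)) (st_lin a (S t x) b (S t y)) = 0"
      if "0 \<le> t" "x \<in> phase" "y \<in> phase" for t x y a b
    proof -
      have "phase_norm ell \<mu> B (st_lin 1 (S t (st_lin a x b y)) (-1) (st_lin a (S t x) b (S t y))) = 0"
        using S2 that by blast
      then show ?thesis
        using d[of "S t (st_lin a x b y)" "st_lin a (S t x) b (S t y)"] that by (simp only: cl phase.lin_closed)
    qed
    show "phase.sn (S t x) \<le> phase.sn x" if "0 \<le> t" "x \<in> phase" for t x
    proof -
      have "phase_norm ell \<mu> B (S t x) \<le> phase_norm ell \<mu> B x" using S3 that by blast
      then show ?thesis using that by (simp only: phase_norm_eq cl)
    qed
    show "phase.sd (S 0 x) x = 0" if "x \<in> phase" for x
    proof -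
      have "phase_norm ell \<mu> B (st_lin 1 (S 0 x) (-1) x) = 0" using S4 that by blast
      then show ?thesis using d[of "S 0 x" x] that by (simp only: cl order_refl)
    qed
    show "phase.sd (S (t + s) x) (S t (S s x)) = 0" if "0 \<le> t" "0 \<le> s" "x \<in> phase" for t s x
    proof -
      have "phase_norm ell \<mu> B (st_lin 1 (S (t + s) x) (-1) (S t (S s x))) = 0" using S5 that by blast
      then show ?thesis using d[of "S (t + s) x" "S t (S s x)"] that by (simp only: cl add_nonneg_nonneg)
    qed
    show "((\<lambda>s. phase.sd (S s x) (S t x)) \<longlongrightarrow> 0) (at t within {0..})" if t: "0 \<le> t" and x: "x \<in> phase" for t x
    proof (rule Lim_transform_eventually)
      show "((\<lambda>s. phase_norm ell \<mu> B (st_lin 1 (S s x) (-1) (S t x))) \<longlongrightarrow> 0) (at t within {0..})"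
        using S6 t x by blast
      have "eventually (\<lambda>s. s \<in> {0..}) (at t within {0..})" by (simp add: eventually_at_filter)
      then show "eventually (\<lambda>s. phase_norm ell \<mu> B (st_lin 1 (S s x) (-1) (S t x)) = phase.sd (S s x) (S t x)) (at t within {0..})"
        by eventually_elim (use t x in \<open>auto intro!: d cl\<close>)
    qed
    show "x \<in> phase \<and> w \<in> phase" if "gen_rel ell \<mu> DA A DB B x w" for x w
      using gen_rel_phase[OF that] by simp
    show "\<exists>w. gen_rel ell \<mu> DA A DB B x w" if x: "x \<in> phase" and w: "w \<in> phase"
      and l: "((\<lambda>h. phase.sd (st_lin (1 / h) (S h x) (- 1 / h) x) w) \<longlongrightarrow> 0) (at_right 0)" for x w
    proof -
      have "((\<lambda>h. phase_norm ell \<mu> B (st_lin 1 (st_lin (1/h) (S h x) (-1/h) x) (-1) w)) \<longlongrightarrow> 0) (at_right 0)"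
        using l by (rule Lim_transform_eventually) (use ev[OF x w] in \<open>auto elim: eventually_mono\<close>)
      then show ?thesis using S7 x w by blast
    qed
    show "((\<lambda>h. phase.sd (st_lin (1 / h) (S h x) (- 1 / h) x) w) \<longlongrightarrow> 0) (at_right 0)"
      if g: "gen_rel ell \<mu> DA A DB B x w" for x w
    proof (rule Lim_transform_eventually)
      show "((\<lambda>h. phase_norm ell \<mu> B (st_lin 1 (st_lin (1/h) (S h x) (-1/h) x) (-1) w)) \<longlongrightarrow> 0) (at_right 0)"
        using S8 g by blast
    qed (rule ev[OF gen_rel_phase[OF g]])
  qed
qed

text \<open>The averaging weight \<open>\<psi>\<close> vanishes near \<open>0\<close>, where \<open>\<mu>\<close> may blow up, so that pairing with it
  never produces the trace \<open>\<xi>(0)\<close>.\<close>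
definition mem_avg :: "(real \<Rightarrow> real) \<Rightarrow> (real \<Rightarrow> 'h) \<Rightarrow> 'h" where
  "mem_avg \<psi> \<xi> = (LINT \<tau>:\<Omega>|lebesgue. \<psi> \<tau> *\<^sub>R \<xi> \<tau>)"

text \<open>The polar form of the functional: on the diagonal it is N |z|^2 - <v, avg \<xi>> + e <v,
  u>. Being symmetric, it gives the right derivative along an orbit as twice its value at z and the
  image of z.\<close>

definition lyapunov :: "(real \<Rightarrow> real) \<Rightarrow> real \<Rightarrow> real \<Rightarrow> 'h state \<Rightarrow> 'h state \<Rightarrow> real" where
  "lyapunov \<psi> N e z z' = N * phase_inner z z' +
     (case z of (u, v, \<xi>) \<Rightarrow> case z' of (u', v', \<xi>') \<Rightarrow>
        - (inner v (mem_avg \<psi> \<xi>') + inner v' (mem_avg \<psi> \<xi>)) / 2 + e / 2 * (inner v u' + inner v' u))"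

lemma mem_avg_lin:
  assumes t: "test_fun \<Omega> \<psi>" and \<xi>: "mem \<xi>" "mem \<xi>'"
  shows "mem_avg \<psi> (\<lambda>\<tau>. a *\<^sub>R \<xi> \<tau> + b *\<^sub>R \<xi>' \<tau>) = a *\<^sub>R mem_avg \<psi> \<xi> + b *\<^sub>R mem_avg \<psi> \<xi>'"
proof -
  obtain C where C: "C > 0" "\<And>x. \<bar>\<psi> x\<bar> \<le> C" "\<And>x. \<bar>deriv \<psi> x\<bar> \<le> C"
    "continuous_on UNIV \<psi>" "continuous_on UNIV (deriv \<psi>)"
    by (rule test_fun_bounded_continuous[OF t]) (rule that)
  note I = weighted_integral_G(1)[OF \<xi>(1) C(4,2)] weighted_integral_G(1)[OF \<xi>(2) C(4,2)]
  have "mem_avg \<psi> (\<lambda>\<tau>. a *\<^sub>R \<xi> \<tau> + b *\<^sub>R \<xi>' \<tau>)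
      = (LINT \<tau>:\<Omega>|lebesgue. a *\<^sub>R (\<psi> \<tau> *\<^sub>R \<xi> \<tau>) + b *\<^sub>R (\<psi> \<tau> *\<^sub>R \<xi>' \<tau>))"
    unfolding mem_avg_def by (simp only: scaleR_add_right scaleR_left_commute)
  also have "\<dots> = a *\<^sub>R mem_avg \<psi> \<xi> + b *\<^sub>R mem_avg \<psi> \<xi>'"
    unfolding mem_avg_def
    using set_integral_add(2)[OF set_integrable_scaleR_right[OF I(1)] set_integrable_scaleR_right[OF I(2)]]
    by (simp only: set_integral_scaleR_right)
  finally show ?thesis .
qed

lemma lyapunov_lin:
  assumes t: "test_fun \<Omega> \<psi>" and x: "x \<in> phase" "y \<in> phase" "q \<in> phase"
  shows "lyapunov \<psi> N e (st_lin a x b y) q = a * lyapunov \<psi> N e x q + b * lyapunov \<psi> N e y q"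
proof -
  obtain u v \<xi> u' v' \<xi>' u'' v'' \<xi>'' where e: "x = (u, v, \<xi>)" "y = (u', v', \<xi>')" "q = (u'', v'', \<xi>'')"
    by (cases x, cases y, cases q)
  have m: "mem \<xi>" "mem \<xi>'" using x e by (auto simp: phase_def)
  have 1: "phase_inner (st_lin a x b y) q = a * phase_inner x q + b * phase_inner y q"
    by (rule phase.ip_lin[OF x])
  show ?thesis
    unfolding lyapunov_def 1 unfolding e st_lin_def prod.case mem_avg_lin[OF t m]
    by (simp add: inner_add_left inner_add_right algebra_simps add_divide_distrib diff_divide_distrib)
qed

lemma lyapunov_sym: "x \<in> phase \<Longrightarrow> y \<in> phase \<Longrightarrow> lyapunov \<psi> N e x y = lyapunov \<psi> N e y x"
  using phase.ip_sym[of x y] by (auto simp: lyapunov_def field_simps split: prod.splits)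

lemma G_norm_bound: obtains g where "g > 0" "\<And>x. norm (G x) \<le> g * norm x"
  using bounded_linear.pos_bounded[OF G_bounded_linear] by (metis mult.commute)

lemma mem_avg_bound:
  assumes t: "continuous_on UNIV \<psi>" "\<And>x. \<bar>\<psi> x\<bar> \<le> C" and \<xi>: "mem \<xi>"
  shows "B (mem_avg \<psi> \<xi>) = (LINT \<tau>:\<Omega>|lebesgue. \<psi> \<tau> *\<^sub>R B (\<xi> \<tau>))" "mem_avg \<psi> \<xi> \<in> DB"
    and "norm (B (mem_avg \<psi> \<xi>)) \<le> C * (sqrt \<kappa> * L2_norm M\<nu> (\<lambda>\<tau>. B (\<xi> \<tau>)))"
proof -
  have e: "mem_avg \<psi> \<xi> = G (LINT \<tau>:\<Omega>|lebesgue. \<psi> \<tau> *\<^sub>R B (\<xi> \<tau>))"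
    unfolding mem_avg_def by (rule weighted_integral_G(2)[OF \<xi> t])
  then show B: "B (mem_avg \<psi> \<xi>) = (LINT \<tau>:\<Omega>|lebesgue. \<psi> \<tau> *\<^sub>R B (\<xi> \<tau>))" "mem_avg \<psi> \<xi> \<in> DB" by simp_all
  show "norm (B (mem_avg \<psi> \<xi>)) \<le> C * (sqrt \<kappa> * L2_norm M\<nu> (\<lambda>\<tau>. B (\<xi> \<tau>)))"
    unfolding B using \<xi> t by (intro weighted_set_integrable(2)) (auto simp: mem_iff)
qed

text \<open>The cross terms pair in H, while position and memory are measured in V; the constant
  \<open>g\<close> compares the two norms through \<open>G\<close>.\<close>

lemma lyapunov_cross_terms_bound:
  assumes t: "continuous_on UNIV \<psi>" "\<And>x. \<bar>\<psi> x\<bar> \<le> 1" and g: "g > 0" "\<And>x. norm (G x) \<le> g * norm x"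
    and z: "(u, v, \<xi>) \<in> phase" "(u', v', \<xi>') \<in> phase"
  shows "\<bar>inner v (mem_avg \<psi> \<xi>')\<bar> \<le> g * sqrt \<kappa> * (phase.sn (u, v, \<xi>) * phase.sn (u', v', \<xi>'))"
    and "\<bar>inner v u'\<bar> \<le> g * (phase.sn (u, v, \<xi>) * phase.sn (u', v', \<xi>'))"
proof -
  have m: "mem \<xi>'" "u' \<in> DB" using z by (auto simp: phase_def)
  note b = mem_avg_bound[OF t m(1)]
  note c = phase_sn_components[OF z(1)] phase_sn_components[OF z(2)]
  have n: "norm (mem_avg \<psi> \<xi>') \<le> g * (sqrt \<kappa> * phase.sn (u', v', \<xi>'))"
  proof -
    have "norm (mem_avg \<psi> \<xi>') \<le> g * norm (B (mem_avg \<psi> \<xi>'))"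
      using g(2)[of "B (mem_avg \<psi> \<xi>')"] G_B[OF b(2)] by simp
    also have "\<dots> \<le> g * (sqrt \<kappa> * L2_norm M\<nu> (\<lambda>\<tau>. B (\<xi>' \<tau>)))"
      using b(3) g(1) by (intro mult_left_mono) auto
    also have "\<dots> \<le> g * (sqrt \<kappa> * phase.sn (u', v', \<xi>'))"
      using c(8) g(1) kappa_nonneg by (intro mult_left_mono) auto
    finally show ?thesis .
  qed
  have "\<bar>inner v (mem_avg \<psi> \<xi>')\<bar> \<le> norm v * norm (mem_avg \<psi> \<xi>')" by (rule Cauchy_Schwarz_ineq2)
  also have "\<dots> \<le> phase.sn (u, v, \<xi>) * (g * (sqrt \<kappa> * phase.sn (u', v', \<xi>')))"
    using n c(3) phase.sn_nonneg[OF z(1)] by (intro mult_mono) auto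
  finally show "\<bar>inner v (mem_avg \<psi> \<xi>')\<bar> \<le> g * sqrt \<kappa> * (phase.sn (u, v, \<xi>) * phase.sn (u', v', \<xi>'))"
    by (simp add: mult_ac)
  have "norm u' \<le> g * norm (B u')" using g(2)[of "B u'"] G_B[OF m(2)] by simp
  also have "\<dots> \<le> g * phase.sn (u', v', \<xi>')" using c(6) g(1) by (intro mult_left_mono) auto
  finally have nu: "norm u' \<le> g * phase.sn (u', v', \<xi>')" .
  have "\<bar>inner v u'\<bar> \<le> norm v * norm u'" by (rule Cauchy_Schwarz_ineq2)
  also have "\<dots> \<le> phase.sn (u, v, \<xi>) * (g * phase.sn (u', v', \<xi>'))"
    using nu c(3) phase.sn_nonneg[OF z(1)] by (intro mult_mono) auto
  finally show "\<bar>inner v u'\<bar> \<le> g * (phase.sn (u, v, \<xi>) * phase.sn (u', v', \<xi>'))"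
    by (simp add: mult_ac)
qed

text \<open>Let \<open>x\<close>, \<open>y\<close>, \<open>k\<close> be the norms of the three
  components. The average contributes - c1 y^2; half of it pays for the + c1 / 2 y^2 of the second
  multiplier, whose weight c1 / 2 also supplies - c1 / 2 x^2. Young's inequality spends half of what
  remains on the mixed terms x k and y k, which leaves c1 / 4. The condition on \<open>N\<close>
  collects the resulting multiples of k^2: \<open>\<kappa>\<close> from pairing the memory with its
  own average, the two remainders of Young's inequality, and c1 / 4 for the conclusion.\<close>

lemma lyapunov_decreasing:
  assumes t: "test_fun \<Omega> \<psi>" "\<And>x. \<bar>\<psi> x\<bar> \<le> 1" and C: "\<And>x. \<bar>deriv \<psi> x\<bar> \<le> C"
    and g: "g > 0" "\<And>x. norm (G x) \<le> g * norm x"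
    and c1: "c1 = (LINT \<tau>:\<Omega>|lebesgue. \<psi> \<tau> * \<mu> \<tau>)" "c1 > 0"
    and N: "N * \<delta> \<ge> \<kappa> + (g * C * sqrt \<kappa>)\<^sup>2 / c1 + (sqrt \<kappa> + sqrt \<kappa> * c1 / 2)\<^sup>2 / c1 + c1 / 4" "N \<ge> 0"
    and gen: "gen_rel ell \<mu> DA A DB B z w"
  shows "2 * lyapunov \<psi> N (c1 / 2) z w \<le> - (c1 / 4) * (phase.sn z)\<^sup>2"
proof -
  obtain u v \<xi> where z: "z = (u, v, \<xi>)" by (cases z)
  obtain \<eta> where 1: "u \<in> DB" "v \<in> DB" "mem \<xi>" "mem \<eta>" "u + (LINT \<tau>:\<Omega>|lebesgue. \<xi> \<tau>) \<in> DA"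
    "P_rel ell \<mu> DB B \<xi> \<eta>" "w = (v, - A (u + (LINT \<tau>:\<Omega>|lebesgue. \<xi> \<tau>)), \<lambda>\<tau>. \<eta> \<tau> + \<mu> \<tau> *\<^sub>R v)"
    using gen[unfolded z] by (rule gen_rel_cases) (rule that)
  have zX: "(u, v, \<xi>) \<in> phase" using 1 by (simp add: phase_def)
  have sqB: "square_integrable M\<nu> (\<lambda>\<tau>. B (\<xi> \<tau>))" using 1 by (simp add: mem_iff)
  obtain C' where C': "continuous_on UNIV \<psi>" "continuous_on UNIV (deriv \<psi>)"
    by (rule test_fun_bounded_continuous[OF t(1)]) (rule that)
  define I where "I = (LINT \<tau>:\<Omega>|lebesgue. B (\<xi> \<tau>))"
  define p where "p = u + (LINT \<tau>:\<Omega>|lebesgue. \<xi> \<tau>)"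
  define x where "x = norm (B u)"
  define y where "y = norm v"
  define k where "k = L2_norm M\<nu> (\<lambda>\<tau>. B (\<xi> \<tau>))"
  define s where "s = sqrt \<kappa>"
  have nn: "0 \<le> x" "0 \<le> y" "0 \<le> k" "0 \<le> s" using kappa_nonneg by (auto simp: x_def y_def k_def s_def)
  have ss: "s * s = \<kappa>" using kappa_nonneg by (simp add: s_def)
  have pA: "p \<in> DA" using 1 by (simp add: p_def)
  have GI: "(LINT \<tau>:\<Omega>|lebesgue. \<xi> \<tau>) = G I" using integral_G(2)[OF 1(3)] by (simp add: I_def)
  have Bp: "B p = B u + I" unfolding p_def GI using 1(1) by (simp add: B_add)
  have nI: "norm I \<le> s * k"
  proof -
    have "norm I \<le> (LINT \<tau>:\<Omega>|lebesgue. norm (B (\<xi> \<tau>)))"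
      unfolding I_def by (rule set_integral_norm_bound[OF L1_bound_Omega(1)[OF sqB]])
    then show ?thesis using L1_bound_Omega(2)[OF sqB] by (simp add: s_def k_def)
  qed
  have w: "w = (v, - A p, \<lambda>\<tau>. 1 *\<^sub>R \<eta> \<tau> + 1 *\<^sub>R (\<mu> \<tau> *\<^sub>R v))" using 1(7) by (simp add: p_def)
  \<comment> \<open>The couplings cancel: those of v with u and with the memory add up to <B v, B u
    + I>, which is <B v, B p>, and the equation for v contributes its negative.\<close>
  have E: "2 * phase_inner z w \<le> - \<delta> * k\<^sup>2"
  proof -
    have "(\<integral>\<tau>. inner (B (\<xi> \<tau>)) (B (\<mu> \<tau> *\<^sub>R v)) \<partial>M\<nu>) = inner I (B v)"
    proof -
      have Bm: "(\<lambda>\<tau>. B (\<xi> \<tau>)) \<in> borel_measurable (lebesgue_on \<Omega>)"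
        using sqB by (simp add: square_integrable_def measurable_Mnu)
      then have "(\<lambda>\<tau>. inner (B (\<xi> \<tau>)) (\<mu> \<tau> *\<^sub>R B v)) \<in> borel_measurable (lebesgue_on \<Omega>)" by measurable
      then have "(\<integral>\<tau>. inner (B (\<xi> \<tau>)) (\<mu> \<tau> *\<^sub>R B v) \<partial>M\<nu>)
          = (LINT \<tau>:\<Omega>|lebesgue. \<nu> \<tau> *\<^sub>R inner (B (\<xi> \<tau>)) (\<mu> \<tau> *\<^sub>R B v))" by (rule integral_Mnu)
      also have "\<dots> = (\<integral>\<tau>. inner (indicator \<Omega> \<tau> *\<^sub>R B (\<xi> \<tau>)) (B v) \<partial>lebesgue)"
        unfolding set_lebesgue_integral_def
      proof (rule Bochner_Integration.integral_cong[OF refl])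
        fix \<tau> show "indicat_real \<Omega> \<tau> *\<^sub>R \<nu> \<tau> *\<^sub>R inner (B (\<xi> \<tau>)) (\<mu> \<tau> *\<^sub>R B v) = inner (indicator \<Omega> \<tau> *\<^sub>R B (\<xi> \<tau>)) (B v)"
          using mu_pos[of \<tau>] by (cases "\<tau> \<in> \<Omega>") auto
      qed
      also have "\<dots> = inner I (B v)"
        using integral_inner_left[of "B v" lebesgue "\<lambda>\<tau>. indicator \<Omega> \<tau> *\<^sub>R B (\<xi> \<tau>)"] L1_bound_Omega(1)[OF sqB]
        by (simp add: I_def set_lebesgue_integral_def set_integrable_def)
      finally show ?thesis using 1(2) by (simp add: B_scale)
    qed
    moreover have "(\<integral>\<tau>. inner (B (\<xi> \<tau>)) (B (1 *\<^sub>R \<eta> \<tau> + 1 *\<^sub>R (\<mu> \<tau> *\<^sub>R v))) \<partial>M\<nu>)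
       = (\<integral>\<tau>. inner (B (\<xi> \<tau>)) (B (\<eta> \<tau>)) \<partial>M\<nu>) + (\<integral>\<tau>. inner (B (\<xi> \<tau>)) (B (\<mu> \<tau> *\<^sub>R v)) \<partial>M\<nu>)"
      using mem_inner_lin[OF 1(4) mem_mu[OF 1(2)] 1(3), of 1 1] by (simp add: inner_commute)
    moreover have "inner v (A p) = inner (B v) (B p)" using inner_A[OF pA 1(2)] by (simp add: inner_commute)
    ultimately have "phase_inner z w = (\<integral>\<tau>. inner (B (\<xi> \<tau>)) (B (\<eta> \<tau>)) \<partial>M\<nu>)"
      unfolding z w phase_inner_def by (simp add: Bp inner_add_right inner_commute)
    then show ?thesis using P_rel_dissipation[OF 1(6)] by (simp add: k_def)
  qed
  \<comment> \<open>The derivative of \<xi> is moved onto \<psi>, and the source \<mu> v averages to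
    c1 v. This is the origin of the damping of v.\<close>
  have avg: "mem_avg \<psi> (\<lambda>\<tau>. 1 *\<^sub>R \<eta> \<tau> + 1 *\<^sub>R (\<mu> \<tau> *\<^sub>R v)) = - mem_avg (deriv \<psi>) \<xi> + c1 *\<^sub>R v"
  proof -
    have "(LINT \<tau>:\<Omega>|lebesgue. deriv \<psi> \<tau> *\<^sub>R \<xi> \<tau>) = - (LINT \<tau>:\<Omega>|lebesgue. \<psi> \<tau> *\<^sub>R \<eta> \<tau>)"
      using 1(6) t(1) unfolding P_rel_def distr_deriv_def by blast
    then have "mem_avg \<psi> \<eta> = - mem_avg (deriv \<psi>) \<xi>" by (simp add: mem_avg_def)
    moreover have "mem_avg \<psi> (\<lambda>\<tau>. \<mu> \<tau> *\<^sub>R v) = c1 *\<^sub>R v"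
    proof (cases "v = 0")
      case False
      have "mem_avg \<psi> (\<lambda>\<tau>. \<mu> \<tau> *\<^sub>R v) = (\<integral>\<tau>. (indicator \<Omega> \<tau> *\<^sub>R (\<psi> \<tau> * \<mu> \<tau>)) *\<^sub>R v \<partial>lebesgue)"
        unfolding mem_avg_def set_lebesgue_integral_def by (intro Bochner_Integration.integral_cong) auto
      also have "\<dots> = (\<integral>\<tau>. indicator \<Omega> \<tau> *\<^sub>R (\<psi> \<tau> * \<mu> \<tau>) \<partial>lebesgue) *\<^sub>R v"
      proof (rule integral_scaleR_left, rule ccontr)
        \<comment> \<open>The integral of a non-integrable function is 0 by convention, so c1 > 0
          already implies integrability.\<close>
        assume "\<not> integrable lebesgue (\<lambda>\<tau>. indicator \<Omega> \<tau> *\<^sub>R (\<psi> \<tau> * \<mu> \<tau>))"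
        from not_integrable_integral_eq[OF this] show False
          using c1 by (simp add: set_lebesgue_integral_def)
      qed
      finally show ?thesis unfolding c1(1) set_lebesgue_integral_def .
    qed (simp add: mem_avg_def)
    ultimately show ?thesis using mem_avg_lin[OF t(1) 1(4) mem_mu[OF 1(2)], of 1 1] by simp
  qed
  have F1: "inner (A p) (mem_avg \<psi> \<xi>) \<le> (x + s * k) * (s * k)"
  proof -
    note b = mem_avg_bound[OF C'(1) t(2) 1(3)]
    have "inner (A p) (mem_avg \<psi> \<xi>) = inner (B p) (B (mem_avg \<psi> \<xi>))" by (rule inner_A[OF pA b(2)])
    also have "\<dots> \<le> norm (B p) * norm (B (mem_avg \<psi> \<xi>))" by (rule norm_cauchy_schwarz)
    also have "\<dots> \<le> (x + s * k) * (s * k)"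
    proof (rule mult_mono)
      show "norm (B p) \<le> x + s * k" using norm_triangle_ineq[of "B u" I] nI by (simp add: Bp x_def)
    qed (use b(3) nn in \<open>auto simp: s_def k_def\<close>)
    finally show ?thesis .
  qed
  have F2: "inner v (mem_avg (deriv \<psi>) \<xi>) \<le> g * C * s * (y * k)"
  proof -
    note b = mem_avg_bound[OF C'(2) C 1(3)]
    have "norm (mem_avg (deriv \<psi>) \<xi>) \<le> g * norm (B (mem_avg (deriv \<psi>) \<xi>))"
      using g(2)[of "B (mem_avg (deriv \<psi>) \<xi>)"] G_B[OF b(2)] by simp
    also have "\<dots> \<le> g * (C * (s * k))" using b(3) g(1) unfolding s_def k_def by (intro mult_left_mono) auto
    finally have "norm (mem_avg (deriv \<psi>) \<xi>) \<le> g * (C * (s * k))" .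
    then have "norm v * norm (mem_avg (deriv \<psi>) \<xi>) \<le> y * (g * (C * (s * k)))"
      unfolding y_def by (rule mult_left_mono) simp
    then show ?thesis using norm_cauchy_schwarz[of v "mem_avg (deriv \<psi>) \<xi>"] by (simp add: mult_ac)
  qed
  have F3: "- inner (A p) u \<le> - x\<^sup>2 + s * k * x"
  proof -
    have "inner (A p) u = x\<^sup>2 + inner I (B u)"
      using inner_A[OF pA 1(1)] by (simp add: Bp inner_add_left x_def power2_norm_eq_inner)
    moreover have "- inner I (B u) \<le> s * k * x"
    proof -
      have "- inner I (B u) \<le> norm I * norm (B u)" using Cauchy_Schwarz_ineq2[of I "B u"] by linarith
      also have "\<dots> \<le> s * k * x" unfolding x_def using nI by (rule mult_right_mono) simp
      finally show ?thesis .
    qed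
    ultimately show ?thesis by simp
  qed
  have L: "2 * lyapunov \<psi> N (c1 / 2) z w = N * (2 * phase_inner z w) + inner v (mem_avg (deriv \<psi>) \<xi>) - c1 * y\<^sup>2
      + inner (A p) (mem_avg \<psi> \<xi>) + c1 / 2 * (y\<^sup>2 - inner (A p) u)"
    unfolding lyapunov_def unfolding z w prod.case avg
    by (simp add: y_def inner_add_right power2_norm_eq_inner algebra_simps add_divide_distrib diff_divide_distrib)
  \<comment> \<open>The coefficients of the mixed products: \<open>a\<close> belongs to x k, and
    \<open>d\<close> below to y k.\<close>
  define a where "a = s + s * c1 / 2"
  define d where "d = g * C * s"
  have Y1: "d * (y * k) \<le> c1 / 4 * y\<^sup>2 + d\<^sup>2 / c1 * k\<^sup>2"
  proof -
    have "0 \<le> (c1 / 2 * y - d * k)\<^sup>2 / c1" using c1 by simp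
    also have "\<dots> = c1 / 4 * y\<^sup>2 + d\<^sup>2 / c1 * k\<^sup>2 - d * (y * k)"
      using c1 by (simp add: power2_eq_square field_simps)
    finally show ?thesis by simp
  qed
  have Y2: "a * (x * k) \<le> c1 / 4 * x\<^sup>2 + a\<^sup>2 / c1 * k\<^sup>2"
  proof -
    have "0 \<le> (c1 / 2 * x - a * k)\<^sup>2 / c1" using c1 by simp
    also have "\<dots> = c1 / 4 * x\<^sup>2 + a\<^sup>2 / c1 * k\<^sup>2 - a * (x * k)"
      using c1 by (simp add: power2_eq_square field_simps)
    finally show ?thesis by simp
  qed
  have "N * (2 * phase_inner z w) \<le> N * (- \<delta> * k\<^sup>2)" using E N(2) by (rule mult_left_mono)
  moreover have "c1 / 2 * (y\<^sup>2 - inner (A p) u) \<le> c1 / 2 * (y\<^sup>2 - x\<^sup>2 + s * k * x)"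
    using F3 c1 by (intro mult_left_mono) auto
  ultimately have "2 * lyapunov \<psi> N (c1 / 2) z w \<le> N * (- \<delta> * k\<^sup>2) + d * (y * k) - c1 * y\<^sup>2
      + (x + s * k) * (s * k) + c1 / 2 * (y\<^sup>2 - x\<^sup>2 + s * k * x)"
    unfolding L using F1 F2 unfolding d_def by linarith
  also have "\<dots> = - (N * \<delta>) * k\<^sup>2 + d * (y * k) - c1 / 2 * y\<^sup>2 - c1 / 2 * x\<^sup>2 + a * (x * k) + \<kappa> * k\<^sup>2"
    unfolding a_def ss[symmetric] by (simp add: power2_eq_square field_simps)
  also have "\<dots> \<le> - (N * \<delta>) * k\<^sup>2 - c1 / 4 * y\<^sup>2 - c1 / 4 * x\<^sup>2 + (\<kappa> + d\<^sup>2 / c1 + a\<^sup>2 / c1) * k\<^sup>2"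
    using Y1 Y2 by (simp add: algebra_simps)
  also have "\<dots> \<le> - (c1 / 4) * (x\<^sup>2 + y\<^sup>2 + k\<^sup>2)"
  proof -
    have "(\<kappa> + d\<^sup>2 / c1 + a\<^sup>2 / c1 + c1 / 4) * k\<^sup>2 \<le> (N * \<delta>) * k\<^sup>2"
      using N(1) unfolding d_def a_def s_def by (intro mult_right_mono) auto
    then show ?thesis by (simp add: algebra_simps)
  qed
  finally show ?thesis unfolding z phase_sn_components(1)[OF zX] by (simp add: x_def y_def k_def)
qed

end

section \<open>Density of the domain of the generator\<close>

context viscoelastic
begin

text \<open>Describes the closure of the \<open>B\<close>-image of the domain of P. It is enlarged
  step by step: plateaus times continuous functions, indicators, simple functions, all of the
  weighted L^2 space.\<close>

definition approximable :: "(real \<Rightarrow> 'h) \<Rightarrow> bool" where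
  "approximable f \<longleftrightarrow> square_integrable M\<nu> f \<and>
     (\<forall>e>0. \<exists>\<xi> \<eta>. P_rel ell \<mu> DB B \<xi> \<eta> \<and> L2_norm M\<nu> (\<lambda>\<tau>. f \<tau> - B (\<xi> \<tau>)) < e)"

lemma P_rel_mem: "P_rel ell \<mu> DB B \<xi> \<eta> \<Longrightarrow> mem \<xi> \<and> mem \<eta>"
  by (simp add: P_rel_def mem_def)

lemma P_rel_add:
  assumes 1: "P_rel ell \<mu> DB B \<xi> \<eta>" and 2: "P_rel ell \<mu> DB B \<xi>' \<eta>'"
  shows "P_rel ell \<mu> DB B (\<lambda>\<tau>. \<xi> \<tau> + \<xi>' \<tau>) (\<lambda>\<tau>. \<eta> \<tau> + \<eta>' \<tau>)"
proof -
  note m = P_rel_mem[OF 1] P_rel_mem[OF 2]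
  have "mem (\<lambda>\<tau>. \<xi> \<tau> + \<xi>' \<tau>)" "mem (\<lambda>\<tau>. \<eta> \<tau> + \<eta>' \<tau>)"
    using m mem_lin[of \<xi> \<xi>' 1 1] mem_lin[of \<eta> \<eta>' 1 1] by simp_all
  moreover have "distr_deriv \<Omega> (\<lambda>\<tau>. \<xi> \<tau> + \<xi>' \<tau>) (\<lambda>\<tau>. \<eta> \<tau> + \<eta>' \<tau>)"
    unfolding distr_deriv_def
  proof (intro allI impI)
    fix \<phi> assume t: "test_fun \<Omega> \<phi>"
    obtain C where C: "C > 0" "\<And>x. \<bar>\<phi> x\<bar> \<le> C" "\<And>x. \<bar>deriv \<phi> x\<bar> \<le> C"
      "continuous_on UNIV \<phi>" "continuous_on UNIV (deriv \<phi>)"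
      by (rule test_fun_bounded_continuous[OF t]) (rule that)
    note I = weighted_integral_G(1)[OF _ C(4,2)] weighted_integral_G(1)[OF _ C(5,3)]
    have "(LINT \<tau>:\<Omega>|lebesgue. deriv \<phi> \<tau> *\<^sub>R (\<xi> \<tau> + \<xi>' \<tau>))
       = (LINT \<tau>:\<Omega>|lebesgue. deriv \<phi> \<tau> *\<^sub>R \<xi> \<tau>) + (LINT \<tau>:\<Omega>|lebesgue. deriv \<phi> \<tau> *\<^sub>R \<xi>' \<tau>)"
      unfolding scaleR_add_right using m by (intro set_integral_add(2) I) auto
    also have "\<dots> = - (LINT \<tau>:\<Omega>|lebesgue. \<phi> \<tau> *\<^sub>R \<eta> \<tau>) + - (LINT \<tau>:\<Omega>|lebesgue. \<phi> \<tau> *\<^sub>R \<eta>' \<tau>)"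
      using 1 2 t unfolding P_rel_def distr_deriv_def by simp
    also have "\<dots> = - (LINT \<tau>:\<Omega>|lebesgue. \<phi> \<tau> *\<^sub>R (\<eta> \<tau> + \<eta>' \<tau>))"
    proof -
      have "(LINT \<tau>:\<Omega>|lebesgue. \<phi> \<tau> *\<^sub>R (\<eta> \<tau> + \<eta>' \<tau>))
         = (LINT \<tau>:\<Omega>|lebesgue. \<phi> \<tau> *\<^sub>R \<eta> \<tau>) + (LINT \<tau>:\<Omega>|lebesgue. \<phi> \<tau> *\<^sub>R \<eta>' \<tau>)"
        unfolding scaleR_add_right using m by (intro set_integral_add(2) I) auto
      then show ?thesis by simp
    qed
    finally show "(LINT \<tau>:\<Omega>|lebesgue. deriv \<phi> \<tau> *\<^sub>R (\<xi> \<tau> + \<xi>' \<tau>)) = - (LINT \<tau>:\<Omega>|lebesgue. \<phi> \<tau> *\<^sub>R (\<eta> \<tau> + \<eta>' \<tau>))" .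
  qed
  moreover have "\<exists>\<zeta>. (AE \<tau> in lebesgue. \<tau> \<in> \<Omega> \<longrightarrow> \<zeta> \<tau> = \<xi> \<tau> + \<xi>' \<tau>) \<and> (\<forall>\<tau>\<in>\<Omega>. \<zeta> \<tau> \<in> DB) \<and>
      continuous_on \<Omega> (\<lambda>\<tau>. B (\<zeta> \<tau>)) \<and> ((\<lambda>\<tau>. B (\<zeta> \<tau>)) \<longlongrightarrow> 0) (to_ell ell)"
  proof -
    obtain \<zeta>1 where a: "AE \<tau> in lebesgue. \<tau> \<in> \<Omega> \<longrightarrow> \<zeta>1 \<tau> = \<xi> \<tau>" "\<And>\<tau>. \<tau>\<in>\<Omega> \<Longrightarrow> \<zeta>1 \<tau> \<in> DB"
      "continuous_on \<Omega> (\<lambda>\<tau>. B (\<zeta>1 \<tau>))" "((\<lambda>\<tau>. B (\<zeta>1 \<tau>)) \<longlongrightarrow> 0) (to_ell ell)"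
      using 1 unfolding P_rel_def by blast
    obtain \<zeta>2 where b: "AE \<tau> in lebesgue. \<tau> \<in> \<Omega> \<longrightarrow> \<zeta>2 \<tau> = \<xi>' \<tau>" "\<And>\<tau>. \<tau>\<in>\<Omega> \<Longrightarrow> \<zeta>2 \<tau> \<in> DB"
      "continuous_on \<Omega> (\<lambda>\<tau>. B (\<zeta>2 \<tau>))" "((\<lambda>\<tau>. B (\<zeta>2 \<tau>)) \<longlongrightarrow> 0) (to_ell ell)"
      using 2 unfolding P_rel_def by blast
    have Badd: "B (\<zeta>1 \<tau> + \<zeta>2 \<tau>) = B (\<zeta>1 \<tau>) + B (\<zeta>2 \<tau>)" if "\<tau> \<in> \<Omega>" for \<tau>
      using a(2)[OF that] b(2)[OF that] by (rule B_add)
    show ?thesis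
    proof (intro exI[of _ "\<lambda>\<tau>. \<zeta>1 \<tau> + \<zeta>2 \<tau>"] conjI ballI)
      show "AE \<tau> in lebesgue. \<tau> \<in> \<Omega> \<longrightarrow> \<zeta>1 \<tau> + \<zeta>2 \<tau> = \<xi> \<tau> + \<xi>' \<tau>"
        using a(1) b(1) by eventually_elim simp
      show "\<zeta>1 \<tau> + \<zeta>2 \<tau> \<in> DB" if "\<tau> \<in> \<Omega>" for \<tau>
        using a(2)[OF that] b(2)[OF that] subspace_DB by (simp add: subspace_add)
      show "continuous_on \<Omega> (\<lambda>\<tau>. B (\<zeta>1 \<tau> + \<zeta>2 \<tau>))"
        using continuous_on_add[OF a(3) b(3)] Badd by (simp cong: continuous_on_cong)
      have ev: "eventually (\<lambda>\<tau>. \<tau> \<in> \<Omega>) (to_ell ell)"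
      proof -
        obtain x where "x \<in> \<Omega>" using Omega_nonempty by blast
        from to_ell_eventually[OF this] show ?thesis by eventually_elim simp
      qed
      have "((\<lambda>\<tau>. B (\<zeta>1 \<tau>) + B (\<zeta>2 \<tau>)) \<longlongrightarrow> 0) (to_ell ell)"
        using tendsto_add[OF a(4) b(4)] by simp
      then show "((\<lambda>\<tau>. B (\<zeta>1 \<tau> + \<zeta>2 \<tau>)) \<longlongrightarrow> 0) (to_ell ell)"
        by (rule Lim_transform_eventually) (use ev in \<open>eventually_elim, simp add: Badd\<close>)
    qed
  qed
  ultimately show ?thesis by (simp add: P_rel_def mem_def)
qed

lemma approximable_add:
  assumes f: "approximable f" and g: "approximable g"
  shows "approximable (\<lambda>\<tau>. f \<tau> + g \<tau>)"
  unfolding approximable_def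
proof (intro conjI allI impI)
  have sf: "square_integrable M\<nu> f" and sg: "square_integrable M\<nu> g" using f g by (auto simp: approximable_def)
  show s: "square_integrable M\<nu> (\<lambda>\<tau>. f \<tau> + g \<tau>)"
    using square_integrable_lin[OF sf sg, of 1 1] by simp
  fix e :: real assume e: "e > 0"
  obtain \<xi> \<eta> where 1: "P_rel ell \<mu> DB B \<xi> \<eta>" "L2_norm M\<nu> (\<lambda>\<tau>. f \<tau> - B (\<xi> \<tau>)) < e / 2"
    using f e unfolding approximable_def by (meson half_gt_zero)
  obtain \<xi>' \<eta>' where 2: "P_rel ell \<mu> DB B \<xi>' \<eta>'" "L2_norm M\<nu> (\<lambda>\<tau>. g \<tau> - B (\<xi>' \<tau>)) < e / 2"
    using g e unfolding approximable_def by (meson half_gt_zero)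
  note m = P_rel_mem[OF 1(1)] P_rel_mem[OF 2(1)]
  have sB: "square_integrable M\<nu> (\<lambda>\<tau>. B (\<xi> \<tau>))" "square_integrable M\<nu> (\<lambda>\<tau>. B (\<xi>' \<tau>))"
    using m by (auto simp: mem_iff)
  have s1: "square_integrable M\<nu> (\<lambda>\<tau>. g \<tau> + B (\<xi> \<tau>))" "square_integrable M\<nu> (\<lambda>\<tau>. B (\<xi> \<tau>) + B (\<xi>' \<tau>))"
    using square_integrable_lin[OF sg sB(1), of 1 1] square_integrable_lin[OF sB, of 1 1] by simp_all
  have "L2_norm M\<nu> (\<lambda>\<tau>. (f \<tau> + g \<tau>) - (B (\<xi> \<tau>) + B (\<xi>' \<tau>))) < e"
    using L2_norm_triangle[OF s s1] 1(2) 2(2) by (simp add: algebra_simps)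
  moreover have "L2_norm M\<nu> (\<lambda>\<tau>. (f \<tau> + g \<tau>) - (B (\<xi> \<tau>) + B (\<xi>' \<tau>))) = L2_norm M\<nu> (\<lambda>\<tau>. (f \<tau> + g \<tau>) - B (\<xi> \<tau> + \<xi>' \<tau>))"
  proof (rule L2_norm_Mnu_AE_cong[OF square_integrable_diff[OF s s1(2)]])
    show "AE \<tau> in M\<nu>. f \<tau> + g \<tau> - (B (\<xi> \<tau>) + B (\<xi>' \<tau>)) = f \<tau> + g \<tau> - B (\<xi> \<tau> + \<xi>' \<tau>)"
      using mem_AE_B_lin[of \<xi> \<xi>' 1 1] m by (auto elim: eventually_mono)
  qed
  ultimately show "\<exists>\<xi> \<eta>. P_rel ell \<mu> DB B \<xi> \<eta> \<and> L2_norm M\<nu> (\<lambda>\<tau>. (f \<tau> + g \<tau>) - B (\<xi> \<tau>)) < e"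
    using P_rel_add[OF 1(1) 2(1)] by (intro exI conjI) auto
qed

lemma approximable_limit:
  assumes f: "square_integrable M\<nu> f" and lim: "\<And>e. e > 0 \<Longrightarrow> \<exists>g. approximable g \<and> L2_norm M\<nu> (\<lambda>\<tau>. f \<tau> - g \<tau>) < e"
  shows "approximable f"
  unfolding approximable_def
proof (intro conjI allI impI f)
  fix e :: real assume e: "e > 0"
  obtain g where g: "approximable g" "L2_norm M\<nu> (\<lambda>\<tau>. f \<tau> - g \<tau>) < e / 2" using lim[of "e / 2"] e by auto
  obtain \<xi> \<eta> where 1: "P_rel ell \<mu> DB B \<xi> \<eta>" "L2_norm M\<nu> (\<lambda>\<tau>. g \<tau> - B (\<xi> \<tau>)) < e / 2"
    using g(1) e unfolding approximable_def by (meson half_gt_zero)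
  have "L2_norm M\<nu> (\<lambda>\<tau>. f \<tau> - B (\<xi> \<tau>)) < e"
    using L2_norm_triangle[OF f, of g "\<lambda>\<tau>. B (\<xi> \<tau>)"] g 1 P_rel_mem[OF 1(1)] by (auto simp: approximable_def mem_iff)
  then show "\<exists>\<xi> \<eta>. P_rel ell \<mu> DB B \<xi> \<eta> \<and> L2_norm M\<nu> (\<lambda>\<tau>. f \<tau> - B (\<xi> \<tau>)) < e" using 1 by blast
qed

text \<open>Dominated convergence for the squared errors.\<close>

lemma approximable_limit_sequence:
  assumes f: "square_integrable M\<nu> f" and g: "\<And>i::nat. approximable (g i)"
    and w: "integrable M\<nu> w" and dom: "\<And>i x. x \<in> \<Omega> \<Longrightarrow> (norm (f x - g i x))\<^sup>2 \<le> w x"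
    and lim: "AE x in M\<nu>. (\<lambda>i. g i x) \<longlonglongrightarrow> f x"
  shows "approximable f"
proof (rule approximable_limit[OF f])
  fix e :: real assume e: "e > 0"
  have sq: "square_integrable M\<nu> (\<lambda>x. f x - g i x)" for i
    using g[of i] f by (auto simp: approximable_def intro: square_integrable_diff)
  have "(\<lambda>i. \<integral>x. (norm (f x - g i x))\<^sup>2 \<partial>M\<nu>) \<longlonglongrightarrow> (\<integral>x. 0 \<partial>M\<nu>)"
  proof (rule integral_dominated_convergence[OF _ _ w])
    show "(\<lambda>x. (norm (f x - g i x))\<^sup>2) \<in> borel_measurable M\<nu>" for i
      using sq[of i] unfolding square_integrable_def by (auto dest: borel_measurable_integrable)
    show "AE x in M\<nu>. (\<lambda>i. (norm (f x - g i x))\<^sup>2) \<longlonglongrightarrow> 0"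
      using lim
    proof eventually_elim
      case (elim x)
      have "(\<lambda>i. (norm (f x - g i x))\<^sup>2) \<longlonglongrightarrow> (norm (f x - f x))\<^sup>2" by (intro tendsto_intros elim)
      then show ?case by simp
    qed
    show "AE x in M\<nu>. norm ((norm (f x - g i x))\<^sup>2) \<le> w x" for i using dom by (intro AE_I2) simp
  qed simp
  then have "(\<lambda>i. L2_norm M\<nu> (\<lambda>x. f x - g i x)) \<longlonglongrightarrow> sqrt 0"
    unfolding L2_norm_def by (intro tendsto_real_sqrt) simp
  then have "eventually (\<lambda>i. L2_norm M\<nu> (\<lambda>x. f x - g i x) < e) sequentially"
    using e by (intro order_tendstoD(2)) auto
  then show "\<exists>g. approximable g \<and> L2_norm M\<nu> (\<lambda>\<tau>. f \<tau> - g \<tau>) < e"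
    using g eventually_happens by fastforce
qed

text \<open>Only C^1 regularity is assumed, since a plateau is later multiplied by a polynomial.
  Integration by parts on [a, b] has no boundary terms, and the limit at ell is trivial past
  b.\<close>

lemma P_rel_C1:
  assumes a: "a \<in> \<Omega>" and b: "b \<in> \<Omega>" and ab: "a \<le> b"
    and der: "\<And>x. (\<phi> has_real_derivative \<phi>' x) (at x)" and c': "continuous_on UNIV \<phi>'"
    and z: "\<And>x. x \<le> a \<or> b \<le> x \<Longrightarrow> \<phi> x = 0" and w: "w \<in> DB"
  shows "P_rel ell \<mu> DB B (\<lambda>\<tau>. \<phi> \<tau> *\<^sub>R w) (\<lambda>\<tau>. \<phi>' \<tau> *\<^sub>R w)"
proof -
  have sub: "{a..b} \<subseteq> \<Omega>" by (rule Icc_subset_Omega[OF a b])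
  have c: "continuous_on UNIV \<phi>" using der DERIV_isCont by (meson continuous_at_imp_continuous_on)
  have zz: "\<phi> x = 0" if "x \<notin> {a..b}" for x using z[of x] that by auto
  have z': "\<phi>' x = 0" if "x \<notin> {a..b}" for x
  proof -
    have "(\<phi> has_real_derivative 0) (at x)"
    proof (rule has_field_derivative_transform_within_open[OF DERIV_const[of 0]])
      show "open (- {a..b})" by (intro open_Compl) simp
    qed (use that z in auto)
    then show ?thesis using der DERIV_unique by blast
  qed
  have mm: "mem (\<lambda>\<tau>. f \<tau> *\<^sub>R w)" if f: "continuous_on UNIV f" "\<And>x. x \<notin> {a..b} \<Longrightarrow> f x = 0" for f :: "real \<Rightarrow> real"
  proof -
    obtain C where C: "\<forall>x\<in>{a..b}. \<bar>f x\<bar> \<le> C"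
      using compact_imp_bounded[OF compact_continuous_image[OF continuous_on_subset[OF f(1)], of "{a..b}"]]
      by (auto simp: bounded_iff)
    have "square_integrable M\<nu> (\<lambda>\<tau>. f \<tau> *\<^sub>R B w)"
    proof (rule square_integrable_compact_support[OF a b])
      show "f \<in> borel_measurable lebesgue"
        using f(1) by (intro measurable_completion) (simp add: borel_measurable_continuous_onI)
      show "\<bar>f x\<bar> \<le> C * indicator {a..b} x" for x using C f(2)[of x] by (auto simp: indicator_def)
    qed
    then show ?thesis using w subspace_DB by (simp add: mem_iff B_scale subspace_scale)
  qed
  have "distr_deriv \<Omega> (\<lambda>\<tau>. \<phi> \<tau> *\<^sub>R w) (\<lambda>\<tau>. \<phi>' \<tau> *\<^sub>R w)"
    unfolding distr_deriv_def
  proof (intro allI impI)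
    fix \<psi> assume t: "test_fun \<Omega> \<psi>"
    have sm: "smooth_fun \<psi>" using t by (simp add: test_fun_def smooth_fun_def)
    obtain C where C: "continuous_on UNIV \<psi>" "continuous_on UNIV (deriv \<psi>)"
      by (rule test_fun_bounded_continuous[OF t]) (rule that)
    have d\<psi>: "(\<psi> has_real_derivative deriv \<psi> x) (at x)" for x using smooth_fun_DERIV[OF sm, of 0 x] by simp
    have cut: "(LINT \<tau>:\<Omega>|lebesgue. (f \<tau> * h \<tau>) *\<^sub>R w) = integral {a..b} (\<lambda>\<tau>. f \<tau> * h \<tau>) *\<^sub>R w"
      if "continuous_on UNIV f" "continuous_on UNIV h" "\<And>x. x \<notin> {a..b} \<Longrightarrow> h x = 0" for f h :: "real \<Rightarrow> real"
    proof -
      have si: "set_integrable lebesgue {a..b} (\<lambda>\<tau>. f \<tau> * h \<tau>)"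
        using that by (intro set_integrable_lebesgue_continuous continuous_on_mult) (auto intro: continuous_on_subset)
      have "(LINT \<tau>:\<Omega>|lebesgue. (f \<tau> * h \<tau>) *\<^sub>R w) = (\<integral>\<tau>. (indicator {a..b} \<tau> *\<^sub>R (f \<tau> * h \<tau>)) *\<^sub>R w \<partial>lebesgue)"
        unfolding set_lebesgue_integral_def
      proof (rule Bochner_Integration.integral_cong[OF refl])
        fix x show "indicat_real \<Omega> x *\<^sub>R (f x * h x) *\<^sub>R w = (indicat_real {a..b} x *\<^sub>R (f x * h x)) *\<^sub>R w"
          using that(3)[of x] sub by (cases "x \<in> {a..b}") auto
      qed
      also have "\<dots> = (LINT \<tau>:{a..b}|lebesgue. f \<tau> * h \<tau>) *\<^sub>R w"
        using si unfolding set_lebesgue_integral_def set_integrable_def by (intro integral_scaleR_left)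
      also have "(LINT \<tau>:{a..b}|lebesgue. f \<tau> * h \<tau>) = integral {a..b} (\<lambda>\<tau>. f \<tau> * h \<tau>)"
        by (rule set_lebesgue_integral_eq_integral(2)[OF si])
      finally show ?thesis .
    qed
    have ftc: "((\<lambda>x. deriv \<psi> x * \<phi> x + \<psi> x * \<phi>' x) has_integral (\<psi> b * \<phi> b - \<psi> a * \<phi> a)) {a..b}"
    proof (rule fundamental_theorem_of_calculus[OF ab])
      fix x
      have "((\<lambda>x. \<psi> x * \<phi> x) has_real_derivative deriv \<psi> x * \<phi> x + \<psi> x * \<phi>' x) (at x)"
        using DERIV_mult[OF d\<psi>[of x] der[of x]] by (simp add: mult_ac)
      then show "((\<lambda>x. \<psi> x * \<phi> x) has_vector_derivative deriv \<psi> x * \<phi> x + \<psi> x * \<phi>' x) (at x within {a..b})"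
        unfolding has_real_derivative_iff_has_vector_derivative by (rule has_vector_derivative_at_within)
    qed
    have i: "(\<lambda>x. deriv \<psi> x * \<phi> x) integrable_on {a..b}" "(\<lambda>x. \<psi> x * \<phi>' x) integrable_on {a..b}"
      by (intro integrable_continuous_interval continuous_on_mult continuous_on_subset[OF C(1)] continuous_on_subset[OF C(2)]
        continuous_on_subset[OF c] continuous_on_subset[OF c'] subset_UNIV)+
    have "integral {a..b} (\<lambda>x. deriv \<psi> x * \<phi> x) + integral {a..b} (\<lambda>x. \<psi> x * \<phi>' x) = 0"
      using integral_unique[OF ftc] z[of a] z[of b] unfolding Henstock_Kurzweil_Integration.integral_add[OF i] by simp
    then have "integral {a..b} (\<lambda>x. deriv \<psi> x * \<phi> x) = - integral {a..b} (\<lambda>x. \<psi> x * \<phi>' x)" by simp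
    then show "(LINT \<tau>:\<Omega>|lebesgue. deriv \<psi> \<tau> *\<^sub>R \<phi> \<tau> *\<^sub>R w) = - (LINT \<tau>:\<Omega>|lebesgue. \<psi> \<tau> *\<^sub>R \<phi>' \<tau> *\<^sub>R w)"
      using cut[OF C(2) c zz] cut[OF C(1) c' z'] by simp
  qed
  moreover have "((\<lambda>\<tau>. B (\<phi> \<tau> *\<^sub>R w)) \<longlongrightarrow> 0) (to_ell ell)"
    by (rule tendsto_eventually, rule eventually_mono[OF to_ell_eventually[OF b]]) (use z in auto)
  moreover have "continuous_on \<Omega> (\<lambda>\<tau>. B (\<phi> \<tau> *\<^sub>R w))"
    using w continuous_on_subset[OF c] by (auto simp: B_scale intro!: continuous_intros)
  ultimately show ?thesis
    using mm[OF c zz] mm[OF c' z'] w subspace_DB unfolding P_rel_def mem_def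
    by (auto simp: subspace_scale intro!: exI[of _ "\<lambda>\<tau>. \<phi> \<tau> *\<^sub>R w"])
qed

text \<open>By Weierstrass, \<open>h\<close> is uniformly close on the support to a polynomial, and
  the plateau times a polynomial is C^1. Using \<open>G c\<close> as direction stays in
  \<open>DB\<close> and reproduces \<open>c\<close> exactly under \<open>B\<close>.\<close>

lemma approximable_plateau_continuous:
  fixes c :: 'h and h :: "real \<Rightarrow> real"
  assumes n: "n > 0" and ab: "a \<le> b" and a: "a \<in> \<Omega>" and b: "b + 1 / n \<in> \<Omega>" and h: "continuous_on UNIV h"
  shows "approximable (\<lambda>x. (plateau n a b x * h x) *\<^sub>R c)"
proof -
  let ?J = "{a..b + 1 / n}"
  let ?p = "plateau n a b"
  have pI: "\<bar>?p x\<bar> \<le> indicator ?J x" for x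
    using plateau_bounds[OF n ab, of x] plateau_eq_0[OF n ab, of x] by (auto simp: indicator_def)
  have meas: "f \<in> borel_measurable lebesgue" if "continuous_on UNIV f" for f :: "real \<Rightarrow> real"
    using that by (intro measurable_completion) (simp add: borel_measurable_continuous_onI)
  have sq: "square_integrable M\<nu> (\<lambda>x. (?p x * q x) *\<^sub>R c)" if q: "continuous_on UNIV q" for q and c :: 'h
  proof -
    obtain C where C: "\<forall>x\<in>?J. \<bar>q x\<bar> \<le> C"
      using compact_imp_bounded[OF compact_continuous_image[OF continuous_on_subset[OF q], of ?J]]
      by (auto simp: bounded_iff)
    show ?thesis
    proof (rule square_integrable_compact_support[OF a b, where \<phi> = "\<lambda>x. ?p x * q x" and C = C])
      show "(\<lambda>x. ?p x * q x) \<in> borel_measurable lebesgue"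
        by (intro meas continuous_on_mult continuous_plateau q)
      show "\<bar>?p x * q x\<bar> \<le> C * indicator ?J x" for x
        using pI[of x] C by (cases "x \<in> ?J") (auto simp: abs_mult intro: order_trans[OF mult_mono[of _ 1 _ C]])
    qed
  qed
  define g where "g = (\<lambda>x. (indicator ?J x :: real) *\<^sub>R c)"
  have sg: "square_integrable M\<nu> g"
    unfolding g_def by (rule square_integrable_compact_support[OF a b, of _ 1]) (auto intro!: borel_measurable_indicator)
  show ?thesis
    unfolding approximable_def
  proof (intro conjI allI impI sq h)
    fix e :: real assume e: "e > 0"
    define \<epsilon> where "\<epsilon> = e / (L2_norm M\<nu> g + 1)"
    have \<epsilon>: "\<epsilon> > 0" using e L2_norm_nonneg[of M\<nu> g] unfolding \<epsilon>_def by (intro divide_pos_pos) linarith+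
    obtain q where q: "real_polynomial_function q" "\<And>x. x \<in> ?J \<Longrightarrow> \<bar>h x - q x\<bar> < \<epsilon>"
      using Stone_Weierstrass_real_polynomial_function[of ?J h \<epsilon>] \<epsilon> continuous_on_subset[OF h] by auto
    obtain q' where q': "real_polynomial_function q'" "\<And>x. (q has_real_derivative q' x) (at x)"
      using has_real_derivative_polynomial_function[OF q(1)] by blast
    have qc: "continuous_on UNIV q" "continuous_on UNIV q'"
      using q(1) q'(1) by (auto intro!: continuous_on_polymonial_function simp: real_polynomial_function_eq)
    have "P_rel ell \<mu> DB B (\<lambda>\<tau>. (?p \<tau> * q \<tau>) *\<^sub>R G c) (\<lambda>\<tau>. (deriv ?p \<tau> * q \<tau> + ?p \<tau> * q' \<tau>) *\<^sub>R G c)"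
    proof (rule P_rel_C1[OF a b])
      show "((\<lambda>\<tau>. ?p \<tau> * q \<tau>) has_real_derivative deriv ?p x * q x + ?p x * q' x) (at x)" for x
        using DERIV_mult[OF plateau_DERIV q'(2), of n a b x] by (simp add: deriv_plateau mult_ac)
      show "continuous_on UNIV (\<lambda>x. deriv ?p x * q x + ?p x * q' x)"
        unfolding deriv_plateau
        by (intro continuous_intros continuous_deriv_smooth_step continuous_plateau qc)
      show "?p x * q x = 0" if "x \<le> a \<or> b + 1 / n \<le> x" for x
        using plateau_eq_0[OF n ab that] by simp
      have "0 < 1 / n" using n by simp
      then show "a \<le> b + 1 / n" using ab by linarith
    qed simp
    moreover have "L2_norm M\<nu> (\<lambda>\<tau>. (?p \<tau> * h \<tau>) *\<^sub>R c - B ((?p \<tau> * q \<tau>) *\<^sub>R G c)) < e"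
    proof -
      have "L2_norm M\<nu> (\<lambda>\<tau>. (?p \<tau> * h \<tau>) *\<^sub>R c - (?p \<tau> * q \<tau>) *\<^sub>R c) \<le> \<epsilon> * L2_norm M\<nu> g"
      proof (rule L2_norm_scaled_bound[OF sg])
        show "(\<lambda>\<tau>. (?p \<tau> * h \<tau>) *\<^sub>R c - (?p \<tau> * q \<tau>) *\<^sub>R c) \<in> borel_measurable M\<nu>"
          using square_integrable_diff[OF sq[OF h] sq[OF qc(1)]] by (simp add: square_integrable_def)
        fix x
        have "\<bar>?p x * (h x - q x)\<bar> \<le> \<epsilon> * indicator ?J x"
          using pI[of x] q(2)[of x] by (cases "x \<in> ?J") (auto simp: abs_mult intro: order_trans[OF mult_mono[of _ 1 _ \<epsilon>]])
        then have "\<bar>?p x * (h x - q x)\<bar> * norm c \<le> \<epsilon> * indicator ?J x * norm c" by (rule mult_right_mono) simp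
        then show "norm ((?p x * h x) *\<^sub>R c - (?p x * q x) *\<^sub>R c) \<le> \<epsilon> * norm (g x)"
          by (simp add: g_def right_diff_distrib flip: scaleR_diff_left)
      qed (use \<epsilon> in simp)
      also have "\<dots> < \<epsilon> * (L2_norm M\<nu> g + 1)" using \<epsilon> by simp
      also have "\<dots> = e" using L2_norm_nonneg[of M\<nu> g] by (simp add: \<epsilon>_def add_nonneg_eq_0_iff)
      finally show ?thesis by (simp add: B_scale)
    qed
    ultimately show "\<exists>\<xi> \<eta>. P_rel ell \<mu> DB B \<xi> \<eta> \<and> L2_norm M\<nu> (\<lambda>\<tau>. (?p \<tau> * h \<tau>) *\<^sub>R c - B (\<xi> \<tau>)) < e"
      by (intro exI conjI)
  qed
qed

text \<open>A measurable indicator is almost everywhere a limit of continuous functions; multiplying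
  these by a plateau that equals 1 on [a, b] gives compact support without changing the
  limit.\<close>

lemma approximable_indicator:
  fixes c :: 'h
  assumes a: "a \<in> \<Omega>" and b: "b \<in> \<Omega>" and ab: "a \<le> b" and T: "T \<in> sets lebesgue" "T \<subseteq> {a..b}"
  shows "approximable (\<lambda>x. indicator T x *\<^sub>R c)"
proof -
  obtain a' where a': "a' < a" "a' \<in> \<Omega>" by (rule Omega_left_neighbourhood[OF a])
  obtain b' where b': "b < b'" "b' \<in> \<Omega>" using Omega_right_neighbourhood[OF b] by metis
  \<comment> \<open>Large enough for the left ramp to fit between \<open>a'\<close> and
    \<open>a\<close> and the right ramp between \<open>b\<close> and \<open>b'\<close>.\<close>
  define n where "n = max (1 / (a - a')) (1 / (b' - b))"
  have n: "n > 0" "a' + 1 / n \<le> a" "b + 1 / n \<le> b'"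
  proof -
    have 1: "1 / (a - a') > 0" using a' by simp
    then show n0: "n > 0" unfolding n_def by linarith
    have "1 / (a - a') \<le> n" "1 / (b' - b) \<le> n" unfolding n_def by linarith+
    then show "a' + 1 / n \<le> a" "b + 1 / n \<le> b'" using n0 a' b' by (auto simp: field_simps)
  qed
  have bn: "b + 1 / n \<in> \<Omega>"
    using Icc_subset_Omega[OF b b'(2)] n by (auto simp: subset_eq)
  let ?p = "plateau n a' b" and ?J = "{a'..b + 1 / n}"
  have ab': "a' \<le> b" using a' ab by simp
  have "indicat_real T measurable_on UNIV"
    using T(1) by (intro lebesgue_measurable_imp_measurable_on) auto
  then obtain N h where N: "negligible N" and hc: "\<And>i::nat. continuous_on UNIV (h i)"
    and hl: "\<And>x. x \<notin> N \<Longrightarrow> (\<lambda>i. h i x) \<longlonglongrightarrow> indicat_real T x"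
    unfolding measurable_on_def by auto
  \<comment> \<open>Truncation to [0, 1] leaves the limit unchanged and bounds every error by the
    indicator of \<open>?J\<close>.\<close>
  define k where "k = (\<lambda>i x. max 0 (min 1 (h i x)))"
  have kc: "continuous_on UNIV (k i)" for i unfolding k_def by (intro continuous_intros hc)
  have kb: "0 \<le> k i x" "k i x \<le> 1" for i x by (auto simp: k_def)
  have kl: "(\<lambda>i. k i x) \<longlonglongrightarrow> indicat_real T x" if "x \<notin> N" for x
  proof -
    have "(\<lambda>i. k i x) \<longlonglongrightarrow> max 0 (min 1 (indicat_real T x))" unfolding k_def by (intro tendsto_intros hl that)
    then show ?thesis by (simp add: indicator_def split: if_splits)
  qed
  have sJ: "square_integrable M\<nu> (\<lambda>x. indicat_real ?J x *\<^sub>R c)"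
    by (rule square_integrable_compact_support[OF a'(2) bn, of _ 1]) (auto intro!: borel_measurable_indicator)
  show ?thesis
  proof (rule approximable_limit_sequence[where g = "\<lambda>i x. (?p x * k i x) *\<^sub>R c" and w = "\<lambda>x. (norm (indicat_real ?J x *\<^sub>R c))\<^sup>2"])
    show "square_integrable M\<nu> (\<lambda>x. indicat_real T x *\<^sub>R c)"
      by (rule square_integrable_compact_support[OF a b, of _ 1]) (use T in \<open>auto simp: indicator_def\<close>)
    show "approximable (\<lambda>x. (?p x * k i x) *\<^sub>R c)" for i
      by (rule approximable_plateau_continuous[OF n(1) ab' a'(2) bn kc])
    show "integrable M\<nu> (\<lambda>x. (norm (indicat_real ?J x *\<^sub>R c))\<^sup>2)"
      using sJ by (simp add: square_integrable_def)
    fix i x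
    have "\<bar>indicat_real T x - ?p x * k i x\<bar> \<le> indicat_real ?J x"
    proof (cases "x \<in> ?J")
      case True
      have "0 \<le> ?p x * k i x" "?p x * k i x \<le> 1"
        using plateau_bounds[OF n(1) ab', of x] kb[of i x] by (auto intro: mult_le_one)
      then show ?thesis using True by (auto simp: indicator_def)
    next
      case False
      have "x \<notin> T"
      proof
        assume "x \<in> T"
        then have "a \<le> x" "x \<le> b" using T(2) by auto
        moreover have "0 < 1 / n" using n by simp
        moreover have "\<not> (a' \<le> x \<and> x \<le> b + 1 / n)" using False by simp
        ultimately show False using a' by linarith
      qed
      then show ?thesis using False plateau_eq_0[OF n(1) ab', of x] by auto
    qed
    then have "\<bar>indicat_real T x - ?p x * k i x\<bar> * norm c \<le> indicat_real ?J x * norm c" by (rule mult_right_mono) simp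
    then have "norm (indicat_real T x *\<^sub>R c - (?p x * k i x) *\<^sub>R c) \<le> norm (indicat_real ?J x *\<^sub>R c)"
      by (simp flip: scaleR_diff_left)
    then show "(norm (indicat_real T x *\<^sub>R c - (?p x * k i x) *\<^sub>R c))\<^sup>2 \<le> (norm (indicat_real ?J x *\<^sub>R c))\<^sup>2"
      by (rule power_mono) simp
  next
    have "AE x in lebesgue. x \<notin> N" using N by (auto simp: negligible_iff_null_sets intro: AE_not_in)
    then have "AE x in M\<nu>. x \<notin> N" unfolding AE_Mnu_iff by eventually_elim simp
    then show "AE x in M\<nu>. (\<lambda>i. (?p x * k i x) *\<^sub>R c) \<longlonglongrightarrow> indicat_real T x *\<^sub>R c"
    proof eventually_elim
      case (elim x)
      have "(\<lambda>i. (?p x * k i x) *\<^sub>R c) \<longlonglongrightarrow> (?p x * indicat_real T x) *\<^sub>R c" by (intro tendsto_intros kl elim)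
      moreover have "?p x * indicat_real T x = indicat_real T x"
        using T(2) n plateau_eq_1[OF n(1), of a' x b] by (auto simp: indicator_def subset_eq)
      ultimately show ?case by simp
    qed
  qed
qed

lemma approximable_zero: "approximable (\<lambda>_. 0)"
proof -
  obtain x where "x \<in> \<Omega>" using Omega_nonempty by blast
  from approximable_indicator[OF this this, of "{}" 0] show ?thesis by simp
qed

lemma approximable_sum: "finite I \<Longrightarrow> (\<And>i. i \<in> I \<Longrightarrow> approximable (f i)) \<Longrightarrow> approximable (\<lambda>x. \<Sum>i\<in>I. f i x)"
  by (induction I rule: finite_induct) (auto intro: approximable_zero approximable_add)

text \<open>A simple function cut off to [l i, u i] is a finite combination of indicators of sets
  inside a compact subinterval of \<open>\<Omega>\<close>.\<close>

lemma square_integrable_approximable: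
  assumes f: "square_integrable M\<nu> f"
  shows "approximable f"
proof -
  obtain l u where ul: "\<And>i. l i \<in> \<Omega>" "\<And>i. u i \<in> \<Omega>" "\<And>i. l i < u i" "incseq u" "decseq l"
    "\<Omega> = (\<Union>i. {l i..u i})" "\<And>x. x \<in> \<Omega> \<Longrightarrow> eventually (\<lambda>i. x < u i) sequentially"
    by (rule Omega_exhaustion) (rule that)
  let ?f = "\<lambda>x. indicator \<Omega> x *\<^sub>R f x"
  have "?f \<in> borel_measurable lebesgue"
    using f by (simp add: square_integrable_Mnu_iff set_borel_measurable_def)
  from borel_measurable_implies_sequence_metric[OF this, of 0] obtain F where
    F: "\<And>i. simple_function lebesgue (F i)" "\<And>x. (\<lambda>i. F i x) \<longlonglongrightarrow> ?f x" "\<And>i x. norm (F i x) \<le> 2 * norm (?f x)"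
    by (auto simp: dist_norm)
  show ?thesis
  \<comment> \<open>The simple functions satisfy |F i| \<le> 2 |f|, so the error is at most 3 |f|
    and its square at most 9 |f|^2.\<close>
  proof (rule approximable_limit_sequence[OF f, where g = "\<lambda>i x. indicator {l i..u i} x *\<^sub>R F i x" and w = "\<lambda>x. 9 * (norm (f x))\<^sup>2"])
    fix i
    let ?R = "range (F i)"
    have fin: "finite ?R" using F(1)[of i] by (simp add: simple_function_def)
    have "(\<lambda>x. indicator {l i..u i} x *\<^sub>R F i x) = (\<lambda>x. \<Sum>c\<in>?R. indicator (F i -` {c} \<inter> {l i..u i}) x *\<^sub>R c)"
    proof
      fix x
      have "(\<Sum>c\<in>?R. indicat_real (F i -` {c} \<inter> {l i..u i}) x *\<^sub>R c) = (\<Sum>c\<in>?R. if c = F i x then indicat_real {l i..u i} x *\<^sub>R c else 0)"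
        by (intro sum.cong) (auto simp: indicator_def)
      then show "indicator {l i..u i} x *\<^sub>R F i x = (\<Sum>c\<in>?R. indicator (F i -` {c} \<inter> {l i..u i}) x *\<^sub>R c)"
        using fin by (simp add: sum.delta')
    qed
    moreover have "approximable (\<lambda>x. \<Sum>c\<in>?R. indicator (F i -` {c} \<inter> {l i..u i}) x *\<^sub>R c)"
    proof (rule approximable_sum[OF fin])
      fix c
      have "F i -` {c} \<in> sets lebesgue" using simple_functionD(2)[OF F(1)[of i], of "{c}"] by simp
      then have "F i -` {c} \<inter> {l i..u i} \<in> sets lebesgue" by (intro sets.Int) auto
      then show "approximable (\<lambda>x. indicator (F i -` {c} \<inter> {l i..u i}) x *\<^sub>R c)"
        using ul(3)[of i] by (intro approximable_indicator[OF ul(1)[of i] ul(2)[of i]]) auto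
    qed
    ultimately show "approximable (\<lambda>x. indicator {l i..u i} x *\<^sub>R F i x)" by simp
  next
    show "integrable M\<nu> (\<lambda>x. 9 * (norm (f x))\<^sup>2)" using f by (simp add: square_integrable_def)
    fix i x assume x: "x \<in> \<Omega>"
    have "norm (f x - indicator {l i..u i} x *\<^sub>R F i x) \<le> norm (f x) + norm (indicator {l i..u i} x *\<^sub>R F i x)"
      by (rule norm_triangle_ineq4)
    also have "norm (indicator {l i..u i} x *\<^sub>R F i x) \<le> 2 * norm (f x)"
      using F(3)[of i x] x by (auto simp: indicator_def)
    finally have "norm (f x - indicator {l i..u i} x *\<^sub>R F i x) \<le> 3 * norm (f x)" by simp
    from power_mono[OF this, of 2] show "(norm (f x - indicator {l i..u i} x *\<^sub>R F i x))\<^sup>2 \<le> 9 * (norm (f x))\<^sup>2"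
      by (simp add: power_mult_distrib)
  next
    show "AE x in M\<nu>. (\<lambda>i. indicator {l i..u i} x *\<^sub>R F i x) \<longlonglongrightarrow> f x"
    proof (rule AE_I2)
      fix x assume "x \<in> space M\<nu>"
      then have x: "x \<in> \<Omega>" by simp
      then obtain j where j: "x \<in> {l j..u j}" using ul(6) by auto
      have "eventually (\<lambda>i. F i x = indicator {l i..u i} x *\<^sub>R F i x) sequentially"
      proof (rule eventually_sequentiallyI[of j])
        fix i assume "j \<le> i"
        then have "l i \<le> l j" "u j \<le> u i" using ul(4,5) by (auto simp: incseq_def decseq_def)
        then show "F i x = indicator {l i..u i} x *\<^sub>R F i x" using j by auto
      qed
      with F(2)[of x] x show "(\<lambda>i. indicator {l i..u i} x *\<^sub>R F i x) \<longlonglongrightarrow> f x"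
        by (auto intro: Lim_transform_eventually)
    qed
  qed
qed

text \<open>The domain couples position and memory through u + I, where I is the integral of the
  memory. The memory is therefore approximated first. Then G w1 in \<open>DA\<close> is chosen near
  u + I in the V-norm, with w1 in \<open>DB\<close> close to B (u + I), and u1 = G w1 - I satisfies
  the coupling exactly.\<close>

lemma generator_domain_dense:
  assumes z: "z \<in> phase" and e: "0 < e"
  shows "\<exists>y w. gen_rel ell \<mu> DA A DB B y w \<and> phase.sd z y < e"
proof -
  obtain u v \<xi> where zz: "z = (u, v, \<xi>)" by (cases z)
  have u: "u \<in> DB" and \<xi>: "mem \<xi>" using z zz by (auto simp: phase_def)
  obtain \<xi>1 \<eta>1 where P: "P_rel ell \<mu> DB B \<xi>1 \<eta>1" and \<xi>1: "L2_norm M\<nu> (\<lambda>\<tau>. B (\<xi> \<tau>) - B (\<xi>1 \<tau>)) < e / 2"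
    using square_integrable_approximable[of "\<lambda>\<tau>. B (\<xi> \<tau>)"] \<xi> e unfolding approximable_def mem_iff by (meson half_gt_zero)
  have m1: "mem \<xi>1" using P_rel_mem[OF P] by simp
  obtain v1 where v1: "v1 \<in> DB" "norm (v1 - v) < e / 2" using G_dense[of "e / 2" v] e by auto
  define I where "I = (LINT \<tau>:\<Omega>|lebesgue. \<xi>1 \<tau>)"
  have I: "I \<in> DB" unfolding I_def integral_G(2)[OF m1] by simp
  obtain w1 where w1: "w1 \<in> DB" "norm (w1 - B (u + I)) < e / 2" using G_dense[of "e / 2" "B (u + I)"] e by auto
  define u1 where "u1 = G w1 - I"
  have u1: "u1 \<in> DB" unfolding u1_def using I subspace_DB by (simp add: subspace_diff)
  have Bu: "B u - B u1 = - (w1 - B (u + I))"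
    unfolding u1_def using I u by (simp add: B_diff B_add)
  have "gen_rel ell \<mu> DA A DB B (u1, v1, \<xi>1)
      (v1, - A (u1 + (LINT \<tau>:\<Omega>|lebesgue. \<xi>1 \<tau>)), \<lambda>\<tau>. \<eta>1 \<tau> + \<mu> \<tau> *\<^sub>R v1)"
    using P v1 u1 m1 G_in_DA[OF w1(1)] unfolding gen_rel_def in_phase_iff
    by (auto simp: phase_def u1_def I_def)
  moreover have "phase.sd z (u1, v1, \<xi>1) < e"
  proof -
    let ?d = "(u - u1, v - v1, \<lambda>\<tau>. 1 *\<^sub>R \<xi> \<tau> + (-1) *\<^sub>R \<xi>1 \<tau>)"
    have dX: "?d \<in> phase" using mem_lin[OF \<xi> m1, of 1 "-1"] u u1 subspace_DB by (simp add: phase_def subspace_diff)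
    have L: "L2_norm M\<nu> (\<lambda>\<tau>. B (1 *\<^sub>R \<xi> \<tau> + (-1) *\<^sub>R \<xi>1 \<tau>)) = L2_norm M\<nu> (\<lambda>\<tau>. B (\<xi> \<tau>) - B (\<xi>1 \<tau>))"
    proof (rule L2_norm_Mnu_AE_cong)
      show "square_integrable M\<nu> (\<lambda>\<tau>. B (1 *\<^sub>R \<xi> \<tau> + (-1) *\<^sub>R \<xi>1 \<tau>))"
        using mem_lin[OF \<xi> m1, of 1 "-1"] unfolding mem_iff by blast
      show "AE \<tau> in M\<nu>. B (1 *\<^sub>R \<xi> \<tau> + (-1) *\<^sub>R \<xi>1 \<tau>) = B (\<xi> \<tau>) - B (\<xi>1 \<tau>)"
        using mem_AE_B_lin[OF \<xi> m1, of 1 "-1"] by eventually_elim simp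
    qed
    have "(phase.sn ?d)\<^sup>2 = (norm (w1 - B (u + I)))\<^sup>2 + (norm (v1 - v))\<^sup>2 + (L2_norm M\<nu> (\<lambda>\<tau>. B (\<xi> \<tau>) - B (\<xi>1 \<tau>)))\<^sup>2"
      unfolding phase_sn_components(1)[OF dX] L B_diff[OF u u1] Bu by (simp add: norm_minus_commute)
    \<comment> \<open>Three errors below e / 2 suffice because 3 / 4 < 1.\<close>
    also have "\<dots> \<le> (e / 2)\<^sup>2 + (e / 2)\<^sup>2 + (e / 2)\<^sup>2"
      using w1(2) v1(2) \<xi>1 by (intro add_mono power_mono) auto
    also have "\<dots> < e\<^sup>2" using e by (simp add: power2_eq_square field_simps)
    finally have "phase.sn ?d < e" by (rule power2_less_imp_less) (use e in simp)
    then show ?thesis by (simp add: phase.sd_def st_lin_def zz)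
  qed
  ultimately show ?thesis by blast
qed

end

section \<open>Exponential decay\<close>

context viscoelastic
begin

theorem exponential_decay:
  assumes S: "generated_contraction_semigroup ell \<mu> DA A DB B S"
  obtains K \<omega> where "K > 1" "\<omega> > 0"
    "\<And>z t. z \<in> phase \<Longrightarrow> t \<ge> 0 \<Longrightarrow> phase_norm ell \<mu> B (S t z) \<le> K * phase_norm ell \<mu> B z * exp (- \<omega> * t)"
proof -
  interpret generated_semigroup phase st_lin phase_inner S "gen_rel ell \<mu> DA A DB B"
    by (rule generated_semigroup_phase[OF S])
  obtain \<psi> where \<psi>: "test_fun \<Omega> \<psi>" "\<And>x. \<bar>\<psi> x\<bar> \<le> 1" "(LINT \<tau>:\<Omega>|lebesgue. \<psi> \<tau> * \<mu> \<tau>) > 0"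
    by (rule weight_exists) (rule that)
  define c1 where "c1 = (LINT \<tau>:\<Omega>|lebesgue. \<psi> \<tau> * \<mu> \<tau>)"
  have c1: "c1 > 0" using \<psi>(3) by (simp add: c1_def)
  obtain C where C: "\<And>x. \<bar>deriv \<psi> x\<bar> \<le> C" "continuous_on UNIV \<psi>"
    by (rule test_fun_bounded_continuous[OF \<psi>(1)]) (rule that)
  obtain g where g: "g > 0" "\<And>x. norm (G x) \<le> g * norm x" by (rule G_norm_bound) (rule that)
  \<comment> \<open>\<open>M\<close> bounds the cross terms: the average through g sqrt \<kappa>,
    the product of velocity and position through g with weight c1 / 2.\<close>
  define M where "M = g * sqrt \<kappa> + c1 / 2 * g"
  have M: "M \<ge> 0" using g c1 kappa_nonneg by (simp add: M_def)
  define R where "R = (\<kappa> + (g * C * sqrt \<kappa>)\<^sup>2 / c1 + (sqrt \<kappa> + sqrt \<kappa> * c1 / 2)\<^sup>2 / c1 + c1 / 4) / \<delta>"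
  have R: "R \<ge> 0" unfolding R_def using delta_pos c1 kappa_nonneg by (intro divide_nonneg_pos add_nonneg_nonneg) auto
  \<comment> \<open>\<open>M\<close> outweighs the cross terms, \<open>R\<close> meets the
    requirement of \<open>lyapunov_decreasing\<close>, and the remaining 1 is the coercivity
    constant.\<close>
  define N where "N = 1 + M + R"
  have N0: "N \<ge> 0" using M R by (simp add: N_def)
  have N: "N * \<delta> \<ge> \<kappa> + (g * C * sqrt \<kappa>)\<^sup>2 / c1 + (sqrt \<kappa> + sqrt \<kappa> * c1 / 2)\<^sup>2 / c1 + c1 / 4"
  proof -
    have "R * \<delta> \<le> N * \<delta>" using M delta_pos by (intro mult_right_mono) (auto simp: N_def)
    then show ?thesis using delta_pos by (simp add: R_def)
  qed
  let ?Q = "lyapunov \<psi> N (c1 / 2)"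
  have cross: "\<bar>?Q z z' - N * phase_inner z z'\<bar> \<le> M * (phase.sn z * phase.sn z')" if z: "z \<in> phase" "z' \<in> phase" for z z'
  proof -
    obtain u v \<xi> u' v' \<xi>' where e: "z = (u, v, \<xi>)" "z' = (u', v', \<xi>')" by (cases z, cases z')
    note z' = z[unfolded e]
    have 1: "\<bar>inner v (mem_avg \<psi> \<xi>')\<bar> \<le> g * sqrt \<kappa> * (phase.sn z * phase.sn z')" "\<bar>inner v u'\<bar> \<le> g * (phase.sn z * phase.sn z')"
      unfolding e by (rule lyapunov_cross_terms_bound[OF C(2) \<psi>(2) g z'])+
    have 2: "\<bar>inner v' (mem_avg \<psi> \<xi>)\<bar> \<le> g * sqrt \<kappa> * (phase.sn z * phase.sn z')" "\<bar>inner v' u\<bar> \<le> g * (phase.sn z * phase.sn z')"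
      unfolding e mult.commute[of "phase.sn (u, v, \<xi>)"] by (rule lyapunov_cross_terms_bound[OF C(2) \<psi>(2) g z'(2,1)])+
    have "?Q z z' - N * phase_inner z z' =
        - (inner v (mem_avg \<psi> \<xi>') + inner v' (mem_avg \<psi> \<xi>)) / 2 + c1 / 2 * ((inner v u' + inner v' u) / 2)"
      unfolding lyapunov_def by (simp add: e)
    moreover have "\<bar>- (inner v (mem_avg \<psi> \<xi>') + inner v' (mem_avg \<psi> \<xi>)) / 2\<bar> \<le> g * sqrt \<kappa> * (phase.sn z * phase.sn z')"
    proof -
      have "\<bar>- (p + q) / 2\<bar> \<le> r" if "\<bar>p\<bar> \<le> r" "\<bar>q\<bar> \<le> r" for p q r :: real
        using that by (simp add: abs_le_iff)
      then show ?thesis using 1(1) 2(1) by blast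
    qed
    moreover have "\<bar>c1 / 2 * ((inner v u' + inner v' u) / 2)\<bar> \<le> c1 / 2 * (g * (phase.sn z * phase.sn z'))"
      unfolding abs_mult using 1(2) 2(2) c1 by (intro mult_mono) auto
    ultimately have "\<bar>?Q z z' - N * phase_inner z z'\<bar> \<le> g * sqrt \<kappa> * (phase.sn z * phase.sn z') + c1 / 2 * (g * (phase.sn z * phase.sn z'))"
      by linarith
    then show ?thesis by (simp add: M_def algebra_simps)
  qed
  define D where "D = N + M"
  have D: "D > 0" using M R by (simp add: D_def N_def)
  have est: "phase.sn (S t z) \<le> sqrt (D / 1) * exp (- ((c1 / 4) / (2 * D)) * t) * phase.sn z" if "z \<in> phase" "0 \<le> t" for z t
  proof (rule exponential_stability[where Q = ?Q])
    show "?Q (st_lin a x b y) q = a * ?Q x q + b * ?Q y q" if "x \<in> phase" "y \<in> phase" "q \<in> phase" for x y q a b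
      by (rule lyapunov_lin[OF \<psi>(1) that])
    show "?Q x y = ?Q y x" if "x \<in> phase" "y \<in> phase" for x y by (rule lyapunov_sym[OF that])
    show "\<bar>?Q x y\<bar> \<le> D * phase.sn x * phase.sn y" if xy: "x \<in> phase" "y \<in> phase" for x y
    proof -
      have "N * \<bar>phase_inner x y\<bar> \<le> N * (phase.sn x * phase.sn y)" using phase.cauchy_schwarz[OF xy] N0 by (rule mult_left_mono)
      then have "\<bar>N * phase_inner x y\<bar> \<le> N * (phase.sn x * phase.sn y)" using N0 by (simp add: abs_mult)
      then have "\<bar>?Q x y\<bar> \<le> N * (phase.sn x * phase.sn y) + M * (phase.sn x * phase.sn y)" using cross[OF xy] by linarith
      then show ?thesis by (simp add: D_def algebra_simps)
    qed
    show "1 * (phase.sn x)\<^sup>2 \<le> ?Q x x" if x: "x \<in> phase" for x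
    proof -
      have "N * (phase.sn x)\<^sup>2 - M * (phase.sn x)\<^sup>2 \<le> ?Q x x"
        using cross[OF x x] phase.sn_power2[OF x] by (simp add: power2_eq_square abs_le_iff)
      moreover have "N * (phase.sn x)\<^sup>2 - M * (phase.sn x)\<^sup>2 = (phase.sn x)\<^sup>2 + R * (phase.sn x)\<^sup>2" by (simp add: N_def algebra_simps)
      moreover have "0 \<le> R * (phase.sn x)\<^sup>2" using R by simp
      ultimately show ?thesis by linarith
    qed
    show "2 * ?Q x w \<le> - (c1 / 4) * (phase.sn x)\<^sup>2" if "gen_rel ell \<mu> DA A DB B x w" for x w
      by (rule lyapunov_decreasing[OF \<psi>(1,2) C(1) g c1_def c1 N N0 that])
    show "\<exists>y w. gen_rel ell \<mu> DA A DB B y w \<and> phase.sd x y < e" if "x \<in> phase" "0 < e" for x e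
      by (rule generator_domain_dense[OF that])
  qed (use D c1 that in auto)
  show ?thesis
  \<comment> \<open>Adding 2 makes the constant exceed 1 whatever \<open>D\<close> is; the rate is r
    / (2 C) with r = c1 / 4 and C = \<open>D\<close>.\<close>
  proof (rule that[of "sqrt D + 2" "c1 / 4 / (2 * D)"])
    show "1 < sqrt D + 2" using real_sqrt_ge_zero[of D] D by linarith
    show "0 < c1 / 4 / (2 * D)" using c1 D by simp
    fix z t assume z: "z \<in> phase" and t: "0 \<le> (t::real)"
    have "phase.sn (S t z) \<le> sqrt D * exp (- (c1 / 4 / (2 * D)) * t) * phase.sn z" using est[OF z t] by simp
    also have "\<dots> \<le> (sqrt D + 2) * exp (- (c1 / 4 / (2 * D)) * t) * phase.sn z"
      using z by (intro mult_right_mono) auto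
    finally show "phase_norm ell \<mu> B (S t z) \<le> (sqrt D + 2) * phase_norm ell \<mu> B z * exp (- (c1 / 4 / (2 * D)) * t)"
      using z t by (simp add: phase_norm_eq S_closed mult_ac)
  qed
qed

end

theorem theorem9p1:
  fixes DA DB :: "'h::{real_inner,banach,second_countable_topology} set"
    and A B :: "'h \<Rightarrow> 'h"
    and ell :: ereal and \<mu> :: "real \<Rightarrow> real" and \<delta> :: real
    and S :: "real \<Rightarrow> 'h state \<Rightarrow> 'h state"
  assumes A_sa: "selfadjoint_op DA A"
    and A_pos: "strictly_positive_op DA A"
    and A_cpt: "compact_inverse_op DA A"
    and B_sqrt: "is_sqrt_op DA A DB B"
    and ell_pos: "0 < ell"
    and mu: "kernel_ok ell \<mu>"
    and S_gen: "generated_contraction_semigroup ell \<mu> DA A DB B S"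
    and delta_pos: "\<delta> > 0"
    and mu_decay: "AE s in lebesgue. s \<in> Omega ell \<longrightarrow>
                     (\<forall>d. (\<mu> has_real_derivative d) (at s) \<longrightarrow> d + \<delta> * \<mu> s \<le> 0)"
  shows "\<exists>K>1. \<exists>\<omega>>0. \<forall>z t. in_phase ell \<mu> DB B z \<longrightarrow> t \<ge> 0 \<longrightarrow>
           phase_norm ell \<mu> B (S t z) \<le> K * phase_norm ell \<mu> B z * exp (- \<omega> * t)"
proof -
  interpret viscoelastic DA DB A B ell \<mu> \<delta>
    by unfold_locales fact+
  obtain K \<omega> where "K > 1" "\<omega> > 0"
    "\<And>z t. z \<in> phase \<Longrightarrow> t \<ge> 0 \<Longrightarrow> phase_norm ell \<mu> B (S t z) \<le> K * phase_norm ell \<mu> B z * exp (- \<omega> * t)"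
    by (rule exponential_decay[OF S_gen]) (rule that)
  then show ?thesis unfolding in_phase_iff by blast
qed

end
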